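(* Let $s\ge 3$, let $u^{in}\in H^s(\mathbb T^3)\cap V$, and for $\alpha>0$ let $u_\alpha^{in}\in H^s(\mathbb T^3)\cap V$. Let $0<T<T_{\max}$, where $T_{\max}$ is the maximal time for which a solution of the Euler equations with initial data $u^{in}$ exists and is unique, and let $u,u_\alpha\in C([0,T],H^s(\mathbb T^3))\cap C^1([0,T],H^{s-1}(\mathbb T^3))$ be the solutions of, respectively, the Euler equations with initial data $u^{in}$ and the Euler-Voigt equations (with parameter $\alpha$) with initial data $u_\alpha^{in}$. Then: (i) There is a constant $C>0$, which may depend on $T$ and $u$ but not on $\alpha$, $t$ or $u_\alpha^{in}$, such that for all $t\in[0,T]$, $$\|u(t)-u_\alpha(t)\|_{L^2(\mathbb T^3)}^2+\alpha^2\|\nabla(u(t)-u_\alpha(t))\|_{L^2(\mathbb T^3)}^2$$ $$\leq\left(\|u^{in}-u_\alpha^{in}\|_{L^2(\mathbb T^3)}^2+\alpha^2\|\nabla(u^{in}-u_\alpha^{in})\|_{L^2(\mathbb T^3)}^2\right)e^{Ct}+C\alpha^2(e^{Ct}-1).$$ (ii) Consequently, if $$\|u^{in}-u_\alpha^{in}\|_{L^2(\mathbb T^3)}^2+\alpha^2\|\nabla(u^{in}-u_\alpha^{in})\|_{L^2(\mathbb T^3)}^2\to 0\quad\text{as }\alpha\to0$$ (in particular, when $u_\alpha^{in}=u^{in}$ for all $\alpha>0$), then $u_\alpha\to u$ in $C([0,T],H)$ as $\alpha\to 0$.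
   Context: $\mathbb T^3=[0,1]^3$ is the periodic unit torus. $L^2$ and $H^s$ are the usual Lebesgue and Sobolev spaces on $\mathbb T^3$. $\mathcal V$ is the set of $\mathbb R^3$-valued trigonometric polynomials $\varphi$ on $\mathbb T^3$ with $\nabla\cdot\varphi=0$ and $\int_{\mathbb T^3}\varphi\,dx=0$. $H$ and $V$ are the closures of $\mathcal V$ in $L^2$ and $H^1$, respectively. Euler equations (periodic boundary conditions, zero forcing): $\partial_tu+(u\cdot\nabla)u+\nabla p=0$, $\nabla\cdot u=0$, $u(0)=u^{in}$. For $u^{in}\in H^s\cap V$, $s>5/2$, it is known that a unique solution in $C([0,T_*],H^s\cap V)\cap C^1([0,T_*],H^{s-1}\cap V)$ exists for some $T_*>0$. Euler-Voigt equations with parameter $\alpha>0$ (periodic boundary conditions, zero forcing): $-\alpha^2\partial_t\triangle u_\alpha+\partial_tu_\alpha+(u_\alpha\cdot\nabla)u_\alpha+\nabla p_\alpha=0$, $\nabla\cdot u_\alpha=0$, $u_\alpha(0)=u_\alpha^{in}$. *)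

theory Defs
  imports "HOL-Analysis.Analysis"
begin

text \<open>
  The torus is the cube \<open>[0,1]\<^sup>3\<close> with opposite faces identified. Its boundary is a null set, so
  square integrable functions on the torus are represented by functions on \<open>real ^ 3\<close> of which only
  the values on the cube matter, modulo equality almost everywhere. No periodicity is
  imposed on such representatives: periodicity enters through the periodic test functions in the
  weak derivatives and through the Fourier coefficients.
\<close>

type_synonym field3 = "real ^ 3 \<Rightarrow> real ^ 3"

definition torus :: "(real ^ 3) measure" where
  "torus = lebesgue_on (cbox 0 1)"

definition L2_torus :: "(real ^ 3 \<Rightarrow> 'a :: euclidean_space) set" where
  "L2_torus = {f. f \<in> borel_measurable torus \<and> integrable torus (\<lambda>x. (norm (f x))\<^sup>2)}"

text \<open>On matrix-valued functions, \<open>norm\<close> is the Frobenius norm.\<close>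

definition L2_torus_norm :: "(real ^ 3 \<Rightarrow> 'a :: euclidean_space) \<Rightarrow> real" where
  "L2_torus_norm f = sqrt (\<integral>x. (norm (f x))\<^sup>2 \<partial>torus)"


subsection \<open>Sobolev spaces of real order\<close>

definition wave_vec :: "int ^ 3 \<Rightarrow> real ^ 3" where
  "wave_vec k = (\<chi> j. 2 * pi * of_int (k $ j))"

definition fourier_coeff :: "field3 \<Rightarrow> int ^ 3 \<Rightarrow> complex ^ 3" where
  "fourier_coeff f k =
     (\<chi> i. \<integral>x. complex_of_real (f x $ i) * cis (- (wave_vec k \<bullet> x)) \<partial>torus)"

text \<open>
  The Bessel-potential norm \<open>\<parallel>(1 - \<Delta>)\<^bsup>r/2\<^esup> f\<parallel>\<close> in \<open>L\<^sup>2\<close>. For \<open>r = 1\<close> it is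
  the square root of \<open>\<parallel>f\<parallel>\<^sup>2 + \<parallel>\<nabla>f\<parallel>\<^sup>2\<close>. Only orders \<open>r \<ge> 0\<close> are used.
\<close>

definition sobolev :: "real \<Rightarrow> field3 set" where
  "sobolev r = {f \<in> L2_torus.
     (\<lambda>k. (1 + (norm (wave_vec k))\<^sup>2) powr r * (norm (fourier_coeff f k))\<^sup>2) summable_on UNIV}"

definition sobolev_norm :: "real \<Rightarrow> field3 \<Rightarrow> real" where
  "sobolev_norm r f =
     sqrt (\<Sum>\<^sub>\<infinity>k. (1 + (norm (wave_vec k))\<^sup>2) powr r * (norm (fourier_coeff f k))\<^sup>2)"


subsection \<open>Weak derivatives\<close>

definition partial :: "3 \<Rightarrow> (real ^ 3 \<Rightarrow> real) \<Rightarrow> real ^ 3 \<Rightarrow> real" where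
  "partial j \<phi> x = frechet_derivative \<phi> (at x) (axis j 1)"

coinductive smooth :: "(real ^ 3 \<Rightarrow> real) \<Rightarrow> bool" where
  "(\<forall>x. \<phi> differentiable (at x)) \<Longrightarrow> (\<forall>j. smooth (partial j \<phi>)) \<Longrightarrow> smooth \<phi>"

definition test_functions :: "(real ^ 3 \<Rightarrow> real) set" where
  "test_functions = {\<phi>. smooth \<phi> \<and> (\<forall>x j. \<phi> (x + axis j 1) = \<phi> x)}"

definition has_weak_partial ::
    "(real ^ 3 \<Rightarrow> real) \<Rightarrow> 3 \<Rightarrow> (real ^ 3 \<Rightarrow> real) \<Rightarrow> bool" where
  "has_weak_partial f j g \<longleftrightarrow> (\<forall>\<phi>\<in>test_functions.
     (\<integral>x. f x * partial j \<phi> x \<partial>torus) = - (\<integral>x. g x * \<phi> x \<partial>torus))"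

definition has_weak_gradient :: "(real ^ 3 \<Rightarrow> real) \<Rightarrow> field3 \<Rightarrow> bool" where
  "has_weak_gradient p q \<longleftrightarrow>
     p \<in> L2_torus \<and> q \<in> L2_torus \<and> (\<forall>j. has_weak_partial p j (\<lambda>x. q x $ j))"

text \<open>The entry \<open>G x $ i $ j\<close> is the \<open>j\<close>-th partial derivative of the \<open>i\<close>-th component, so
  \<open>G x *v f x\<close> is \<open>((f \<bullet> \<nabla>) f) x\<close>.\<close>

definition has_weak_jacobian :: "field3 \<Rightarrow> (real ^ 3 \<Rightarrow> real ^ 3 ^ 3) \<Rightarrow> bool" where
  "has_weak_jacobian f G \<longleftrightarrow>
     f \<in> L2_torus \<and> G \<in> L2_torus \<and>
     (\<forall>i j. has_weak_partial (\<lambda>x. f x $ i) j (\<lambda>x. G x $ i $ j))"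

text \<open>\<open>\<parallel>\<nabla>f\<parallel>\<close> in \<open>L\<^sup>2\<close>; the Jacobian of an \<open>H\<^sup>1\<close> field exists and is unique almost everywhere,
  so the value does not depend on the choice.\<close>

definition grad_norm :: "field3 \<Rightarrow> real" where
  "grad_norm f = L2_torus_norm (SOME G. has_weak_jacobian f G)"

definition has_weak_laplacian :: "field3 \<Rightarrow> field3 \<Rightarrow> bool" where
  "has_weak_laplacian f g \<longleftrightarrow>
     f \<in> L2_torus \<and> g \<in> L2_torus \<and>
     (\<forall>i. \<forall>\<phi>\<in>test_functions.
        (\<integral>x. f x $ i * (\<Sum>j\<in>UNIV. partial j (partial j \<phi>) x) \<partial>torus) = (\<integral>x. g x $ i * \<phi> x \<partial>torus))"

definition weakly_div_free :: "field3 \<Rightarrow> bool" where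
  "weakly_div_free f \<longleftrightarrow> (\<forall>\<phi>\<in>test_functions.
     (\<integral>x. (\<Sum>j\<in>UNIV. f x $ j * partial j \<phi> x) \<partial>torus) = 0)"


subsection \<open>The spaces \<open>H\<close> and \<open>V\<close>\<close>

definition trig_polynomial :: "field3 \<Rightarrow> bool" where
  "trig_polynomial \<phi> \<longleftrightarrow> (\<exists>K c d. finite K \<and>
     \<phi> = (\<lambda>x. \<Sum>k\<in>K. cos (wave_vec k \<bullet> x) *\<^sub>R c k + sin (wave_vec k \<bullet> x) *\<^sub>R d k))"

definition solenoidal_trig :: "field3 set" where
  "solenoidal_trig = {\<phi>. trig_polynomial \<phi> \<and>
     (\<forall>x. (\<Sum>j\<in>UNIV. partial j (\<lambda>y. \<phi> y $ j) x) = 0) \<and> (\<integral>x. \<phi> x \<partial>torus) = 0}"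

definition H_space :: "field3 set" where
  "H_space = {f \<in> L2_torus.
     \<forall>\<epsilon>>0. \<exists>\<phi>\<in>solenoidal_trig. L2_torus_norm (\<lambda>x. f x - \<phi> x) < \<epsilon>}"

definition V_space :: "field3 set" where
  "V_space = {f \<in> sobolev 1.
     \<forall>\<epsilon>>0. \<exists>\<phi>\<in>solenoidal_trig. sobolev_norm 1 (\<lambda>x. f x - \<phi> x) < \<epsilon>}"


subsection \<open>Curves on \<open>[0,T]\<close> with values in these spaces\<close>

definition C0_sobolev :: "real \<Rightarrow> real \<Rightarrow> (real \<Rightarrow> field3) \<Rightarrow> bool" where
  "C0_sobolev T r u \<longleftrightarrow> (\<forall>t\<in>{0..T}. u t \<in> sobolev r \<and>
     ((\<lambda>\<tau>. sobolev_norm r (\<lambda>x. u \<tau> x - u t x)) \<longlongrightarrow> 0) (at t within {0..T}))"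

definition C0_H :: "real \<Rightarrow> (real \<Rightarrow> field3) \<Rightarrow> bool" where
  "C0_H T u \<longleftrightarrow> (\<forall>t\<in>{0..T}. u t \<in> H_space \<and>
     ((\<lambda>\<tau>. L2_torus_norm (\<lambda>x. u \<tau> x - u t x)) \<longlongrightarrow> 0) (at t within {0..T}))"

text \<open>The curve \<open>u\<close> is in \<open>C\<^sup>1([0,T], H\<^sup>r)\<close> with time derivative \<open>v\<close> (one-sided at \<open>0\<close> and \<open>T\<close>).\<close>

definition C1_sobolev :: "real \<Rightarrow> real \<Rightarrow> (real \<Rightarrow> field3) \<Rightarrow> (real \<Rightarrow> field3) \<Rightarrow> bool" where
  "C1_sobolev T r u v \<longleftrightarrow> C0_sobolev T r u \<and> C0_sobolev T r v \<and>
     (\<forall>t\<in>{0..T}.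
        ((\<lambda>\<tau>. sobolev_norm r (\<lambda>x. (u \<tau> x - u t x) /\<^sub>R (\<tau> - t) - v t x)) \<longlongrightarrow> 0)
          (at t within {0..T}))"


subsection \<open>Solutions\<close>

text \<open>
  For \<open>s \<ge> 3\<close> every term of either equation is in \<open>L\<^sup>2\<close> at each time, so the equations are required
  to hold almost everywhere on the torus for every \<open>t \<in> [0,T]\<close>. The pressure is a function on the
  torus, that is, periodic.
\<close>

definition euler_solution :: "real \<Rightarrow> real \<Rightarrow> field3 \<Rightarrow> (real \<Rightarrow> field3) \<Rightarrow> bool" where
  "euler_solution s T uin u \<longleftrightarrow>
     C0_sobolev T s u \<and>
     (\<exists>v. C1_sobolev T (s - 1) u v \<and>
       (\<forall>t\<in>{0..T}. weakly_div_free (u t) \<and>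
         (\<exists>G p q. has_weak_jacobian (u t) G \<and> has_weak_gradient p q \<and>
            (AE x in torus. v t x + G x *v u t x + q x = 0)))) \<and>
     (AE x in torus. u 0 x = uin x)"

text \<open>Here \<open>L t\<close> is the Laplacian of \<open>u t\<close>, and \<open>m\<close> is the time derivative of \<open>L\<close>. Both exist
  for every \<open>u\<close> in \<open>C\<^sup>1([0,T], H\<^bsup>s-1\<^esup>)\<close>.\<close>

definition euler_voigt_solution ::
    "real \<Rightarrow> real \<Rightarrow> real \<Rightarrow> field3 \<Rightarrow> (real \<Rightarrow> field3) \<Rightarrow> bool" where
  "euler_voigt_solution \<alpha> s T uin u \<longleftrightarrow>
     C0_sobolev T s u \<and>
     (\<exists>v L m. C1_sobolev T (s - 1) u v \<and>
       (\<forall>t\<in>{0..T}. has_weak_laplacian (u t) (L t)) \<and> C1_sobolev T (s - 3) L m \<and>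
       (\<forall>t\<in>{0..T}. weakly_div_free (u t) \<and>
         (\<exists>G p q. has_weak_jacobian (u t) G \<and> has_weak_gradient p q \<and>
            (AE x in torus. - \<alpha>\<^sup>2 *\<^sub>R m t x + v t x + G x *v u t x + q x = 0)))) \<and>
     (AE x in torus. u 0 x = uin x)"

definition euler_Tmax :: "real \<Rightarrow> field3 \<Rightarrow> ereal" where
  "euler_Tmax s uin = Sup {ereal T | T. T > 0 \<and>
     (\<exists>u. euler_solution s T uin u \<and>
       (\<forall>u'. euler_solution s T uin u' \<longrightarrow> (\<forall>t\<in>{0..T}. AE x in torus. u' t x = u t x)))}"

definition voigt_energy :: "real \<Rightarrow> field3 \<Rightarrow> real" where
  "voigt_energy \<alpha> f = (L2_torus_norm f)\<^sup>2 + \<alpha>\<^sup>2 * (grad_norm f)\<^sup>2"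

definition converges_in_C0_H ::
    "real \<Rightarrow> (real \<Rightarrow> real \<Rightarrow> field3) \<Rightarrow> (real \<Rightarrow> field3) \<Rightarrow> bool" where
  "converges_in_C0_H T ua u \<longleftrightarrow>
     C0_H T u \<and> (\<forall>\<alpha>>0. C0_H T (ua \<alpha>)) \<and>
     ((\<lambda>\<alpha>. SUP t\<in>{0..T}. L2_torus_norm (\<lambda>x. ua \<alpha> t x - u t x)) \<longlongrightarrow> 0) (at_right 0)"

end

theory Submission
  imports Defs
begin

text \<open>
  Write \<open>w = u - u\<^sub>\<alpha>\<close> and let \<open>E = \<parallel>w\<parallel>\<^sup>2 + \<alpha>\<^sup>2 \<parallel>\<nabla>w\<parallel>\<^sup>2\<close> be the Voigt energy of the difference.
  Subtract the two equations and pair the result with \<open>w\<close> in \<open>L\<^sup>2\<close>. The pressure gradients drop out because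
  \<open>w\<close> is solenoidal, and of \<open>(u \<cdot> \<nabla>)u - (u\<^sub>\<alpha> \<cdot> \<nabla>)u\<^sub>\<alpha> = (w \<cdot> \<nabla>)u + (u\<^sub>\<alpha> \<cdot> \<nabla>)w\<close> the second summand
  is orthogonal to \<open>w\<close> because \<open>u\<^sub>\<alpha>\<close> is solenoidal. The Voigt term \<open>- \<alpha>\<^sup>2 \<partial>\<^sub>t\<Delta>u\<^sub>\<alpha>\<close> supplies the time
  derivative of \<open>\<alpha>\<^sup>2 \<parallel>\<nabla>w\<parallel>\<^sup>2\<close>, except that \<open>\<partial>\<^sub>t\<nabla>u\<close> has to be added and subtracted. There remains
  \<open>E' = 2 \<alpha>\<^sup>2 \<langle>\<nabla>\<partial>\<^sub>tu, \<nabla>w\<rangle> - 2 \<langle>(w \<cdot> \<nabla>)u, w\<rangle> \<le> C E + \<alpha>\<^sup>2 K\<^sup>2\<close>,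
  where \<open>K\<close> bounds \<open>\<parallel>\<nabla>\<partial>\<^sub>tu\<parallel>\<close> and \<open>C\<close> comes from the maximum of \<open>|\<nabla>u|\<close>. Both bounds involve the Euler solution
  alone, so Gronwall's lemma gives part (i) with a constant independent of \<open>\<alpha>\<close> and of the Voigt data. Since
  \<open>E\<close> dominates \<open>\<parallel>w\<parallel>\<^sup>2\<close>, part (ii) follows by taking the supremum over \<open>t\<close>; both solutions stay in
  \<open>H\<close> because the equations preserve the mean.

  All linear terms are treated through Fourier coefficients. The energy is a weighted \<open>\<ell>\<^sup>2\<close> norm of the
  coefficients of \<open>w\<close> (\<open>voigt_energy_wsq\<close>) and is differentiated as such (\<open>weights.wsq_has_derivative\<close>);
  the pressure and the Laplacian act on each coefficient separately (\<open>gradient_orthogonal_solenoidal\<close>,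
  \<open>laplacian_time_derivative\<close>). The quadratic terms live in physical space. The bridge is
  Parseval's formula for functions with absolutely convergent Fourier series (\<open>parseval_wiener\<close>), a class that
  contains the \<open>H\<^sup>3\<close> fields and their Jacobians because the lattice sum of \<open>(1 + |k|\<^sup>2)\<^sup>-\<^sup>2\<close> converges in
  dimension three. Partial sums of such series are trigonometric polynomials, hence admissible test functions, and
  this is how the weak form of \<open>\<nabla> \<cdot> u\<^sub>\<alpha> = 0\<close> yields the cancellation (\<open>transport_antisymmetric\<close>).
  That the series represents the function rests on the completeness of the
  trigonometric system (\<open>trig_orthogonal_AE_0\<close>).
\<close>

section \<open>The measure on the torus\<close>

lemma space_torus: "space torus = cbox 0 1"
  by (simp add: torus_def)

lemma finite_measure_torus: "finite_measure torus"
  unfolding torus_def by (rule finite_measure_lebesgue_on) simp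

interpretation torus: finite_measure torus
  by (rule finite_measure_torus)

lemma measure_torus: "measure torus (space torus) = 1"
proof -
  have "measure torus (cbox 0 1) = measure lebesgue (cbox 0 (1::real^3))"
    unfolding torus_def by (subst measure_restrict_space) auto
  also have "\<dots> = 1"
    using content_cbox_cart[of "0::real^3" 1] by (auto simp: interval_ne_empty_cart)
  finally show ?thesis by (simp add: space_torus)
qed

lemma measurable_torus_borel: "f \<in> borel_measurable borel \<Longrightarrow> f \<in> borel_measurable torus"
  unfolding torus_def
  by (rule measurable_restrict_space1, rule measurable_completion) simp

lemma measurable_torus_continuous:
  fixes f :: "real^3 \<Rightarrow> 'a::topological_space"
  assumes "continuous_on UNIV f"
  shows "f \<in> borel_measurable torus"
  by (rule measurable_torus_borel) (rule borel_measurable_continuous_onI[OF assms])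

lemma integrable_mult_bounded:
  fixes f g :: "'a \<Rightarrow> real"
  assumes f: "integrable M f" and g: "g \<in> borel_measurable M" and b: "AE x in M. \<bar>g x\<bar> \<le> c"
  shows "integrable M (\<lambda>x. f x * g x)"
proof (rule Bochner_Integration.integrable_bound)
  show "integrable M (\<lambda>x. c * f x)" using f by simp
  show "(\<lambda>x. f x * g x) \<in> borel_measurable M" using f g by measurable
  show "AE x in M. norm (f x * g x) \<le> norm (c * f x)"
    using b
  proof eventually_elim
    case (elim x)
    have "\<bar>f x\<bar> * \<bar>g x\<bar> \<le> \<bar>f x\<bar> * \<bar>c\<bar>" using elim by (intro mult_left_mono) auto
    then show ?case by (simp add: abs_mult mult.commute)
  qed
qed

section \<open>Trigonometric polynomials\<close>

text \<open>Real trigonometric polynomials, generated as an algebra rather than listed by coefficients: products such as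
  \<open>P Q\<close> and \<open>P\<^sup>2\<close> then belong to the class by definition, and properties follow by rule induction.\<close>

inductive trigp :: "(real^3 \<Rightarrow> real) \<Rightarrow> bool" where
  const: "trigp (\<lambda>x. c)"
| cos: "trigp (\<lambda>x. cos (wave_vec k \<bullet> x))"
| sin: "trigp (\<lambda>x. sin (wave_vec k \<bullet> x))"
| add: "trigp f \<Longrightarrow> trigp g \<Longrightarrow> trigp (\<lambda>x. f x + g x)"
| mult: "trigp f \<Longrightarrow> trigp g \<Longrightarrow> trigp (\<lambda>x. f x * g x)"

lemma trigp_cmult: "trigp f \<Longrightarrow> trigp (\<lambda>x. c * f x)"
  by (intro trigp.intros)

lemma trigp_sum: "(\<And>i. i \<in> I \<Longrightarrow> trigp (f i)) \<Longrightarrow> trigp (\<lambda>x. \<Sum>i\<in>I. f i x)"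
  by (induction I rule: infinite_finite_induct) (auto intro: trigp.intros)

lemma trigp_uminus: "trigp f \<Longrightarrow> trigp (\<lambda>x. - f x)"
  using trigp_cmult[of f "-1"] by simp

lemma trigp_diff: "trigp f \<Longrightarrow> trigp g \<Longrightarrow> trigp (\<lambda>x. f x - g x)"
  using trigp.add[OF _ trigp_uminus, of f g] by simp

lemma wave_vec_zero [simp]: "wave_vec 0 = 0"
  by (simp add: wave_vec_def vec_eq_iff)
lemma wave_vec_add: "wave_vec (k + l) = wave_vec k + wave_vec l"
  by (simp add: wave_vec_def vec_eq_iff algebra_simps)
lemma wave_vec_diff: "wave_vec (k - l) = wave_vec k - wave_vec l"
  by (simp add: wave_vec_def vec_eq_iff algebra_simps)
lemma wave_vec_minus: "wave_vec (- l) = - wave_vec l"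
  by (simp add: wave_vec_def vec_eq_iff algebra_simps)

lemma has_derivative_cos_wave:
  "((\<lambda>x. cos (wave_vec k \<bullet> x)) has_derivative (\<lambda>h. - sin (wave_vec k \<bullet> x) * (wave_vec k \<bullet> h))) (at x)"
  by (auto intro!: derivative_eq_intros)

lemma has_derivative_sin_wave:
  "((\<lambda>x. sin (wave_vec k \<bullet> x)) has_derivative (\<lambda>h. cos (wave_vec k \<bullet> x) * (wave_vec k \<bullet> h))) (at x)"
  by (auto intro!: derivative_eq_intros)

lemma partial_eqI: "(f has_derivative f') (at x) \<Longrightarrow> partial j f x = f' (axis j 1)"
  unfolding partial_def by (metis frechet_derivative_at)

lemma partial_cos: "partial j (\<lambda>x. cos (wave_vec k \<bullet> x)) x = - (wave_vec k $ j * sin (wave_vec k \<bullet> x))"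
  by (subst partial_eqI[OF has_derivative_cos_wave]) (simp add: inner_axis)

lemma partial_sin: "partial j (\<lambda>x. sin (wave_vec k \<bullet> x)) x = wave_vec k $ j * cos (wave_vec k \<bullet> x)"
  by (subst partial_eqI[OF has_derivative_sin_wave]) (simp add: inner_axis)

lemma partial_add:
  assumes "f differentiable (at x)" "g differentiable (at x)"
  shows "partial j (\<lambda>x. f x + g x) x = partial j f x + partial j g x"
  using assms unfolding frechet_derivative_works
  by (subst partial_eqI[OF has_derivative_add]) (auto simp: partial_def)

lemma partial_mult:
  assumes "f differentiable (at x)" "g differentiable (at x)"
  shows "partial j (\<lambda>x. f x * g x) x = f x * partial j g x + partial j f x * g x"
  using assms unfolding frechet_derivative_works
  by (subst partial_eqI[OF has_derivative_mult]) (auto simp: partial_def)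

lemma partial_const: "partial j (\<lambda>x. c) x = 0"
  by (subst partial_eqI[OF has_derivative_const]) auto

lemma trigp_differentiable: "trigp f \<Longrightarrow> f differentiable (at x)"
proof (induction rule: trigp.induct)
  case (cos k) then show ?case using has_derivative_cos_wave differentiable_def by blast
next
  case (sin k) then show ?case using has_derivative_sin_wave differentiable_def by blast
qed auto

lemma trigp_partial: "trigp f \<Longrightarrow> trigp (partial j f)"
proof (induction rule: trigp.induct)
  case (const c)
  have "partial j (\<lambda>x. c) = (\<lambda>x. 0)" by (simp add: partial_const fun_eq_iff)
  then show ?case by (simp add: trigp.const)
next
  case (cos k)
  have "partial j (\<lambda>x. cos (wave_vec k \<bullet> x)) = (\<lambda>x. (- (wave_vec k $ j)) * sin (wave_vec k \<bullet> x))"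
    by (simp add: partial_cos fun_eq_iff)
  then show ?case by (metis trigp_cmult trigp.sin)
next
  case (sin k)
  have "partial j (\<lambda>x. sin (wave_vec k \<bullet> x)) = (\<lambda>x. (wave_vec k $ j) * cos (wave_vec k \<bullet> x))"
    by (simp add: partial_sin fun_eq_iff)
  then show ?case by (metis trigp_cmult trigp.cos)
next
  case (add f g)
  have "partial j (\<lambda>x. f x + g x) = (\<lambda>x. partial j f x + partial j g x)"
    using add by (simp add: partial_add trigp_differentiable fun_eq_iff)
  then show ?case using add by (simp add: trigp.add)
next
  case (mult f g)
  have "partial j (\<lambda>x. f x * g x) = (\<lambda>x. f x * partial j g x + partial j f x * g x)"
    using mult by (simp add: partial_mult trigp_differentiable fun_eq_iff)
  then show ?case using mult by (auto intro!: trigp.add trigp.mult)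
qed

text \<open>The class is closed under partial derivatives, so it is itself a witness for coinduction.\<close>

lemma trigp_smooth: "trigp f \<Longrightarrow> smooth f"
  by (coinduction arbitrary: f) (auto intro: trigp_differentiable trigp_partial)

lemma wave_vec_axis: "wave_vec k \<bullet> axis j 1 = 2 * pi * of_int (k $ j)"
  by (simp add: inner_axis wave_vec_def)

lemma trigp_periodic: "trigp f \<Longrightarrow> f (x + axis j 1) = f x"
proof (induction rule: trigp.induct)
  case (cos k)
  show ?case
    by (simp only: inner_add_right wave_vec_axis cos_add cos_int_2pin sin_int_2pin mult_1_right mult_zero_right diff_zero)
next
  case (sin k)
  show ?case
    by (simp only: inner_add_right wave_vec_axis sin_add cos_int_2pin sin_int_2pin mult_1_right mult_zero_right add_0_right)
qed auto

lemma trigp_test_function: "trigp f \<Longrightarrow> f \<in> test_functions"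
  by (simp add: test_functions_def trigp_smooth trigp_periodic)

lemma trigp_continuous: "trigp f \<Longrightarrow> continuous_on S f"
  by (induction rule: trigp.induct) (auto intro!: continuous_intros)

lemma trigp_measurable [measurable]: "trigp f \<Longrightarrow> f \<in> borel_measurable torus"
  by (rule measurable_torus_continuous) (rule trigp_continuous)

lemma trigp_bounded: "trigp f \<Longrightarrow> \<exists>B. \<forall>x. \<bar>f x\<bar> \<le> B"
proof (induction rule: trigp.induct)
  case (add f g)
  then obtain B C where "\<forall>x. \<bar>f x\<bar> \<le> B" "\<forall>x. \<bar>g x\<bar> \<le> C" by auto
  then have "\<bar>f x + g x\<bar> \<le> B + C" for x
    by (intro order_trans[OF abs_triangle_ineq] add_mono) auto
  then show ?case by blast
next
  case (mult f g)
  then obtain B C where BC: "\<forall>x. \<bar>f x\<bar> \<le> B" "\<forall>x. \<bar>g x\<bar> \<le> C" by auto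
  then have "\<bar>f x * g x\<bar> \<le> B * C" for x unfolding abs_mult
    by (intro mult_mono) (auto intro: order_trans[OF abs_ge_zero])
  then show ?case by blast
qed (auto intro: abs_cos_le_one abs_sin_le_one)

lemma integrable_mult_trigp:
  assumes "integrable torus f" "trigp g"
  shows "integrable torus (\<lambda>x. f x * g x)"
proof -
  obtain B where "\<forall>x. \<bar>g x\<bar> \<le> B" using trigp_bounded assms(2) by blast
  then show ?thesis
    by (intro integrable_mult_bounded[where c = B] assms trigp_measurable) auto
qed

lemma integrable_trigp: "trigp g \<Longrightarrow> integrable torus g"
  using integrable_mult_trigp[of "\<lambda>x. 1" g] by simp

section \<open>Orthogonality of waves\<close>

lemma integral_cis_unit_interval:
  "(\<integral>x. indicator {0..1} x *\<^sub>R cis (2 * pi * of_int n * x) \<partial>lborel) = (if n = 0 then 1 else 0)"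
proof (cases "n = 0")
  case True
  then show ?thesis by simp
next
  case False
  define w where "w = 2 * pi * real_of_int n"
  have w: "w \<noteq> 0" using False by (simp add: w_def)
  have cw: "cis w = 1" unfolding w_def using cis_multiple_2pi by simp
  have "(\<integral>x. indicator {0..1} x *\<^sub>R cis (w * x) \<partial>lborel) = (cis (w * 1) / (\<i> * w)) - (cis (w * 0) / (\<i> * w))"
  proof (rule integral_FTC_atLeastAtMost)
    fix x :: real
    show "((\<lambda>x. cis (w * x) / (\<i> * w)) has_vector_derivative cis (w * x)) (at x within {0..1})"
    proof -
      have "((\<lambda>z. exp (\<i> * (w * z)) / (\<i> * w)) has_field_derivative exp (\<i> * (w * x))) (at (complex_of_real x))"
        using w by (auto intro!: derivative_eq_intros simp: field_simps)
      from has_vector_derivative_real_field[OF this] show ?thesis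
        by (simp add: cis_conv_exp)
    qed
  qed (auto intro!: continuous_intros)
  also have "\<dots> = 0" by (simp add: cw)
  finally show ?thesis using False by (simp add: w_def)
qed

lemma integral_torus_borel:
  fixes f :: "real^3 \<Rightarrow> 'a::{banach, second_countable_topology}"
  assumes "f \<in> borel_measurable borel"
  shows "(\<integral>x. f x \<partial>torus) = (\<integral>x. indicator (cbox 0 1) x *\<^sub>R f x \<partial>lborel)"
proof -
  have "(\<integral>x. f x \<partial>torus) = (\<integral>x. indicator (cbox 0 1) x *\<^sub>R f x \<partial>lebesgue)"
    unfolding torus_def by (rule integral_restrict_space) simp
  also have "\<dots> = (\<integral>x. indicator (cbox 0 1) x *\<^sub>R f x \<partial>lborel)"
    by (rule integral_completion) (use assms in measurable)
  finally show ?thesis .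
qed

lemma cis_sum: "finite I \<Longrightarrow> cis (\<Sum>i\<in>I. f i) = (\<Prod>i\<in>I. cis (f i))"
  by (induction I rule: finite_induct) (auto simp: cis_mult[symmetric])

text \<open>On the cube the exponential is a product of functions of one coordinate, and Lebesgue measure is the product
  of its one-dimensional factors; the integral is a product of three integrals over \<open>[0,1]\<close>.\<close>

lemma integral_cis_wave:
  "(\<integral>x. cis (wave_vec k \<bullet> x) \<partial>torus) = (if k = 0 then 1 else 0)"
proof -
  let ?g = "\<lambda>b t. indicator {0..1} t *\<^sub>R cis ((wave_vec k \<bullet> b) * t)"
  interpret P: product_sigma_finite "\<lambda>b::real^3. lborel :: real measure" ..
  have int: "integrable lborel (?g b)" for b
    unfolding set_integrable_def[symmetric]
    by (rule borel_integrable_atLeastAtMost') (auto intro!: continuous_intros)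
  have prod: "indicator (cbox 0 1) x *\<^sub>R cis (wave_vec k \<bullet> x) = (\<Prod>b\<in>Basis. ?g b (x \<bullet> b))" for x :: "real^3"
  proof -
    have "cis (wave_vec k \<bullet> x) = (\<Prod>b\<in>Basis. cis ((wave_vec k \<bullet> b) * (x \<bullet> b)))"
      by (subst euclidean_inner) (simp add: cis_sum)
    moreover have "indicator (cbox 0 1) x = (\<Prod>b\<in>Basis. indicator {0..1} (x \<bullet> b) :: real)"
    proof (cases "x \<in> cbox 0 1")
      case True
      then have "x \<bullet> b \<in> {0..1}" if "b \<in> Basis" for b
        using that by (auto simp: mem_box_cart Basis_vec_def inner_axis)
      then show ?thesis using True by simp
    next
      case False
      then obtain j where "x \<bullet> axis j 1 \<notin> {0..1}"
        by (auto simp: mem_box_cart inner_axis)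
      moreover have "axis j (1::real) \<in> Basis" by (auto simp: Basis_vec_def)
      ultimately have "(\<Prod>b\<in>Basis. indicator {0..1} (x \<bullet> b) :: real) = 0"
        by (intro prod_zero) (auto simp: indicator_def)
      then show ?thesis using False by simp
    qed
    ultimately show ?thesis
      by (simp add: scaleR_conv_of_real prod.distrib)
  qed
  have "(\<integral>x. cis (wave_vec k \<bullet> x) \<partial>torus) = (\<integral>x. indicator (cbox 0 1) x *\<^sub>R cis (wave_vec k \<bullet> x) \<partial>lborel)"
    by (rule integral_torus_borel) (auto intro!: borel_measurable_continuous_onI continuous_intros)
  also have "\<dots> = (\<integral>x. (\<Prod>b\<in>Basis. ?g b (x \<bullet> b)) \<partial>lborel)"
    by (simp only: prod)
  also have "\<dots> = (\<integral>x. (\<Prod>b\<in>Basis. ?g b (x b)) \<partial>Pi\<^sub>M (Basis :: (real^3) set) (\<lambda>b. lborel))"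
  proof -
    have "(\<lambda>x::real^3. \<Prod>b\<in>Basis. ?g b (x \<bullet> b)) = (\<lambda>x. indicator (cbox 0 1) x *\<^sub>R cis (wave_vec k \<bullet> x))"
      by (simp only: prod)
    also have "\<dots> \<in> borel_measurable borel"
      by (intro borel_measurable_scaleR borel_measurable_indicator borel_measurable_continuous_onI continuous_intros) auto
    finally have m: "(\<lambda>x::real^3. \<Prod>b\<in>Basis. ?g b (x \<bullet> b)) \<in> borel_measurable borel" .
    show ?thesis
      unfolding lborel_def[where 'a="real^3"] lborel_eq_real[symmetric]
      by (subst integral_distr[OF _ m]) auto
  qed
  also have "\<dots> = (\<Prod>b\<in>Basis. integral\<^sup>L lborel (?g b))"
    by (rule P.product_integral_prod) (auto intro: int)
  also have "\<dots> = (\<Prod>j\<in>UNIV. if k $ j = 0 then 1 else 0)"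
  proof -
    have B: "(Basis :: (real^3) set) = (\<lambda>j. axis j 1) ` UNIV" by (auto simp: Basis_vec_def)
    have "inj (\<lambda>j::3. axis j (1::real))" by (auto simp: inj_on_def axis_eq_axis)
    then show ?thesis
      unfolding B by (simp add: prod.reindex wave_vec_axis integral_cis_unit_interval)
  qed
  also have "\<dots> = (if k = 0 then 1 else 0)"
    by (auto simp: vec_eq_iff)
  finally show ?thesis .
qed

lemma integral_cos_wave: "(\<integral>x. cos (wave_vec k \<bullet> x) \<partial>torus) = (if k = 0 then 1 else 0)"
  and integral_sin_wave: "(\<integral>x. sin (wave_vec k \<bullet> x) \<partial>torus) = 0"
proof -
  have int: "integrable torus (\<lambda>x. cis (wave_vec k \<bullet> x))"
    by (rule torus.integrable_const_bound[where B=1])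
       (auto intro!: measurable_torus_continuous continuous_intros)
  show "(\<integral>x. cos (wave_vec k \<bullet> x) \<partial>torus) = (if k = 0 then 1 else 0)"
    using integral_Re[OF int] by (simp add: integral_cis_wave split: if_splits)
  show "(\<integral>x. sin (wave_vec k \<bullet> x) \<partial>torus) = 0"
    using integral_Im[OF int] by (simp add: integral_cis_wave split: if_splits)
qed

section \<open>Completeness of the trigonometric system\<close>

definition cos_coeff :: "int^3 \<Rightarrow> (real^3 \<Rightarrow> real) \<Rightarrow> real" where
  "cos_coeff k f = (\<integral>x. f x * cos (wave_vec k \<bullet> x) \<partial>torus)"
definition sin_coeff :: "int^3 \<Rightarrow> (real^3 \<Rightarrow> real) \<Rightarrow> real" where
  "sin_coeff k f = (\<integral>x. f x * sin (wave_vec k \<bullet> x) \<partial>torus)"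

text \<open>The functions that the trigonometric system cannot distinguish from zero; the goal of this section is that
  they vanish almost everywhere.\<close>

definition trig_orthogonal :: "(real^3 \<Rightarrow> real) \<Rightarrow> bool" where
  "trig_orthogonal f \<longleftrightarrow> integrable torus f \<and> (\<forall>k. cos_coeff k f = 0 \<and> sin_coeff k f = 0)"

lemma trig_product_to_sum:
  fixes x :: "real^3"
  shows "cos (wave_vec k \<bullet> x) * cos (wave_vec l \<bullet> x) = (cos (wave_vec (k - l) \<bullet> x) + cos (wave_vec (k + l) \<bullet> x)) / 2"
    "sin (wave_vec k \<bullet> x) * sin (wave_vec l \<bullet> x) = (cos (wave_vec (k - l) \<bullet> x) - cos (wave_vec (k + l) \<bullet> x)) / 2"
    "sin (wave_vec k \<bullet> x) * cos (wave_vec l \<bullet> x) = (sin (wave_vec (k + l) \<bullet> x) + sin (wave_vec (k - l) \<bullet> x)) / 2"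
    "cos (wave_vec k \<bullet> x) * sin (wave_vec l \<bullet> x) = (sin (wave_vec (k + l) \<bullet> x) - sin (wave_vec (k - l) \<bullet> x)) / 2"
  by (simp_all only: cos_times_cos sin_times_sin sin_times_cos cos_times_sin wave_vec_add wave_vec_diff
       inner_add_left inner_diff_left)

lemma integrable_mult_cos_wave: "integrable torus f \<Longrightarrow> integrable torus (\<lambda>x. f x * cos (wave_vec k \<bullet> x))"
  and integrable_mult_sin_wave: "integrable torus f \<Longrightarrow> integrable torus (\<lambda>x. f x * sin (wave_vec k \<bullet> x))"
  by (rule integrable_mult_trigp, assumption, rule trigp.intros)+

lemmas integrable_wave = integrable_mult_cos_wave integrable_mult_sin_wave

lemma coeff_lincomb:
  assumes "integrable torus f" "integrable torus g"
  shows "cos_coeff k (\<lambda>x. a * f x + b * g x) = a * cos_coeff k f + b * cos_coeff k g"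
    and "sin_coeff k (\<lambda>x. a * f x + b * g x) = a * sin_coeff k f + b * sin_coeff k g"
  using assms by (simp_all add: cos_coeff_def sin_coeff_def distrib_right mult.assoc integrable_wave)

lemma trig_orthogonal_lincomb: "trig_orthogonal f \<Longrightarrow> trig_orthogonal g \<Longrightarrow> trig_orthogonal (\<lambda>x. a * f x + b * g x)"
  by (simp add: trig_orthogonal_def coeff_lincomb)

lemma coeff_mult_wave:
  assumes "integrable torus f"
  shows "cos_coeff k (\<lambda>x. f x * cos (wave_vec l \<bullet> x)) = (cos_coeff (k - l) f + cos_coeff (k + l) f) / 2"
    "cos_coeff k (\<lambda>x. f x * sin (wave_vec l \<bullet> x)) = (sin_coeff (k + l) f - sin_coeff (k - l) f) / 2"
    "sin_coeff k (\<lambda>x. f x * cos (wave_vec l \<bullet> x)) = (sin_coeff (k + l) f + sin_coeff (k - l) f) / 2"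
    "sin_coeff k (\<lambda>x. f x * sin (wave_vec l \<bullet> x)) = (cos_coeff (k - l) f - cos_coeff (k + l) f) / 2"
proof -
  note int = integrable_wave[OF assms]
  note tr = trig_product_to_sum[of k _ l]
  show "cos_coeff k (\<lambda>x. f x * cos (wave_vec l \<bullet> x)) = (cos_coeff (k - l) f + cos_coeff (k + l) f) / 2"
    "sin_coeff k (\<lambda>x. f x * cos (wave_vec l \<bullet> x)) = (sin_coeff (k + l) f + sin_coeff (k - l) f) / 2"
    unfolding cos_coeff_def sin_coeff_def using int
    by (simp_all add: mult.assoc mult.commute[of "cos (wave_vec l \<bullet> _)"] tr distrib_left add_divide_distrib)
  show "cos_coeff k (\<lambda>x. f x * sin (wave_vec l \<bullet> x)) = (sin_coeff (k + l) f - sin_coeff (k - l) f) / 2"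
    "sin_coeff k (\<lambda>x. f x * sin (wave_vec l \<bullet> x)) = (cos_coeff (k - l) f - cos_coeff (k + l) f) / 2"
    unfolding cos_coeff_def sin_coeff_def using int
    by (simp_all add: mult.assoc mult.commute[of "sin (wave_vec l \<bullet> _)"] tr right_diff_distrib diff_divide_distrib)
qed

text \<open>By the product-to-sum formulas multiplication by a wave only mixes vanishing coefficients. Stating this for all
  \<open>f\<close> at once makes the product case of the induction a composition.\<close>

lemma trig_orthogonal_mult: "trigp P \<Longrightarrow> trig_orthogonal f \<Longrightarrow> trig_orthogonal (\<lambda>x. f x * P x)"
proof (induction arbitrary: f rule: trigp.induct)
  case (const c)
  then show ?case using trig_orthogonal_lincomb[of f f c 0] by (simp add: mult.commute)
next
  case (cos k)
  then show ?case by (auto simp: trig_orthogonal_def coeff_mult_wave integrable_wave)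
next
  case (sin k)
  then show ?case by (auto simp: trig_orthogonal_def coeff_mult_wave integrable_wave)
next
  case (add P Q)
  then show ?case using trig_orthogonal_lincomb[of "\<lambda>x. f x * P x" "\<lambda>x. f x * Q x" 1 1]
    by (simp add: distrib_left)
next
  case (mult P Q)
  show ?case using mult.IH(2)[OF mult.IH(1)[OF mult.prems]] by (simp add: mult.assoc)
qed

lemma trig_orthogonal_integral_eq_0: "trig_orthogonal f \<Longrightarrow> (\<integral>x. f x \<partial>torus) = 0"
  unfolding trig_orthogonal_def cos_coeff_def by (elim conjE allE[of _ 0]) simp

lemma trigp_real_polynomial:
  "real_polynomial_function p \<Longrightarrow> trigp g \<Longrightarrow> trigp (\<lambda>x. p (g x))"
proof (induction rule: real_polynomial_function.induct)
  case (linear f)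
  then have "f (g x) = f 1 * g x" for x
    using linear_scale[OF bounded_linear.linear[OF linear(1)], of "g x" 1] by (simp add: mult.commute)
  then show ?case using linear by (simp add: trigp_cmult)
qed (auto intro: trigp.intros)

text \<open>Sets whose indicator is a boundedly convergent limit of trigonometric polynomials. They form a \<open>\<pi>\<close>-system
  containing the half-spaces, and a function orthogonal to all trigonometric polynomials integrates to zero over
  each of them by dominated convergence.\<close>

definition trig_approx :: "(real^3) set \<Rightarrow> bool" where
  "trig_approx A \<longleftrightarrow> (\<exists>P B. (\<forall>n::nat. trigp (P n)) \<and> (\<forall>n x. \<bar>P n x\<bar> \<le> B) \<and>
     (AE x in torus. (\<lambda>n. P n x) \<longlonglongrightarrow> indicator A x))"

lemma trig_approxE:
  assumes "trig_approx A"
  obtains P b where "\<And>n. trigp (P n)" "\<And>n x. \<bar>P n x\<bar> \<le> b" "AE x in torus. (\<lambda>n. P n x) \<longlonglongrightarrow> indicator A x"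
  using assms unfolding trig_approx_def by blast

text \<open>A trigonometric polynomial \<open>g\<close> has bounded range, and on that range the step function \<open>1\<^bsub>t > 0\<^esub>\<close> is a bounded
  limit of continuous ramps, each uniformly close to a polynomial. Composing these polynomials with \<open>g\<close> gives the
  approximating sequence.\<close>

lemma trig_approx_superlevel:
  assumes g: "trigp g"
  shows "trig_approx {x. g x > 0}"
proof -
  obtain M where M: "\<And>x. \<bar>g x\<bar> \<le> M" using trigp_bounded[OF g] by blast
  \<comment> \<open>the ramp that is zero for \<open>t \<le> 0\<close> and one from \<open>t = 1/n\<close> on\<close>
  define h where "h n t = max 0 (min 1 (real n * t))" for n :: nat and t :: real
  have "\<exists>p. real_polynomial_function p \<and> (\<forall>t\<in>{-M..M}. \<bar>h n t - p t\<bar> < 1 / Suc n)" for n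
  proof -
    have "continuous_on {-M..M} (h n)" unfolding h_def by (intro continuous_intros)
    from Stone_Weierstrass_real_polynomial_function[OF _ this, of "1 / Suc n"]
    obtain p where "real_polynomial_function p" "\<And>t. t \<in> {-M..M} \<Longrightarrow> \<bar>h n t - p t\<bar> < 1 / Suc n"
      by (metis compact_Icc zero_less_divide_1_iff of_nat_0_less_iff zero_less_Suc)
    then show ?thesis by blast
  qed
  then obtain p where p: "\<And>n. real_polynomial_function (p n)"
      "\<And>n t. t \<in> {-M..M} \<Longrightarrow> \<bar>h n t - p n t\<bar> < 1 / Suc n"
    by metis
  have gM: "g x \<in> {-M..M}" for x using M[of x] by auto
  have bound: "\<bar>p n (g x)\<bar> \<le> 2" for n x
  proof -
    have "1 / real (Suc n) \<le> 1" "0 \<le> h n (g x)" "h n (g x) \<le> 1" by (auto simp: h_def)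
    then show ?thesis using p(2)[OF gM[of x], of n] by linarith
  qed
  have lim: "(\<lambda>n. p n (g x)) \<longlonglongrightarrow> indicator {x. g x > 0} x" for x
  proof (rule Lim_transform)
    show "(\<lambda>n. p n (g x) - h n (g x)) \<longlonglongrightarrow> 0"
    proof (rule Lim_null_comparison)
      show "\<forall>\<^sub>F n in sequentially. norm (p n (g x) - h n (g x)) \<le> 1 / Suc n"
        using p(2)[OF gM[of x]] by (auto intro!: always_eventually less_imp_le simp: abs_minus_commute)
      show "(\<lambda>n. 1 / real (Suc n)) \<longlonglongrightarrow> 0" by (rule LIMSEQ_Suc[OF lim_1_over_n])
    qed
    show "(\<lambda>n. h n (g x)) \<longlonglongrightarrow> indicator {x. g x > 0} x"
    proof (cases "g x > 0")
      case True
      have "\<forall>\<^sub>F n in sequentially. h n (g x) = 1"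
      proof -
        have "\<forall>\<^sub>F n in sequentially. real n \<ge> 1 / g x"
          using filterlim_real_sequentially by (simp add: filterlim_at_top)
        then show ?thesis
          by eventually_elim (use True in \<open>auto simp: h_def field_simps\<close>)
      qed
      then show ?thesis using True by (simp add: tendsto_eventually)
    next
      case False
      have "real n * g x \<le> 0" for n using False by (simp add: mult_le_0_iff)
      then have "h n (g x) = 0" for n by (metis h_def max.absorb1 min.coboundedI2)
      then show ?thesis using False by simp
    qed
  qed
  show ?thesis
    unfolding trig_approx_def
    by (intro exI[of _ "\<lambda>n x. p n (g x)"] exI[of _ 2] conjI allI AE_I2)
       (auto intro: trigp_real_polynomial p g bound lim)
qed

lemma trig_approx_Int:
  assumes "trig_approx A" "trig_approx B"
  shows "trig_approx (A \<inter> B)"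
proof -
  obtain P b where P: "\<And>n. trigp (P n)" "\<And>n x. \<bar>P n x\<bar> \<le> b"
      "AE x in torus. (\<lambda>n. P n x) \<longlonglongrightarrow> indicator A x"
    using trig_approxE[OF assms(1)] by blast
  obtain Q c where Q: "\<And>n. trigp (Q n)" "\<And>n x. \<bar>Q n x\<bar> \<le> c"
      "AE x in torus. (\<lambda>n. Q n x) \<longlonglongrightarrow> indicator B x"
    using trig_approxE[OF assms(2)] by blast
  have "\<bar>P n x * Q n x\<bar> \<le> b * c" for n x
    unfolding abs_mult using P(2)[of n x] Q(2)[of n x] by (intro mult_mono) auto
  moreover have "AE x in torus. (\<lambda>n. P n x * Q n x) \<longlonglongrightarrow> indicator (A \<inter> B) x"
    using P(3) Q(3)
    by eventually_elim (auto simp: indicator_inter_arith intro!: tendsto_mult)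
  ultimately show ?thesis unfolding trig_approx_def using P(1) Q(1)
    by (intro exI[of _ "\<lambda>n x. P n x * Q n x"] exI[of _ "b * c"]) (auto intro: trigp.mult)
qed

lemma AE_torus_component_neq: "AE x in torus. x $ j \<noteq> c"
proof -
  have "AE x in lebesgue. x \<notin> {x::real^3. x $ j = c}"
    using negligible_standard_hyperplane[of "axis j 1 :: real^3" c]
    by (intro AE_not_in) (auto simp: negligible_iff_null_sets inner_axis Basis_vec_def)
  then show ?thesis
    unfolding torus_def by (auto simp: AE_restrict_space_iff)
qed

lemma AE_torus_in_cube: "AE x in torus. x \<in> cbox 0 1"
  using AE_space[of torus] by (simp add: space_torus)

lemma trig_approx_cong:
  assumes "trig_approx A" "AE x in torus. x \<in> A \<longleftrightarrow> x \<in> B"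
  shows "trig_approx B"
proof -
  obtain P b where P: "\<And>n. trigp (P n)" "\<And>n x. \<bar>P n x\<bar> \<le> b"
      "AE x in torus. (\<lambda>n. P n x) \<longlonglongrightarrow> indicator A x"
    using trig_approxE[OF assms(1)] by blast
  have "AE x in torus. (\<lambda>n. P n x) \<longlonglongrightarrow> indicator B x"
    using P(3) assms(2) by eventually_elim (auto simp: indicator_def)
  then show ?thesis unfolding trig_approx_def using P by blast
qed

text \<open>For \<open>0 < a \<le> 1\<close> and up to null sets of the cube, the half-space is the set where \<open>sin (\<pi> x\<^sub>j) sin (\<pi> (a - x\<^sub>j))\<close> is positive, and by
  the sum-to-product formula this product is a trigonometric polynomial of period one in \<open>x\<^sub>j\<close>.\<close>

lemma trig_approx_halfspace: "trig_approx {x. x $ j < a}"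
proof -
  consider "a \<le> 0" | "1 < a" | "0 < a" "a \<le> 1" by linarith
  then show ?thesis
  proof cases
    case 1
    have "AE x in torus. x \<in> {x. (0::real) > 0} \<longleftrightarrow> x \<in> {x. x $ j < a}"
      using AE_torus_in_cube
    proof eventually_elim
      case (elim x)
      then have "0 \<le> x $ j" by (simp add: mem_box_cart)
      then show ?case using 1 by simp
    qed
    then show ?thesis by (rule trig_approx_cong[OF trig_approx_superlevel[OF trigp.const]])
  next
    case 2
    have "AE x in torus. x \<in> {x. (1::real) > 0} \<longleftrightarrow> x \<in> {x. x $ j < a}"
      using AE_torus_in_cube
    proof eventually_elim
      case (elim x)
      then have "x $ j \<le> 1" by (simp add: mem_box_cart)
      then show ?case using 2 by simp
    qed
    then show ?thesis by (rule trig_approx_cong[OF trig_approx_superlevel[OF trigp.const]])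
  next
    case 3
    \<comment> \<open>this is \<open>cos (2 \<pi> x\<^sub>j - \<pi> a) - cos (\<pi> a)\<close>\<close>
    define g where "g x = cos (pi * a) * cos (wave_vec (axis j 1) \<bullet> x) + sin (pi * a) * sin (wave_vec (axis j 1) \<bullet> x)
        - cos (pi * a)" for x
    have "trigp g" unfolding g_def by (intro trigp_diff trigp.intros)
    have w: "wave_vec (axis j 1) = axis j (2 * pi)" by (auto simp: wave_vec_def axis_def vec_eq_iff)
    have g: "g x = 2 * sin (pi * x $ j) * sin (pi * (a - x $ j))" for x
    proof -
      have "g x = cos (2 * pi * x $ j - pi * a) - cos (pi * a)"
        by (simp add: g_def w inner_axis' cos_diff mult.commute)
      also have "\<dots> = 2 * sin (pi * x $ j) * sin (pi * (a - x $ j))"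
      proof -
        have "(2 * pi * x $ j - pi * a + pi * a) / 2 = pi * x $ j"
          "(pi * a - (2 * pi * x $ j - pi * a)) / 2 = pi * (a - x $ j)"
          by (simp_all add: field_simps)
        then show ?thesis by (simp add: cos_diff_cos)
      qed
      finally show ?thesis .
    qed
    have "AE x in torus. x \<in> {x. g x > 0} \<longleftrightarrow> x \<in> {x. x $ j < a}"
      using AE_torus_in_cube AE_torus_component_neq[of j 0] AE_torus_component_neq[of j 1]
    proof eventually_elim
      case (elim x)
      then have x: "0 < x $ j" "x $ j < 1"
        by (auto simp: mem_box_cart less_le dest: spec[of _ j])
      have s: "sin (pi * x $ j) > 0" using x by (intro sin_gt_zero) auto
      have "sin (pi * (a - x $ j)) > 0 \<longleftrightarrow> x $ j < a"
      proof (cases "x $ j < a")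
        case True
        have "pi * (a - x $ j) < pi * 1" using x 3 by (intro mult_strict_left_mono) auto
        then show ?thesis using True by (auto intro!: sin_gt_zero)
      next
        case False
        have "pi * (x $ j - a) < pi * 1" using x 3 by (intro mult_strict_left_mono) auto
        then have "sin (pi * (x $ j - a)) \<ge> 0" using False by (auto intro!: sin_ge_zero)
        moreover have "sin (pi * (a - x $ j)) = - sin (pi * (x $ j - a))"
          by (metis minus_diff_eq mult_minus_right sin_minus)
        ultimately show ?thesis using False by simp
      qed
      then show ?case using s by (simp add: g zero_less_mult_iff)
    qed
    then show ?thesis by (rule trig_approx_cong[OF trig_approx_superlevel[OF \<open>trigp g\<close>]])
  qed
qed

lemma indicator_measurable_torus [measurable]:
  "A \<in> sets borel \<Longrightarrow> (indicator A :: real^3 \<Rightarrow> real) \<in> borel_measurable torus"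
  by (rule measurable_torus_borel) simp

lemma integrable_mult_indicator_torus:
  fixes f :: "real^3 \<Rightarrow> real"
  assumes "integrable torus f" "A \<in> sets borel"
  shows "integrable torus (\<lambda>x. f x * indicator A x)"
proof -
  have "AE x in torus. \<bar>indicator A x :: real\<bar> \<le> 1" by (simp add: indicator_def)
  with assms show ?thesis by (intro integrable_mult_bounded indicator_measurable_torus)
qed

lemma trig_orthogonal_integral_trig_approx:
  assumes f: "trig_orthogonal f" and A: "trig_approx A" "A \<in> sets borel"
  shows "(\<integral>x. f x * indicator A x \<partial>torus) = 0"
proof -
  obtain P b where P: "\<And>n. trigp (P n)" "\<And>n x. \<bar>P n x\<bar> \<le> b"
      "AE x in torus. (\<lambda>n. P n x) \<longlonglongrightarrow> indicator A x"
    using trig_approxE[OF A(1)] by blast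
  have int: "integrable torus f" using f by (simp add: trig_orthogonal_def)
  have "(\<lambda>n. \<integral>x. f x * P n x \<partial>torus) \<longlonglongrightarrow> (\<integral>x. f x * indicator A x \<partial>torus)"
  proof (rule integral_dominated_convergence)
    show "AE x in torus. (\<lambda>n. f x * P n x) \<longlonglongrightarrow> f x * indicator A x"
      using P(3) by eventually_elim (rule tendsto_mult_left)
    have "integrable torus (\<lambda>x. b * f x)" using int by simp
    then show "integrable torus (\<lambda>x. norm (b * f x))" by (rule integrable_norm)
    show "AE x in torus. norm (f x * P n x) \<le> norm (b * f x)" for n
    proof (rule AE_I2)
      fix x
      have "\<bar>f x\<bar> * \<bar>P n x\<bar> \<le> \<bar>f x\<bar> * \<bar>b\<bar>"
        using P(2)[of n x] by (intro mult_left_mono) auto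
      then show "norm (f x * P n x) \<le> norm (b * f x)" by (simp add: abs_mult mult.commute)
    qed
  qed (use int A P(1) in measurable)
  moreover have "(\<integral>x. f x * P n x \<partial>torus) = 0" for n
    by (rule trig_orthogonal_integral_eq_0[OF trig_orthogonal_mult[OF P(1) f]])
  ultimately show ?thesis by (simp add: LIMSEQ_const_iff)
qed

text \<open>Dynkin's \<open>\<pi>\<close>-\<open>\<lambda>\<close> argument: half-spaces generate the Borel sets.\<close>

lemma trig_orthogonal_integral_borel:
  assumes f: "trig_orthogonal f" and A: "A \<in> sets borel"
  shows "(\<integral>x. f x * indicator A x \<partial>torus) = 0"
proof -
  define G where "G = {A. trig_approx A \<and> A \<in> sets (borel :: (real^3) measure)}"
  have int: "integrable torus f" using f by (simp add: trig_orthogonal_def)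
  note intA = integrable_mult_indicator_torus[OF int]
  have sub: "sigma_sets UNIV G \<subseteq> sets borel"
    using sets.sigma_sets_subset[of G "borel :: (real^3) measure"] by (auto simp: G_def)
  have "(\<lambda>(a, i). {x::real^3. x \<bullet> i < a}) ` (UNIV \<times> Basis) \<subseteq> G"
    using trig_approx_halfspace by (auto simp: G_def Basis_vec_def inner_axis)
  then have "sigma_sets UNIV ((\<lambda>(a, i). {x::real^3. x \<bullet> i < a}) ` (UNIV \<times> Basis)) \<subseteq> sigma_sets UNIV G"
    by (rule sigma_sets_mono')
  then have "A \<in> sigma_sets UNIV G"
    using A by (subst (asm) borel_eq_halfspace_less) auto
  have "Int_stable G" "G \<subseteq> Pow UNIV" by (auto simp: Int_stable_def G_def trig_approx_Int)
  then show ?thesis using \<open>A \<in> sigma_sets UNIV G\<close>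
  proof (induction rule: sigma_sets_induct_disjoint)
    case (basic A) then show ?case using trig_orthogonal_integral_trig_approx[OF f] by (simp add: G_def)
  next
    case empty then show ?case by simp
  next
    case (compl A)
    have "(\<integral>x. f x * indicator (UNIV - A) x \<partial>torus) = (\<integral>x. f x - f x * indicator A x \<partial>torus)"
      by (intro Bochner_Integration.integral_cong) (auto simp: indicator_def)
    also have "\<dots> = 0"
      using compl sub int by (subst Bochner_Integration.integral_diff) (auto intro: intA trig_orthogonal_integral_eq_0[OF f])
    finally show ?case .
  next
    case (union A)
    have bor: "A i \<in> sets borel" for i using union(2) sub by auto
    have "(\<lambda>n. \<integral>x. f x * (\<Sum>i<n. indicator (A i) x) \<partial>torus) \<longlonglongrightarrow> (\<integral>x. f x * indicator (\<Union>i. A i) x \<partial>torus)"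
    proof (rule integral_dominated_convergence)
      show "integrable torus (\<lambda>x. norm (f x))" using int by simp
      show "AE x in torus. (\<lambda>n. f x * (\<Sum>i<n. indicator (A i) x)) \<longlonglongrightarrow> f x * indicator (\<Union>i. A i) x"
      proof (intro AE_I2 tendsto_mult_left)
        show "(\<lambda>n. \<Sum>i<n. indicator (A i) x) \<longlonglongrightarrow> (indicator (\<Union>i. A i) x :: real)" for x
          using indicator_sums[of A x] union(1) by (auto simp: sums_def disjoint_family_on_def)
      qed
      show "AE x in torus. norm (f x * (\<Sum>i<n. indicator (A i) x)) \<le> norm (f x)" for n
      proof (rule AE_I2)
        fix x
        have "(\<Sum>i<n. indicator (A i) x) = (indicator (\<Union>i<n. A i) x :: real)"
          using union(1) by (intro indicator_UN_disjoint[symmetric]) (auto simp: disjoint_family_on_def)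
        then show "norm (f x * (\<Sum>i<n. indicator (A i) x)) \<le> norm (f x)"
          by (simp add: indicator_def)
      qed
    qed (use int bor in measurable)
    moreover have "(\<integral>x. f x * (\<Sum>i<n. indicator (A i) x) \<partial>torus) = 0" for n
    proof -
      have "(\<integral>x. f x * (\<Sum>i<n. indicator (A i) x) \<partial>torus) = (\<Sum>i<n. \<integral>x. f x * indicator (A i) x \<partial>torus)"
        unfolding sum_distrib_left by (intro Bochner_Integration.integral_sum intA bor)
      then show ?thesis using union(3) by simp
    qed
    ultimately show ?case by (simp add: LIMSEQ_const_iff)
  qed
qed

text \<open>Completeness of the trigonometric system, even among integrable functions: by the previous lemma a Borel
  version of \<open>f\<close> has integral zero over the sets where it is positive and where it is negative.\<close>

theorem trig_orthogonal_AE_0: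
  assumes f: "trig_orthogonal f"
  shows "AE x in torus. f x = 0"
proof -
  have int: "integrable torus f" using f by (simp add: trig_orthogonal_def)
  have "(\<lambda>x. if x \<in> cbox 0 1 then f x else 0) \<in> borel_measurable lebesgue"
    using int by (intro borel_measurable_if_I) (auto simp: torus_def)
  from completion_ex_borel_measurable_real[OF this]
  obtain g where g: "g \<in> borel_measurable borel" "AE x in lborel. (if x \<in> cbox 0 1 then f x else 0) = g x"
    by auto
  from g(2) have "AE x in lebesgue. (if x \<in> cbox 0 1 then f x else 0) = g x" by (rule AE_completion)
  then have fg: "AE x in torus. f x = g x"
    unfolding torus_def by (subst AE_restrict_space_iff) (auto elim!: eventually_mono)
  define S where "S = {x. g x > 0}"
  define N where "N = {x. g x < 0}"
  have [measurable]: "S \<in> sets borel" "N \<in> sets borel" unfolding S_def N_def using g(1) by measurable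
  have gint: "integrable torus g"
    using int fg g(1) by (subst integrable_cong_AE[where g = f]) (auto intro: measurable_torus_borel)
  have gA: "(\<integral>x. g x * indicator A x \<partial>torus) = 0" if [measurable]: "A \<in> sets borel" for A
  proof -
    have [measurable]: "g \<in> borel_measurable torus" "f \<in> borel_measurable torus" using gint int by auto
    have "(\<integral>x. g x * indicator A x \<partial>torus) = (\<integral>x. f x * indicator A x \<partial>torus)"
      by (intro integral_cong_AE) (use fg in auto)
    then show ?thesis using trig_orthogonal_integral_borel[OF f that] by simp
  qed
  have "AE x in torus. g x * indicator S x = 0"
    using gA[OF \<open>S \<in> sets borel\<close>] integrable_mult_indicator_torus[OF gint \<open>S \<in> sets borel\<close>]
    by (subst integral_nonneg_eq_0_iff_AE[symmetric]) (auto simp: S_def indicator_def)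
  moreover have "AE x in torus. - (g x * indicator N x) = 0"
    using gA[OF \<open>N \<in> sets borel\<close>] Bochner_Integration.integrable_minus[OF integrable_mult_indicator_torus[OF gint \<open>N \<in> sets borel\<close>]]
    by (subst integral_nonneg_eq_0_iff_AE[symmetric]) (auto simp: N_def indicator_def)
  ultimately show ?thesis using fg
    by eventually_elim (auto simp: S_def N_def indicator_def split: if_splits)
qed

section \<open>Absolutely convergent Fourier series\<close>

definition partial_fourier :: "(int^3) set \<Rightarrow> (real^3 \<Rightarrow> real) \<Rightarrow> real^3 \<Rightarrow> real" where
  "partial_fourier K f x = (\<Sum>k\<in>K. cos_coeff k f * cos (wave_vec k \<bullet> x) + sin_coeff k f * sin (wave_vec k \<bullet> x))"

definition abs_fourier :: "(real^3 \<Rightarrow> real) \<Rightarrow> int^3 \<Rightarrow> real" where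
  "abs_fourier f k = \<bar>cos_coeff k f\<bar> + \<bar>sin_coeff k f\<bar>"

text \<open>The Wiener algebra: functions with absolutely summable Fourier coefficients.\<close>

definition wiener :: "(real^3 \<Rightarrow> real) \<Rightarrow> bool" where
  "wiener f \<longleftrightarrow> integrable torus f \<and> abs_fourier f summable_on UNIV"

text \<open>The \<open>\<ell>\<^sup>1\<close> mass of the coefficients outside \<open>K\<close>, which bounds the uniform error of the partial sum over \<open>K\<close>.\<close>

definition fourier_tail :: "(real^3 \<Rightarrow> real) \<Rightarrow> (int^3) set \<Rightarrow> real" where
  "fourier_tail f K = infsum (abs_fourier f) UNIV - sum (abs_fourier f) K"

lemma trigp_partial_fourier: "trigp (partial_fourier K f)"
  unfolding partial_fourier_def by (intro trigp_sum trigp.add trigp_cmult trigp.cos trigp.sin)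

lemma cos_coeff_minus: "cos_coeff (- k) f = cos_coeff k f" and sin_coeff_minus: "sin_coeff (- k) f = - sin_coeff k f"
  by (simp_all add: cos_coeff_def sin_coeff_def wave_vec_minus)

lemma abs_fourier_nonneg: "0 \<le> abs_fourier f k"
  by (simp add: abs_fourier_def)

lemma fourier_tail_tendsto_0:
  assumes "wiener f"
  shows "(fourier_tail f \<longlongrightarrow> 0) (finite_subsets_at_top UNIV)"
proof -
  have "(sum (abs_fourier f) \<longlongrightarrow> infsum (abs_fourier f) UNIV) (finite_subsets_at_top UNIV)"
    using assms unfolding wiener_def by (intro infsum_tendsto) auto
  from tendsto_diff[OF tendsto_const[of "infsum (abs_fourier f) UNIV"] this]
  show ?thesis by (simp add: fourier_tail_def[abs_def])
qed

lemma abs_cos_add_sin_le: 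
  fixes x y :: real
  shows "\<bar>a * cos x + b * sin y\<bar> \<le> \<bar>a\<bar> + \<bar>b\<bar>"
proof -
  have "\<bar>a * cos x + b * sin y\<bar> \<le> \<bar>a\<bar> * \<bar>cos x\<bar> + \<bar>b\<bar> * \<bar>sin y\<bar>"
    using abs_triangle_ineq[of "a * cos x" "b * sin y"] by (simp add: abs_mult)
  also have "\<dots> \<le> \<bar>a\<bar> * 1 + \<bar>b\<bar> * 1"
    by (intro add_mono mult_left_mono) auto
  finally show ?thesis by simp
qed

lemma cos_coeff_one: "cos_coeff k (\<lambda>x. 1) = (if k = 0 then 1 else 0)" and sin_coeff_one: "sin_coeff k (\<lambda>x. 1) = 0"
  by (simp_all add: cos_coeff_def sin_coeff_def integral_cos_wave integral_sin_wave)

lemma coeff_wave: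
  "cos_coeff l (\<lambda>x. cos (wave_vec k \<bullet> x)) = (of_bool (l = k) + of_bool (l = - k)) / 2"
  "cos_coeff l (\<lambda>x. sin (wave_vec k \<bullet> x)) = 0"
  "sin_coeff l (\<lambda>x. cos (wave_vec k \<bullet> x)) = 0"
  "sin_coeff l (\<lambda>x. sin (wave_vec k \<bullet> x)) = (of_bool (l = k) - of_bool (l = - k)) / 2"
  using coeff_mult_wave[of "\<lambda>x. 1" l k] by (simp_all add: cos_coeff_one sin_coeff_one add_eq_0_iff2)

lemma coeff_sum:
  assumes "\<And>i. i \<in> I \<Longrightarrow> integrable torus (f i)"
  shows "cos_coeff l (\<lambda>x. \<Sum>i\<in>I. f i x) = (\<Sum>i\<in>I. cos_coeff l (f i))" "sin_coeff l (\<lambda>x. \<Sum>i\<in>I. f i x) = (\<Sum>i\<in>I. sin_coeff l (f i))"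
  using assms by (simp_all add: cos_coeff_def sin_coeff_def sum_distrib_right integrable_wave)

text \<open>The real waves of \<open>k\<close> and \<open>-k\<close> coincide up to sign, so a partial sum over an arbitrary finite \<open>K\<close> counts
  them with weight one half each.\<close>

lemma coeff_partial_fourier_eq_sum:
  "cos_coeff l (partial_fourier K f) = (\<Sum>k\<in>K. cos_coeff k f * ((of_bool (l = k) + of_bool (l = - k)) / 2))"
  "sin_coeff l (partial_fourier K f) = (\<Sum>k\<in>K. sin_coeff k f * ((of_bool (l = k) - of_bool (l = - k)) / 2))"
proof -
  note int = integrable_trigp[OF trigp.cos] integrable_trigp[OF trigp.sin]
  then have "integrable torus (\<lambda>x. cos_coeff k f * cos (wave_vec k \<bullet> x) + sin_coeff k f * sin (wave_vec k \<bullet> x))" for k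
    by simp
  then show "cos_coeff l (partial_fourier K f) = (\<Sum>k\<in>K. cos_coeff k f * ((of_bool (l = k) + of_bool (l = - k)) / 2))"
    "sin_coeff l (partial_fourier K f) = (\<Sum>k\<in>K. sin_coeff k f * ((of_bool (l = k) - of_bool (l = - k)) / 2))"
    unfolding partial_fourier_def[abs_def]
    by (simp_all add: coeff_sum coeff_lincomb int coeff_wave)
qed

lemma coeff_partial_fourier:
  assumes K: "finite K" "l \<in> K" "- l \<in> K"
  shows "cos_coeff l (partial_fourier K f) = cos_coeff l f" "sin_coeff l (partial_fourier K f) = sin_coeff l f"
proof -
  have d: "(\<Sum>k\<in>K. a k * of_bool (l = k)) = a l" for a :: "int^3 \<Rightarrow> real"
    using K sum.delta[of K l a] by (simp add: of_bool_def if_distrib cong: if_cong)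
  have e: "(\<Sum>k\<in>K. a k * of_bool (l = - k)) = a (- l)" for a :: "int^3 \<Rightarrow> real"
  proof -
    have "l = - k \<longleftrightarrow> - l = k" for k :: "int^3" by auto
    then show ?thesis
      using K sum.delta[of K "- l" a] by (simp add: of_bool_def if_distrib cong: if_cong)
  qed
  have "cos_coeff l (partial_fourier K f) = ((\<Sum>k\<in>K. cos_coeff k f * of_bool (l = k)) + (\<Sum>k\<in>K. cos_coeff k f * of_bool (l = - k))) / 2"
    unfolding coeff_partial_fourier_eq_sum sum.distrib[symmetric] sum_divide_distrib
    by (intro sum.cong) (simp_all only: distrib_left times_divide_eq_right)
  also have "\<dots> = cos_coeff l f" unfolding d e cos_coeff_minus by simp
  finally show "cos_coeff l (partial_fourier K f) = cos_coeff l f" .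
  have "sin_coeff l (partial_fourier K f) = ((\<Sum>k\<in>K. sin_coeff k f * of_bool (l = k)) - (\<Sum>k\<in>K. sin_coeff k f * of_bool (l = - k))) / 2"
    unfolding coeff_partial_fourier_eq_sum sum_subtractf[symmetric] sum_divide_distrib
    by (intro sum.cong) (simp_all only: right_diff_distrib times_divide_eq_right)
  also have "\<dots> = sin_coeff l f" unfolding d e sin_coeff_minus by simp
  finally show "sin_coeff l (partial_fourier K f) = sin_coeff l f" .
qed

lemma abs_coeff_le:
  assumes "integrable torus f" "AE x in torus. \<bar>f x\<bar> \<le> c"
  shows "\<bar>cos_coeff k f\<bar> \<le> c" "\<bar>sin_coeff k f\<bar> \<le> c"
proof -
  have *: "\<bar>\<integral>x. f x * g x \<partial>torus\<bar> \<le> c" if g: "integrable torus (\<lambda>x. f x * g x)" "\<And>x. \<bar>g x\<bar> \<le> 1" for g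
  proof -
    have "\<bar>\<integral>x. f x * g x \<partial>torus\<bar> \<le> (\<integral>x. \<bar>f x * g x\<bar> \<partial>torus)" by (rule integral_abs_bound)
    also have "\<dots> \<le> (\<integral>x. c \<partial>torus)"
    proof (rule integral_mono_AE)
      show "AE x in torus. \<bar>f x * g x\<bar> \<le> c"
        using assms(2)
      proof eventually_elim
        case (elim x)
        have "\<bar>f x\<bar> * \<bar>g x\<bar> \<le> c * 1" using elim g(2) by (intro mult_mono) auto
        then show ?case by (simp add: abs_mult)
      qed
    qed (use g in auto)
    also have "\<dots> = c" by (simp add: measure_torus)
    finally show ?thesis .
  qed
  show "\<bar>cos_coeff k f\<bar> \<le> c" "\<bar>sin_coeff k f\<bar> \<le> c"
    unfolding cos_coeff_def sin_coeff_def by (intro * integrable_wave assms; simp)+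
qed

lemma coeff_diff:
  assumes "integrable torus f" "integrable torus g"
  shows "cos_coeff k (\<lambda>x. f x - g x) = cos_coeff k f - cos_coeff k g" "sin_coeff k (\<lambda>x. f x - g x) = sin_coeff k f - sin_coeff k g"
  using coeff_lincomb[OF assms, of k 1 "-1"] by simp_all

text \<open>The series converges uniformly to a function \<open>F\<close> that has the coefficients of \<open>f\<close>, because
  coefficients are continuous under uniform convergence; completeness then gives \<open>f = F\<close> almost everywhere.\<close>

theorem wiener_uniform_approx:
  assumes f: "wiener f"
  shows "AE x in torus. \<forall>K. finite K \<longrightarrow> \<bar>f x - partial_fourier K f x\<bar> \<le> fourier_tail f K"
proof -
  let ?F = "finite_subsets_at_top (UNIV :: (int^3) set)"
  define F where "F x = (\<Sum>\<^sub>\<infinity>k. cos_coeff k f * cos (wave_vec k \<bullet> x) + sin_coeff k f * sin (wave_vec k \<bullet> x))" for x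
  have sm: "abs_fourier f summable_on UNIV" and int: "integrable torus f" using f by (auto simp: wiener_def)
  have F: "\<bar>F x - partial_fourier K f x\<bar> \<le> fourier_tail f K" if K: "finite K" for x K
  proof -
    let ?t = "\<lambda>k. cos_coeff k f * cos (wave_vec k \<bullet> x) + sin_coeff k f * sin (wave_vec k \<bullet> x)"
    have t: "(\<lambda>k. norm (?t k)) summable_on UNIV"
      by (rule Infinite_Sum.abs_summable_on_comparison_test'[OF sm]) (simp add: abs_fourier_def abs_cos_add_sin_le)
    have "F x = infsum ?t K + infsum ?t (- K)"
      unfolding F_def using infsum_Un_disjoint[of ?t K "- K"] abs_summable_summable[OF t]
      by (metis (no_types, lifting) Compl_disjoint Compl_partition subset_UNIV summable_on_subset_banach)
    then have "F x - partial_fourier K f x = infsum ?t (- K)"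
      using K by (simp add: partial_fourier_def)
    also have "\<bar>\<dots>\<bar> \<le> infsum (\<lambda>k. \<bar>?t k\<bar>) (- K)"
      using norm_infsum_bound[of ?t "- K"] summable_on_subset_banach[OF t, of "- K"] by simp
    also have "\<dots> \<le> infsum (abs_fourier f) (- K)"
      using summable_on_subset_banach[OF t, of "- K"] summable_on_subset_banach[OF sm, of "- K"]
      by (intro infsum_mono) (auto simp: abs_fourier_def abs_cos_add_sin_le)
    also have "\<dots> = fourier_tail f K"
      unfolding fourier_tail_def using infsum_Un_disjoint[of "abs_fourier f" K "- K"] K sm
      by (simp add: summable_on_subset_banach[OF sm])
    finally show ?thesis .
  qed
  have "\<exists>K. finite K \<and> fourier_tail f K < 1 / Suc n" for n
  proof -
    have "\<forall>\<^sub>F K in ?F. fourier_tail f K < 1 / Suc n"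
      by (rule order_tendstoD(2)[OF fourier_tail_tendsto_0[OF f]]) simp
    then show ?thesis unfolding eventually_finite_subsets_at_top by blast
  qed
  \<comment> \<open>a sequence of frequency sets, since measurability passes to sequential limits only\<close>
  then obtain Kn where Kn: "\<And>n. finite (Kn n)" "\<And>n. fourier_tail f (Kn n) < 1 / Suc n" by metis
  have lim: "(\<lambda>n. partial_fourier (Kn n) f x) \<longlonglongrightarrow> F x" for x
  proof (rule LIM_zero_cancel, rule Lim_null_comparison)
    show "\<forall>\<^sub>F n in sequentially. norm (partial_fourier (Kn n) f x - F x) \<le> 1 / Suc n"
    proof (rule always_eventually, rule allI)
      fix n show "norm (partial_fourier (Kn n) f x - F x) \<le> 1 / Suc n"
        using F[OF Kn(1)[of n], of x] Kn(2)[of n] by simp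
    qed
    show "(\<lambda>n. 1 / real (Suc n)) \<longlonglongrightarrow> 0" by (rule LIMSEQ_Suc[OF lim_1_over_n])
  qed
  have mF: "F \<in> borel_measurable torus"
    by (rule borel_measurable_LIMSEQ_real[OF lim]) (auto intro: trigp_measurable trigp_partial_fourier)
  have "\<bar>F x\<bar> \<le> fourier_tail f {}" for x using F[of "{}"] by (simp add: partial_fourier_def)
  then have intF: "integrable torus F"
    using mF by (intro torus.integrable_const_bound[where B="fourier_tail f {}"]) auto
  have intP: "integrable torus (partial_fourier K f)" for K
    by (intro integrable_trigp trigp_partial_fourier)
  let ?c = "\<lambda>l. \<bar>cos_coeff l F - cos_coeff l f\<bar>" and ?s = "\<lambda>l. \<bar>sin_coeff l F - sin_coeff l f\<bar>"
  have eq: "cos_coeff l F = cos_coeff l f \<and> sin_coeff l F = sin_coeff l f" for l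
  proof -
    \<comment> \<open>a partial sum reproduces the coefficient at \<open>l\<close> once it contains both \<open>l\<close> and \<open>-l\<close>\<close>
    have ev: "\<forall>\<^sub>F K in ?F. finite K \<and> {l, -l} \<subseteq> K"
      by (auto simp: eventually_finite_subsets_at_top intro!: exI[of _ "{l, - l}"])
    have "\<forall>\<^sub>F K in ?F. ?c l \<le> fourier_tail f K"
      "\<forall>\<^sub>F K in ?F. ?s l \<le> fourier_tail f K"
    proof -
      have *: "?c l \<le> fourier_tail f K \<and> ?s l \<le> fourier_tail f K"
        if K: "finite K \<and> {l, -l} \<subseteq> K" for K
      proof -
        have i: "integrable torus (\<lambda>x. F x - partial_fourier K f x)" using intF intP by auto
        have b: "AE x in torus. \<bar>F x - partial_fourier K f x\<bar> \<le> fourier_tail f K" using F K by auto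
        from abs_coeff_le[OF i b, of l] K show ?thesis
          by (simp add: coeff_diff intF intP coeff_partial_fourier)
      qed
      show "\<forall>\<^sub>F K in ?F. ?c l \<le> fourier_tail f K"
        "\<forall>\<^sub>F K in ?F. ?s l \<le> fourier_tail f K"
        using ev * by (auto elim!: eventually_mono)
    qed
    from this[THEN tendsto_lowerbound[OF fourier_tail_tendsto_0[OF f]]]
    have "?c l \<le> 0" "?s l \<le> 0"
      by simp_all
    then show ?thesis by simp
  qed
  have "trig_orthogonal (\<lambda>x. f x - F x)" using eq int intF by (auto simp: trig_orthogonal_def coeff_diff)
  from trig_orthogonal_AE_0[OF this] show ?thesis
    by eventually_elim (use F in simp)
qed

lemma wiener_AE_bounded:
  assumes "wiener f"
  shows "AE x in torus. \<bar>f x\<bar> \<le> infsum (abs_fourier f) UNIV"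
  using wiener_uniform_approx[OF assms]
  by eventually_elim (auto simp: partial_fourier_def fourier_tail_def dest!: spec[of _ "{}"])

lemma integral_mult_partial_fourier:
  assumes "integrable torus g"
  shows "(\<integral>x. g x * partial_fourier K f x \<partial>torus) = (\<Sum>k\<in>K. cos_coeff k f * cos_coeff k g + sin_coeff k f * sin_coeff k g)"
proof -
  have "(\<integral>x. g x * partial_fourier K f x \<partial>torus) =
    (\<integral>x. (\<Sum>k\<in>K. cos_coeff k f * (g x * cos (wave_vec k \<bullet> x)) + sin_coeff k f * (g x * sin (wave_vec k \<bullet> x))) \<partial>torus)"
    unfolding partial_fourier_def by (simp add: sum_distrib_left algebra_simps)
  also have "\<dots> = (\<Sum>k\<in>K. cos_coeff k f * cos_coeff k g + sin_coeff k f * sin_coeff k g)"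
    using integrable_wave[OF assms] by (simp add: cos_coeff_def sin_coeff_def)
  finally show ?thesis .
qed

lemma integrable_mult_wiener:
  assumes "integrable torus g" "wiener f"
  shows "integrable torus (\<lambda>x. g x * f x)"
  using assms wiener_AE_bounded[OF assms(2)] by (intro integrable_mult_bounded) (auto simp: wiener_def)

text \<open>Against a partial sum of \<open>f\<close> the formula is a finite computation, and the partial sums converge uniformly, so
  integrability of \<open>g\<close> suffices to pass to the limit.\<close>

theorem parseval_wiener:
  assumes g: "integrable torus g" and f: "wiener f"
  shows "((\<lambda>k. cos_coeff k f * cos_coeff k g + sin_coeff k f * sin_coeff k g) has_sum (\<integral>x. g x * f x \<partial>torus)) UNIV"
  unfolding has_sum_def
proof (rule LIM_zero_cancel, rule Lim_null_comparison)
  let ?d = "\<lambda>K. (\<Sum>k\<in>K. cos_coeff k f * cos_coeff k g + sin_coeff k f * sin_coeff k g) - (\<integral>x. g x * f x \<partial>torus)"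
  show "\<forall>\<^sub>F K in finite_subsets_at_top UNIV.
      norm (?d K) \<le> fourier_tail f K * (\<integral>x. \<bar>g x\<bar> \<partial>torus)"
    using eventually_finite_subsets_at_top_weakI
  proof (rule eventually_mono)
    fix K :: "(int^3) set" assume K: "finite K \<and> K \<subseteq> UNIV"
    note int = integrable_mult_wiener[OF g f] integrable_mult_trigp[OF g trigp_partial_fourier[of K f]]
    have "norm (?d K)
        = \<bar>\<integral>x. g x * partial_fourier K f x - g x * f x \<partial>torus\<bar>"
      using int by (simp add: integral_mult_partial_fourier[OF g, symmetric])
    also have "\<dots> \<le> (\<integral>x. \<bar>g x * partial_fourier K f x - g x * f x\<bar> \<partial>torus)"
      by (rule integral_abs_bound)
    also have "\<dots> \<le> (\<integral>x. fourier_tail f K * \<bar>g x\<bar> \<partial>torus)"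
    proof (rule integral_mono_AE)
      show "AE x in torus. \<bar>g x * partial_fourier K f x - g x * f x\<bar> \<le> fourier_tail f K * \<bar>g x\<bar>"
        using wiener_uniform_approx[OF f]
      proof eventually_elim
        case (elim x)
        then have "\<bar>f x - partial_fourier K f x\<bar> \<le> fourier_tail f K" using K by simp
        from mult_right_mono[OF this, of "\<bar>g x\<bar>"] show ?case
          by (simp add: abs_mult[symmetric] algebra_simps abs_minus_commute)
      qed
    qed (use int g in auto)
    finally show "norm (?d K) \<le> fourier_tail f K * (\<integral>x. \<bar>g x\<bar> \<partial>torus)"
      by simp
  qed auto
  show "((\<lambda>K. fourier_tail f K * (\<integral>x. \<bar>g x\<bar> \<partial>torus)) \<longlongrightarrow> 0) (finite_subsets_at_top UNIV)"
    by (rule tendsto_mult_left_zero[OF fourier_tail_tendsto_0[OF f]])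
qed

section \<open>Weighted square-summable families\<close>

text \<open>Membership, squared norm (\<open>wsq\<close>) and inner product (\<open>wip\<close>) of the weighted sequence space \<open>\<ell>\<^sup>2(h)\<close>. Keeping the space as a
  predicate lets one family of coefficients be measured in several weights.\<close>

definition wsq_summable :: "('i \<Rightarrow> real) \<Rightarrow> ('i \<Rightarrow> 'b::real_inner) \<Rightarrow> bool" where
  "wsq_summable h a \<longleftrightarrow> (\<lambda>k. h k * (norm (a k))\<^sup>2) summable_on UNIV"
definition wsq :: "('i \<Rightarrow> real) \<Rightarrow> ('i \<Rightarrow> 'b::real_inner) \<Rightarrow> real" where
  "wsq h a = (\<Sum>\<^sub>\<infinity>k. h k * (norm (a k))\<^sup>2)"
definition wip :: "('i \<Rightarrow> real) \<Rightarrow> ('i \<Rightarrow> 'b::real_inner) \<Rightarrow> ('i \<Rightarrow> 'b) \<Rightarrow> real" where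
  "wip h a b = (\<Sum>\<^sub>\<infinity>k. h k * (a k \<bullet> b k))"

lemma summable_on_nonneg_le:
  fixes f g :: "'i \<Rightarrow> real"
  assumes "g summable_on A" "\<And>x. x \<in> A \<Longrightarrow> 0 \<le> f x" "\<And>x. x \<in> A \<Longrightarrow> f x \<le> g x"
  shows "f summable_on A"
  by (rule summable_on_comparison_test[OF assms(1)]) (use assms in auto)

locale weights =
  fixes h :: "'i \<Rightarrow> real"
  assumes h: "\<And>k. 0 \<le> h k"
begin

lemma wsq_nonneg: "0 \<le> wsq h a"
  unfolding wsq_def by (intro infsum_nonneg mult_nonneg_nonneg h) auto

lemma cauchy_schwarz_abs:
  assumes "wsq_summable h a" "wsq_summable h b"
  shows "(\<lambda>k. h k * (norm (a k) * norm (b k))) summable_on UNIV"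
    and "(\<Sum>\<^sub>\<infinity>k. h k * (norm (a k) * norm (b k))) \<le> sqrt (wsq h a) * sqrt (wsq h b)"
proof -
  have fin: "(\<Sum>k\<in>K. h k * (norm (a k) * norm (b k))) \<le> sqrt (wsq h a) * sqrt (wsq h b)" if "finite K" for K
  proof -
    have "(\<Sum>k\<in>K. h k * (norm (a k) * norm (b k))) = (\<Sum>k\<in>K. \<bar>sqrt (h k) * norm (a k)\<bar> * \<bar>sqrt (h k) * norm (b k)\<bar>)"
      using h by (intro sum.cong) (auto simp: abs_mult algebra_simps)
    also have "\<dots> \<le> L2_set (\<lambda>k. sqrt (h k) * norm (a k)) K * L2_set (\<lambda>k. sqrt (h k) * norm (b k)) K"
      by (rule L2_set_mult_ineq)
    also have "\<dots> \<le> sqrt (wsq h a) * sqrt (wsq h b)"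
      unfolding L2_set_def wsq_def power_mult_distrib using assms that h
      by (intro mult_mono real_sqrt_le_mono)
         (auto simp: wsq_summable_def sum_nonneg intro!: finite_sum_le_infsum infsum_nonneg)
    finally show ?thesis .
  qed
  show s: "(\<lambda>k. h k * (norm (a k) * norm (b k))) summable_on UNIV"
    by (rule nonneg_bdd_above_summable_on) (auto intro!: bdd_aboveI2 fin mult_nonneg_nonneg h)
  show "(\<Sum>\<^sub>\<infinity>k. h k * (norm (a k) * norm (b k))) \<le> sqrt (wsq h a) * sqrt (wsq h b)"
    by (rule infsum_le_finite_sums[OF s]) (use fin in auto)
qed

lemma wip_summable:
  assumes "wsq_summable h a" "wsq_summable h b"
  shows "(\<lambda>k. norm (h k * (a k \<bullet> b k))) summable_on UNIV"
  by (rule Infinite_Sum.abs_summable_on_comparison_test'[OF cauchy_schwarz_abs(1)[OF assms]])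
     (use h in \<open>auto simp: abs_mult intro!: mult_left_mono Cauchy_Schwarz_ineq2\<close>)

lemma wip_has_sum:
  assumes "wsq_summable h a" "wsq_summable h b"
  shows "((\<lambda>k. h k * (a k \<bullet> b k)) has_sum wip h a b) UNIV"
  unfolding wip_def using abs_summable_summable[OF wip_summable[OF assms]] by simp

lemma cauchy_schwarz:
  assumes "wsq_summable h a" "wsq_summable h b"
  shows "\<bar>wip h a b\<bar> \<le> sqrt (wsq h a) * sqrt (wsq h b)"
proof -
  have "\<bar>wip h a b\<bar> \<le> (\<Sum>\<^sub>\<infinity>k. norm (h k * (a k \<bullet> b k)))"
    unfolding wip_def using norm_infsum_bound[OF wip_summable[OF assms]] by simp
  also have "\<dots> \<le> (\<Sum>\<^sub>\<infinity>k. h k * (norm (a k) * norm (b k)))"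
    by (intro infsum_mono wip_summable[OF assms] cauchy_schwarz_abs(1)[OF assms])
       (use h in \<open>auto simp: abs_mult intro!: mult_left_mono Cauchy_Schwarz_ineq2\<close>)
  also have "\<dots> \<le> sqrt (wsq h a) * sqrt (wsq h b)" by (rule cauchy_schwarz_abs(2)[OF assms])
  finally show ?thesis .
qed

lemma wsq_has_sum: "wsq_summable h a \<Longrightarrow> ((\<lambda>k. h k * (norm (a k))\<^sup>2) has_sum wsq h a) UNIV"
  by (simp add: wsq_def wsq_summable_def)

lemma wsq_expand_has_sum:
  assumes "wsq_summable h a" "wsq_summable h b"
  shows "((\<lambda>k. h k * (norm (a k + c *\<^sub>R b k))\<^sup>2) has_sum (wsq h a + 2 * c * wip h a b + c\<^sup>2 * wsq h b)) UNIV"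
proof -
  have "h k * (norm (a k + c *\<^sub>R b k))\<^sup>2 = h k * (norm (a k))\<^sup>2 + 2 * c * (h k * (a k \<bullet> b k)) + c\<^sup>2 * (h k * (norm (b k))\<^sup>2)" for k
    unfolding power2_norm_eq_inner by (simp add: inner_simps inner_commute power2_eq_square algebra_simps)
  moreover have "((\<lambda>k. h k * (norm (a k))\<^sup>2 + 2 * c * (h k * (a k \<bullet> b k)) + c\<^sup>2 * (h k * (norm (b k))\<^sup>2))
    has_sum (wsq h a + 2 * c * wip h a b + c\<^sup>2 * wsq h b)) UNIV"
    by (intro has_sum_add has_sum_cmult_right wsq_has_sum wip_has_sum assms)
  ultimately show ?thesis by simp
qed

lemma wsq_summable_lincomb: "wsq_summable h a \<Longrightarrow> wsq_summable h b \<Longrightarrow> wsq_summable h (\<lambda>k. a k + c *\<^sub>R b k)"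
  unfolding wsq_summable_def using wsq_expand_has_sum[of a b c] by (auto simp: summable_on_def wsq_summable_def)

lemma wsq_expand:
  assumes "wsq_summable h a" "wsq_summable h b"
  shows "wsq h (\<lambda>k. a k + c *\<^sub>R b k) = wsq h a + 2 * c * wip h a b + c\<^sup>2 * wsq h b"
  unfolding wsq_def[of h "\<lambda>k. a k + c *\<^sub>R b k"] by (rule infsumI) (rule wsq_expand_has_sum[OF assms])

lemma wsq_zero: "wsq_summable h (\<lambda>k. 0)"
  by (simp add: wsq_summable_def)

lemma wsq_summable_scale: "wsq_summable h b \<Longrightarrow> wsq_summable h (\<lambda>k. c *\<^sub>R b k)"
  using wsq_summable_lincomb[OF wsq_zero, of b c] by simp

lemma wsq_summable_diff: "wsq_summable h a \<Longrightarrow> wsq_summable h b \<Longrightarrow> wsq_summable h (\<lambda>k. a k - b k)"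
  using wsq_summable_lincomb[of a b "-1"] by simp

lemma wsq_triangle:
  assumes "wsq_summable h a" "wsq_summable h b"
  shows "sqrt (wsq h (\<lambda>k. a k + b k)) \<le> sqrt (wsq h a) + sqrt (wsq h b)"
proof -
  have "wsq h (\<lambda>k. a k + b k) = wsq h a + 2 * wip h a b + wsq h b"
    using wsq_expand[OF assms, of 1] by simp
  also have "\<dots> \<le> wsq h a + 2 * (sqrt (wsq h a) * sqrt (wsq h b)) + wsq h b"
    using cauchy_schwarz[OF assms] by simp
  also have "\<dots> = (sqrt (wsq h a) + sqrt (wsq h b))\<^sup>2"
    using wsq_nonneg[of a] wsq_nonneg[of b] by (simp add: power2_sum)
  finally have "sqrt (wsq h (\<lambda>k. a k + b k)) \<le> sqrt ((sqrt (wsq h a) + sqrt (wsq h b))\<^sup>2)"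
    by (rule real_sqrt_le_mono)
  then show ?thesis using wsq_nonneg[of a] wsq_nonneg[of b] by simp
qed

text \<open>The squared norm along a curve that is differentiable in the norm of \<open>\<ell>\<^sup>2(h)\<close>. Insert
  \<open>a(\<tau>) = a(t) + (\<tau> - t)(d + r(\<tau>))\<close> into the quadratic form; the remainder \<open>r\<close> tends to zero in norm and
  is handled by the Cauchy-Schwarz inequality.\<close>

theorem wsq_has_derivative:
  assumes a: "\<And>\<tau>. \<tau> \<in> S \<Longrightarrow> wsq_summable h (a \<tau>)" and d: "wsq_summable h d" and t: "t \<in> S"
    and lim: "((\<lambda>\<tau>. wsq h (\<lambda>k. (a \<tau> k - a t k) /\<^sub>R (\<tau> - t) - d k)) \<longlongrightarrow> 0) (at t within S)"
  shows "((\<lambda>\<tau>. wsq h (a \<tau>)) has_real_derivative 2 * wip h (a t) d) (at t within S)"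
proof -
  define r where "r \<tau> k = (a \<tau> k - a t k) /\<^sub>R (\<tau> - t) - d k" for \<tau> k
  have r: "wsq_summable h (r \<tau>)" if "\<tau> \<in> S" for \<tau>
    unfolding r_def by (intro wsq_summable_diff wsq_summable_scale a d t that)
  have lim0: "((\<lambda>\<tau>. sqrt (wsq h (r \<tau>))) \<longlongrightarrow> 0) (at t within S)"
    using tendsto_real_sqrt[OF lim] by (simp add: r_def[abs_def])
  let ?D = "\<lambda>\<tau>. (wsq h (a \<tau>) - wsq h (a t)) / (\<tau> - t) - 2 * wip h (a t) d"
    and ?e = "\<lambda>\<tau>. 2 * (sqrt (wsq h (a t)) * sqrt (wsq h (r \<tau>))) + \<bar>\<tau> - t\<bar> * (sqrt (wsq h d) + sqrt (wsq h (r \<tau>)))\<^sup>2"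
  have "((\<lambda>\<tau>. (wsq h (a \<tau>) - wsq h (a t)) / (\<tau> - t) - 2 * wip h (a t) d) \<longlongrightarrow> 0) (at t within S)"
  proof (rule Lim_null_comparison)
    show "\<forall>\<^sub>F \<tau> in at t within S. norm (?D \<tau>)
      \<le> ?e \<tau>"
      unfolding eventually_at_filter
    proof (rule always_eventually, intro allI impI)
      fix \<tau> assume \<tau>: "\<tau> \<noteq> t" "\<tau> \<in> S"
      let ?b = "\<lambda>k. d k + r \<tau> k"
      have b: "wsq_summable h ?b" using wsq_summable_lincomb[OF d r[OF \<tau>(2)], of 1] by simp
      have "a \<tau> = (\<lambda>k. a t k + (\<tau> - t) *\<^sub>R ?b k)" using \<tau> by (simp add: r_def)
      then have "wsq h (a \<tau>) = wsq h (a t) + 2 * (\<tau> - t) * wip h (a t) ?b + (\<tau> - t)\<^sup>2 * wsq h ?b"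
        using wsq_expand[OF a[OF t] b, of "\<tau> - t"] by simp
      then have "(wsq h (a \<tau>) - wsq h (a t)) / (\<tau> - t) = 2 * wip h (a t) ?b + (\<tau> - t) * wsq h ?b"
        using \<tau> by (simp add: field_simps power2_eq_square)
      also have "wip h (a t) ?b = wip h (a t) d + wip h (a t) (r \<tau>)"
      proof -
        have "((\<lambda>k. h k * (a t k \<bullet> d k) + h k * (a t k \<bullet> r \<tau> k)) has_sum (wip h (a t) d + wip h (a t) (r \<tau>))) UNIV"
          by (intro has_sum_add wip_has_sum a t d r \<tau>)
        then show ?thesis unfolding wip_def[of h _ ?b] by (intro infsumI) (simp add: inner_add_right distrib_left)
      qed
      finally have "norm (?D \<tau>)
          = \<bar>2 * wip h (a t) (r \<tau>) + (\<tau> - t) * wsq h ?b\<bar>" by simp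
      also have "\<dots> \<le> 2 * \<bar>wip h (a t) (r \<tau>)\<bar> + \<bar>\<tau> - t\<bar> * wsq h ?b"
        using abs_triangle_ineq[of "2 * wip h (a t) (r \<tau>)" "(\<tau> - t) * wsq h ?b"] wsq_nonneg[of ?b] by (simp add: abs_mult)
      also have "wsq h ?b = (sqrt (wsq h ?b))\<^sup>2" using wsq_nonneg[of ?b] by simp
      also have "2 * \<bar>wip h (a t) (r \<tau>)\<bar> + \<bar>\<tau> - t\<bar> * (sqrt (wsq h ?b))\<^sup>2 \<le>
        ?e \<tau>"
        by (intro add_mono mult_left_mono power_mono cauchy_schwarz wsq_triangle a t d r \<tau>) (auto simp: wsq_nonneg)
      finally show "norm (?D \<tau>)
      \<le> ?e \<tau>" .
    qed
    show "(?e \<longlongrightarrow> 0) (at t within S)"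
      by (rule tendsto_eq_intros lim0 refl)+ simp
  qed
  then show ?thesis
    unfolding has_field_derivative_iff by (rule LIM_zero_cancel)
qed

lemma wsq_sqrt_continuous:
  assumes a: "\<And>\<tau>. \<tau> \<in> S \<Longrightarrow> wsq_summable h (a \<tau>)"
    and lim: "\<And>t. t \<in> S \<Longrightarrow> ((\<lambda>\<tau>. sqrt (wsq h (\<lambda>k. a \<tau> k - a t k))) \<longlongrightarrow> 0) (at t within S)"
  shows "continuous_on S (\<lambda>t. sqrt (wsq h (a t)))"
  unfolding continuous_on_def
proof
  fix t assume t: "t \<in> S"
  show "((\<lambda>\<tau>. sqrt (wsq h (a \<tau>))) \<longlongrightarrow> sqrt (wsq h (a t))) (at t within S)"
  proof (rule LIM_zero_cancel, rule Lim_null_comparison[OF _ lim[OF t]])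
    show "\<forall>\<^sub>F \<tau> in at t within S. norm (sqrt (wsq h (a \<tau>)) - sqrt (wsq h (a t))) \<le> sqrt (wsq h (\<lambda>k. a \<tau> k - a t k))"
      unfolding eventually_at_filter
    proof (rule always_eventually, intro allI impI)
      fix \<tau> assume \<tau>: "\<tau> \<in> S"
      note d = wsq_summable_diff[OF a[OF \<tau>] a[OF t]] wsq_summable_diff[OF a[OF t] a[OF \<tau>]]
      have "wsq h (\<lambda>k. a \<tau> k - a t k) = wsq h (\<lambda>k. a t k - a \<tau> k)"
        by (simp add: wsq_def norm_minus_commute)
      with wsq_triangle[OF a[OF t] d(1)] wsq_triangle[OF a[OF \<tau>] d(2)]
      show "norm (sqrt (wsq h (a \<tau>)) - sqrt (wsq h (a t))) \<le> sqrt (wsq h (\<lambda>k. a \<tau> k - a t k))"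
        by simp
    qed
  qed
qed

end

lemma wsq_mono:
  assumes "\<And>k. 0 \<le> h k" "\<And>k. h k \<le> g k" "wsq_summable g a"
  shows "wsq_summable h a" "wsq h a \<le> wsq g a"
proof -
  have le: "h k * (norm (a k))\<^sup>2 \<le> g k * (norm (a k))\<^sup>2" for k by (intro mult_right_mono assms) auto
  show s: "wsq_summable h a" unfolding wsq_summable_def
    by (rule summable_on_nonneg_le[OF assms(3)[unfolded wsq_summable_def]]) (use assms le in auto)
  then show "wsq h a \<le> wsq g a" using assms(3) le unfolding wsq_def wsq_summable_def by (intro infsum_mono)
qed

text \<open>Since \<open>1 + |k|\<^sup>2\<close> dominates each of the three \<open>1 + k\<^sub>j\<^sup>2\<close>, its power \<open>-2\<close> is at most the product of the
  \<open>(1 + k\<^sub>j\<^sup>2)\<^bsup>-2/3\<^esup>\<close>, and \<open>n\<^bsup>-4/3\<^esup>\<close> is summable in one dimension.\<close>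

lemma lattice_summable: "(\<lambda>k::int^3. (1 + (norm (wave_vec k))\<^sup>2) powr (-2)) summable_on UNIV"
proof -
  define p where "p n = (1 + (real_of_int n)\<^sup>2) powr (-2/3)" for n :: int
  have p0: "0 \<le> p n" for n by (simp add: p_def)
  have "(\<lambda>n. p (int n)) summable_on UNIV"
  proof (rule summable_nonneg_imp_summable_on)
    have "summable (\<lambda>n. real n powr (-4/3))" by (subst summable_real_powr_iff) simp
    then show "summable (\<lambda>n. p (int n))"
    proof (rule summable_comparison_test_ev[rotated])
      show "\<forall>\<^sub>F n in sequentially. norm (p (int n)) \<le> real n powr (-4/3)"
        using eventually_gt_at_top[of 0]
      proof eventually_elim
        case (elim n)
        have "real n powr (-4/3) = (real n powr 2) powr (-2/3)" by (simp only: powr_powr) simp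
        also have "real n powr 2 = (real n)\<^sup>2" using elim by (simp add: powr_numeral)
        also have "((real n)\<^sup>2) powr (-2/3) \<ge> (1 + (real n)\<^sup>2) powr (-2/3)"
          using elim by (intro powr_mono2') auto
        finally show ?case using p0 by (simp add: p_def)
      qed
    qed
  qed (use p0 in auto)
  then have nat: "p summable_on range int" by (subst summable_on_reindex) (auto simp: o_def)
  have "p summable_on range (\<lambda>n. - int n)"
    using \<open>(\<lambda>n. p (int n)) summable_on UNIV\<close> by (subst summable_on_reindex) (auto simp: o_def inj_on_def p_def)
  then have "p summable_on (range int \<union> (range (\<lambda>n. - int n) - range int))"
    using nat by (intro summable_on_Un_disjoint) (auto intro: summable_on_subset_banach)
  moreover have "range int \<union> (range (\<lambda>n. - int n) - range int) = UNIV"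
  proof -
    have "n \<in> range int \<union> (range (\<lambda>n. - int n) - range int)" for n :: int
      by (cases n rule: int_cases2) auto
    then show ?thesis by auto
  qed
  ultimately have sp: "p summable_on UNIV" by simp
  define P where "P = infsum p UNIV"
  have finP: "sum p I \<le> P" if "finite I" for I
    unfolding P_def by (rule finite_sum_le_infsum[OF sp that]) (use p0 in auto)
  have bound: "(1 + (norm (wave_vec k))\<^sup>2) powr (-2) \<le> p (k$1) * p (k$2) * p (k$3)" for k
  proof -
    let ?W = "1 + (norm (wave_vec k))\<^sup>2"
    have W: "(norm (wave_vec k))\<^sup>2 = (\<Sum>j\<in>UNIV. (2 * pi * real_of_int (k$j))\<^sup>2)"
      unfolding power2_norm_eq_inner inner_vec_def by (simp add: wave_vec_def power2_eq_square)
    have 1: "1 + (real_of_int (k$j))\<^sup>2 \<le> ?W" for j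
    proof -
      have "(real_of_int (k$j))\<^sup>2 \<le> (2 * pi * real_of_int (k$j))\<^sup>2"
      proof -
        have "1 \<le> 2 * pi" using pi_gt3 by simp
        then have "1 * \<bar>real_of_int (k$j)\<bar> \<le> 2 * pi * \<bar>real_of_int (k$j)\<bar>" by (intro mult_right_mono) auto
        then show ?thesis using pi_gt_zero by (intro abs_le_square_iff[THEN iffD1]) (simp add: abs_mult)
      qed
      also have "\<dots> \<le> (norm (wave_vec k))\<^sup>2" unfolding W by (rule member_le_sum) auto
      finally show ?thesis by simp
    qed
    have "?W powr (-2/3) \<le> p (k$j)" for j
      unfolding p_def using 1[of j] by (intro powr_mono2') (auto intro: add_pos_nonneg)
    then have "?W powr (-2/3) * ?W powr (-2/3) * ?W powr (-2/3) \<le> p (k$1) * p (k$2) * p (k$3)"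
      by (intro mult_mono) (auto simp: p0)
    then show ?thesis by (simp add: powr_add[symmetric])
  qed
  show ?thesis
  proof (rule nonneg_bdd_above_summable_on)
    show "bdd_above (sum (\<lambda>k::int^3. (1 + (norm (wave_vec k))\<^sup>2) powr (-2)) ` {F. F \<subseteq> UNIV \<and> finite F})"
    proof (rule bdd_aboveI2)
      fix K :: "(int^3) set" assume "K \<in> {F. F \<subseteq> UNIV \<and> finite F}"
      then have K: "finite K" by simp
      define I where "I = (\<lambda>k. k$1) ` K \<union> (\<lambda>k. k$2) ` K \<union> (\<lambda>k. k$3) ` K"
      have I: "finite I" using K by (simp add: I_def)
      let ?v = "\<lambda>k::int^3. (k$1, k$2, k$3)"
      have inj: "inj_on ?v K" by (auto simp: inj_on_def vec_eq_iff forall_3)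
      have "(\<Sum>k\<in>K. (1 + (norm (wave_vec k))\<^sup>2) powr (-2)) \<le> (\<Sum>k\<in>K. p (k$1) * p (k$2) * p (k$3))"
        by (intro sum_mono bound)
      also have "\<dots> = (\<Sum>(a,b,c)\<in>?v ` K. p a * p b * p c)"
        using inj by (simp add: sum.reindex o_def)
      also have "\<dots> \<le> (\<Sum>(a,b,c)\<in>I \<times> I \<times> I. p a * p b * p c)"
      proof (rule sum_mono2)
        show "?v ` K \<subseteq> I \<times> I \<times> I" by (auto simp: I_def)
      qed (use I p0 in auto)
      also have "\<dots> = sum p I * sum p I * sum p I"
        by (simp only: sum.cartesian_product[symmetric] case_prod_conv mult.assoc
            sum_distrib_left[symmetric] sum_distrib_right[symmetric])
      also have "\<dots> \<le> P * P * P"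
        using finP[OF I] p0 by (intro mult_mono) (auto intro!: sum_nonneg mult_nonneg_nonneg infsum_nonneg simp: P_def)
      finally show "(\<Sum>k\<in>K. (1 + (norm (wave_vec k))\<^sup>2) powr (-2)) \<le> P * P * P" .
    qed
  qed auto
qed

section \<open>Square integrable functions on the torus\<close>

lemma L2_torus_integrable:
  fixes f :: "real^3 \<Rightarrow> 'a::euclidean_space"
  assumes "f \<in> L2_torus"
  shows "integrable torus f"
proof (rule Bochner_Integration.integrable_bound)
  show "integrable torus (\<lambda>x. 1 + (norm (f x))\<^sup>2)" using assms by (simp add: L2_torus_def)
  show "AE x in torus. norm (f x) \<le> norm (1 + (norm (f x))\<^sup>2)"
  proof (rule AE_I2)
    fix x
    have "2 * norm (f x) \<le> 1 + (norm (f x))\<^sup>2"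
      using sum_squares_bound[of 1 "norm (f x)"] by simp
    then have "norm (f x) \<le> 1 + (norm (f x))\<^sup>2" using norm_ge_zero[of "f x"] by linarith
    then show "norm (f x) \<le> norm (1 + (norm (f x))\<^sup>2)" by simp
  qed
qed (use assms in \<open>simp add: L2_torus_def\<close>)

lemma L2_torus_mult_integrable:
  fixes f g :: "real^3 \<Rightarrow> real"
  assumes f: "f \<in> L2_torus" and g: "g \<in> L2_torus"
  shows "integrable torus (\<lambda>x. f x * g x)"
proof (rule Bochner_Integration.integrable_bound)
  show "integrable torus (\<lambda>x. (f x)\<^sup>2 + (g x)\<^sup>2)" using assms by (simp add: L2_torus_def)
  show "AE x in torus. norm (f x * g x) \<le> norm ((f x)\<^sup>2 + (g x)\<^sup>2)"
  proof (rule AE_I2)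
    fix x
    have "0 \<le> (\<bar>f x\<bar> - \<bar>g x\<bar>)\<^sup>2" by simp
    then have "2 * (\<bar>f x\<bar> * \<bar>g x\<bar>) \<le> (f x)\<^sup>2 + (g x)\<^sup>2" by (simp add: power2_diff)
    moreover have "0 \<le> \<bar>f x\<bar> * \<bar>g x\<bar>" by simp
    ultimately show "norm (f x * g x) \<le> norm ((f x)\<^sup>2 + (g x)\<^sup>2)"
      unfolding real_norm_def abs_mult by linarith
  qed
  have "f \<in> borel_measurable torus" "g \<in> borel_measurable torus" using assms by (auto simp: L2_torus_def)
  then show "(\<lambda>x. f x * g x) \<in> borel_measurable torus" by measurable
qed

lemma L2_torus_add:
  fixes f g :: "real^3 \<Rightarrow> 'a::euclidean_space"
  assumes "f \<in> L2_torus" "g \<in> L2_torus"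
  shows "(\<lambda>x. f x + g x) \<in> L2_torus"
proof -
  have [measurable]: "f \<in> borel_measurable torus" "g \<in> borel_measurable torus"
    using assms by (auto simp: L2_torus_def)
  have "integrable torus (\<lambda>x. (norm (f x + g x))\<^sup>2)"
  proof (rule Bochner_Integration.integrable_bound)
    show "integrable torus (\<lambda>x. 2 * (norm (f x))\<^sup>2 + 2 * (norm (g x))\<^sup>2)" using assms by (simp add: L2_torus_def)
    show "AE x in torus. norm ((norm (f x + g x))\<^sup>2) \<le> norm (2 * (norm (f x))\<^sup>2 + 2 * (norm (g x))\<^sup>2)"
    proof (rule AE_I2)
      fix x
      have "(norm (f x + g x))\<^sup>2 \<le> (norm (f x) + norm (g x))\<^sup>2"
        by (intro power_mono norm_triangle_ineq) auto
      also have "\<dots> \<le> 2 * (norm (f x))\<^sup>2 + 2 * (norm (g x))\<^sup>2"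
        using zero_le_power2[of "norm (f x) - norm (g x)"] by (simp add: power2_sum power2_diff)
      finally show "norm ((norm (f x + g x))\<^sup>2) \<le> norm (2 * (norm (f x))\<^sup>2 + 2 * (norm (g x))\<^sup>2)" by simp
    qed
  qed measurable
  then show ?thesis by (auto simp: L2_torus_def)
qed

lemma L2_torus_scaleR: "f \<in> L2_torus \<Longrightarrow> (\<lambda>x. c *\<^sub>R f x) \<in> L2_torus"
  by (auto simp: L2_torus_def power_mult_distrib)

lemma L2_torus_diff: "f \<in> L2_torus \<Longrightarrow> g \<in> L2_torus \<Longrightarrow> (\<lambda>x. f x - g x) \<in> L2_torus"
  using L2_torus_add[OF _ L2_torus_scaleR[of g "-1"], of f] by simp

lemma L2_torus_inner:
  fixes f :: "real^3 \<Rightarrow> 'a::euclidean_space"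
  assumes "f \<in> L2_torus"
  shows "(\<lambda>x. f x \<bullet> b) \<in> L2_torus"
proof -
  have [measurable]: "f \<in> borel_measurable torus" using assms by (auto simp: L2_torus_def)
  have "integrable torus (\<lambda>x. (norm (f x \<bullet> b))\<^sup>2)"
  proof (rule Bochner_Integration.integrable_bound)
    show "integrable torus (\<lambda>x. (norm b)\<^sup>2 * (norm (f x))\<^sup>2)" using assms by (simp add: L2_torus_def)
    show "AE x in torus. norm ((norm (f x \<bullet> b))\<^sup>2) \<le> norm ((norm b)\<^sup>2 * (norm (f x))\<^sup>2)"
    proof (rule AE_I2)
      fix x
      have "(norm (f x \<bullet> b))\<^sup>2 \<le> (norm (f x) * norm b)\<^sup>2"
        using Cauchy_Schwarz_ineq2[of "f x" b] by (intro power_mono) auto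
      then show "norm ((norm (f x \<bullet> b))\<^sup>2) \<le> norm ((norm b)\<^sup>2 * (norm (f x))\<^sup>2)"
        by (simp add: power_mult_distrib mult.commute)
    qed
  qed measurable
  then show ?thesis by (auto simp: L2_torus_def)
qed

lemma L2_torus_component:
  fixes f :: field3
  assumes "f \<in> L2_torus"
  shows "(\<lambda>x. f x $ i) \<in> L2_torus"
  using L2_torus_inner[OF assms, of "axis i 1"] by (simp add: inner_axis)

lemma L2_torus_entry:
  fixes G :: "real^3 \<Rightarrow> real^3^3"
  assumes "G \<in> L2_torus"
  shows "(\<lambda>x. G x $ i $ j) \<in> L2_torus"
  using L2_torus_inner[OF assms, of "axis i (axis j 1)"] by (simp add: inner_axis)

lemmas integrable_component = L2_torus_integrable[OF L2_torus_component]
lemmas integrable_entry = L2_torus_integrable[OF L2_torus_entry]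

section \<open>Fourier coefficients of vector fields\<close>

lemma fourier_coeff_component:
  assumes "integrable torus (\<lambda>x. f x $ i)"
  shows "fourier_coeff f k $ i = Complex (cos_coeff k (\<lambda>x. f x $ i)) (- sin_coeff k (\<lambda>x. f x $ i))"
proof -
  have e: "complex_of_real (f x $ i) * cis (- (wave_vec k \<bullet> x)) =
      complex_of_real (f x $ i * cos (wave_vec k \<bullet> x)) - \<i> * complex_of_real (f x $ i * sin (wave_vec k \<bullet> x))" for x
    by (simp add: complex_eq_iff)
  have "fourier_coeff f k $ i = (\<integral>x. complex_of_real (f x $ i * cos (wave_vec k \<bullet> x)) - \<i> * complex_of_real (f x $ i * sin (wave_vec k \<bullet> x)) \<partial>torus)"
    unfolding fourier_coeff_def by (simp only: vec_lambda_beta e)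
  also have "\<dots> = complex_of_real (cos_coeff k (\<lambda>x. f x $ i)) - \<i> * complex_of_real (sin_coeff k (\<lambda>x. f x $ i))"
    using integrable_wave[OF assms]
    by (subst Bochner_Integration.integral_diff) (auto simp: cos_coeff_def sin_coeff_def simp del: of_real_mult)
  finally show ?thesis by (simp add: complex_eq_iff)
qed

lemma fourier_coeff_inner:
  assumes "\<And>i. integrable torus (\<lambda>x. f x $ i)" "\<And>i. integrable torus (\<lambda>x. g x $ i)"
  shows "fourier_coeff f k \<bullet> fourier_coeff g k =
    (\<Sum>i\<in>UNIV. cos_coeff k (\<lambda>x. f x $ i) * cos_coeff k (\<lambda>x. g x $ i) + sin_coeff k (\<lambda>x. f x $ i) * sin_coeff k (\<lambda>x. g x $ i))"
  using assms by (simp add: inner_vec_def fourier_coeff_component inner_complex_def)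

lemma fourier_coeff_norm:
  assumes "\<And>i. integrable torus (\<lambda>x. f x $ i)"
  shows "(norm (fourier_coeff f k))\<^sup>2 = (\<Sum>i\<in>UNIV. (cos_coeff k (\<lambda>x. f x $ i))\<^sup>2 + (sin_coeff k (\<lambda>x. f x $ i))\<^sup>2)"
  unfolding power2_norm_eq_inner fourier_coeff_inner[OF assms assms] by (simp add: power2_eq_square)

lemma fourier_coeff_lincomb:
  assumes "\<And>i. integrable torus (\<lambda>x. f x $ i)" "\<And>i. integrable torus (\<lambda>x. g x $ i)"
  shows "fourier_coeff (\<lambda>x. a *\<^sub>R f x + b *\<^sub>R g x) k = a *\<^sub>R fourier_coeff f k + b *\<^sub>R fourier_coeff g k"
  using assms by (simp add: vec_eq_iff fourier_coeff_component coeff_lincomb complex_eq_iff)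

lemma fourier_coeff_diff:
  assumes "f \<in> L2_torus" "g \<in> L2_torus"
  shows "fourier_coeff (\<lambda>x. f x - g x) k = fourier_coeff f k - fourier_coeff g k"
  using fourier_coeff_lincomb[of f g 1 "-1" k] assms by (simp add: integrable_component)

lemma fourier_coeff_scaleR:
  assumes "f \<in> L2_torus"
  shows "fourier_coeff (\<lambda>x. c *\<^sub>R f x) k = c *\<^sub>R fourier_coeff f k"
  using fourier_coeff_lincomb[of f f c 0 k] assms by (simp add: integrable_component)

lemma fourier_coeff_cong_AE:
  assumes "AE x in torus. f x = g x" "f \<in> L2_torus" "g \<in> L2_torus"
  shows "fourier_coeff f k = fourier_coeff g k"
proof -
  have "fourier_coeff f k $ i = fourier_coeff g k $ i" for i
  proof -
    have [measurable]: "(\<lambda>x. f x $ i) \<in> borel_measurable torus" "(\<lambda>x. g x $ i) \<in> borel_measurable torus"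
      using integrable_component[OF assms(2)] integrable_component[OF assms(3)] by auto
    have "(\<integral>x. f x $ i * P x \<partial>torus) = (\<integral>x. g x $ i * P x \<partial>torus)" if "trigp P" for P
      using trigp_measurable[OF that] assms(1) by (intro integral_cong_AE) auto
    then have "cos_coeff k (\<lambda>x. f x $ i) = cos_coeff k (\<lambda>x. g x $ i)" "sin_coeff k (\<lambda>x. f x $ i) = sin_coeff k (\<lambda>x. g x $ i)"
      unfolding cos_coeff_def sin_coeff_def using trigp.cos trigp.sin by auto
    then show ?thesis by (simp add: fourier_coeff_component integrable_component assms)
  qed
  then show ?thesis by (simp add: vec_eq_iff)
qed

section \<open>Sobolev spaces as weighted spaces of coefficients\<close>

definition bessel_weight :: "real \<Rightarrow> int^3 \<Rightarrow> real" where
  "bessel_weight r k = (1 + (norm (wave_vec k))\<^sup>2) powr r"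

lemma bessel_weight_nonneg: "0 \<le> bessel_weight r k"
  by (simp add: bessel_weight_def)

interpretation bessel: weights "bessel_weight r" for r
  by unfold_locales (rule bessel_weight_nonneg)

lemma sobolev_iff: "f \<in> sobolev r \<longleftrightarrow> f \<in> L2_torus \<and> wsq_summable (bessel_weight r) (fourier_coeff f)"
  by (simp add: sobolev_def wsq_summable_def bessel_weight_def)

lemma sobolev_norm_wsq: "sobolev_norm r f = sqrt (wsq (bessel_weight r) (fourier_coeff f))"
  by (simp add: sobolev_norm_def wsq_def bessel_weight_def)

lemma sobolev_L2: "f \<in> sobolev r \<Longrightarrow> f \<in> L2_torus"
  by (simp add: sobolev_iff)

lemma sobolev_scaleR: "f \<in> sobolev r \<Longrightarrow> (\<lambda>x. c *\<^sub>R f x) \<in> sobolev r"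
proof -
  assume f: "f \<in> sobolev r"
  have "fourier_coeff (\<lambda>x. c *\<^sub>R f x) = (\<lambda>k. c *\<^sub>R fourier_coeff f k)"
    using sobolev_L2[OF f] by (simp add: fun_eq_iff fourier_coeff_scaleR)
  then show ?thesis using f by (simp add: sobolev_iff L2_torus_scaleR bessel.wsq_summable_scale)
qed

lemma sobolev_diff:
  assumes f: "f \<in> sobolev r" and g: "g \<in> sobolev r"
  shows "(\<lambda>x. f x - g x) \<in> sobolev r"
proof -
  have "fourier_coeff (\<lambda>x. f x - g x) = (\<lambda>k. fourier_coeff f k - fourier_coeff g k)"
    using sobolev_L2[OF f] sobolev_L2[OF g] by (simp add: fun_eq_iff fourier_coeff_diff)
  then show ?thesis using f g by (simp add: sobolev_iff L2_torus_diff bessel.wsq_summable_diff)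
qed

lemma bessel_weight_mono: "r \<le> r' \<Longrightarrow> bessel_weight r k \<le> bessel_weight r' k"
  unfolding bessel_weight_def by (intro powr_mono) auto

lemma sobolev_mono:
  assumes "r \<le> r'" "f \<in> sobolev r'"
  shows "f \<in> sobolev r" "sobolev_norm r f \<le> sobolev_norm r' f"
  using wsq_mono[of "bessel_weight r" "bessel_weight r'" "fourier_coeff f"] assms
  by (auto simp: sobolev_iff sobolev_norm_wsq bessel_weight_nonneg bessel_weight_mono)

lemma fourier_coeff_le_sobolev_norm:
  assumes "f \<in> sobolev r" "0 \<le> r"
  shows "norm (fourier_coeff f k) \<le> sobolev_norm r f"
proof -
  have s: "(\<lambda>k. bessel_weight r k * (norm (fourier_coeff f k))\<^sup>2) summable_on UNIV"
    using assms by (simp add: sobolev_iff wsq_summable_def)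
  have "1 \<le> bessel_weight r k" unfolding bessel_weight_def using assms by (intro ge_one_powr_ge_zero) auto
  then have "1 * (norm (fourier_coeff f k))\<^sup>2 \<le> bessel_weight r k * (norm (fourier_coeff f k))\<^sup>2"
    by (intro mult_right_mono) auto
  also have "\<dots> \<le> wsq (bessel_weight r) (fourier_coeff f)"
    unfolding wsq_def using finite_sum_le_infsum[OF s, of "{k}"] by (simp add: bessel_weight_nonneg)
  finally have "sqrt ((norm (fourier_coeff f k))\<^sup>2) \<le> sobolev_norm r f"
    unfolding sobolev_norm_wsq by (intro real_sqrt_le_mono) simp
  then show ?thesis by simp
qed

section \<open>Weak derivatives in terms of coefficients\<close>

lemma integral_mult_left_commute:
  fixes f g :: "'a \<Rightarrow> real"
  shows "(\<integral>x. f x * (c * g x) \<partial>M) = c * (\<integral>x. f x * g x \<partial>M)"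
proof -
  have "(\<lambda>x. f x * (c * g x)) = (\<lambda>x. c * (f x * g x))" by (simp add: fun_eq_iff)
  then show ?thesis by (simp only: integral_mult_right_zero)
qed

text \<open>The definition of the weak derivative, tested with the two waves of frequency \<open>k\<close>.\<close>

lemma has_weak_partial_coeff:
  assumes "has_weak_partial f j g"
  shows "cos_coeff k g = wave_vec k $ j * sin_coeff k f" "sin_coeff k g = - (wave_vec k $ j * cos_coeff k f)"
proof -
  have "(\<integral>x. f x * partial j (\<lambda>x. cos (wave_vec k \<bullet> x)) x \<partial>torus) = - cos_coeff k g"
    using assms trigp_test_function[OF trigp.cos] unfolding has_weak_partial_def cos_coeff_def by blast
  moreover have "(\<integral>x. f x * partial j (\<lambda>x. cos (wave_vec k \<bullet> x)) x \<partial>torus) = - (wave_vec k $ j * sin_coeff k f)"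
    by (simp add: partial_cos sin_coeff_def integral_mult_left_commute)
  ultimately show "cos_coeff k g = wave_vec k $ j * sin_coeff k f" by simp
  have "(\<integral>x. f x * partial j (\<lambda>x. sin (wave_vec k \<bullet> x)) x \<partial>torus) = - sin_coeff k g"
    using assms trigp_test_function[OF trigp.sin] unfolding has_weak_partial_def sin_coeff_def by blast
  moreover have "(\<integral>x. f x * partial j (\<lambda>x. sin (wave_vec k \<bullet> x)) x \<partial>torus) = wave_vec k $ j * cos_coeff k f"
    by (simp add: partial_sin cos_coeff_def integral_mult_left_commute)
  ultimately show "sin_coeff k g = - (wave_vec k $ j * cos_coeff k f)" by simp
qed

lemma partial_partial_fourier_eq:
  "partial j (partial_fourier K f) x =
    (\<Sum>k\<in>K. wave_vec k $ j * sin_coeff k f * cos (wave_vec k \<bullet> x) - wave_vec k $ j * cos_coeff k f * sin (wave_vec k \<bullet> x))"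
  unfolding partial_fourier_def
  by (subst partial_eqI[OF has_derivative_sum, OF has_derivative_add,
        OF has_derivative_mult_right[OF has_derivative_cos_wave] has_derivative_mult_right[OF has_derivative_sin_wave]])
     (simp add: inner_axis algebra_simps)

lemma partial_partial_fourier:
  assumes "has_weak_partial f j g"
  shows "partial j (partial_fourier K f) x = partial_fourier K g x"
  unfolding partial_partial_fourier_eq unfolding partial_fourier_def has_weak_partial_coeff[OF assms] by simp

lemma weakly_div_free_test:
  assumes "weakly_div_free f" "f \<in> L2_torus" "trigp \<phi>"
  shows "(\<Sum>j\<in>UNIV. \<integral>x. f x $ j * partial j \<phi> x \<partial>torus) = 0"
proof -
  have "(\<integral>x. (\<Sum>j\<in>UNIV. f x $ j * partial j \<phi> x) \<partial>torus) = 0"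
    using assms(1) trigp_test_function[OF assms(3)] unfolding weakly_div_free_def by blast
  moreover have "integrable torus (\<lambda>x. f x $ j * partial j \<phi> x)" for j
    by (intro integrable_mult_trigp integrable_component assms trigp_partial)
  ultimately show ?thesis by simp
qed

lemma weakly_div_free_coeff:
  assumes "weakly_div_free f" "f \<in> L2_torus"
  shows "(\<Sum>j\<in>UNIV. wave_vec k $ j * cos_coeff k (\<lambda>x. f x $ j)) = 0"
    "(\<Sum>j\<in>UNIV. wave_vec k $ j * sin_coeff k (\<lambda>x. f x $ j)) = 0"
proof -
  have "(\<integral>x. f x $ j * partial j (\<lambda>x. cos (wave_vec k \<bullet> x)) x \<partial>torus) = - (wave_vec k $ j * sin_coeff k (\<lambda>x. f x $ j))" for j
    by (simp add: partial_cos sin_coeff_def integral_mult_left_commute)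
  then show "(\<Sum>j\<in>UNIV. wave_vec k $ j * sin_coeff k (\<lambda>x. f x $ j)) = 0"
    using weakly_div_free_test[OF assms trigp.cos[of k]] by (simp add: sum_negf)
  have "(\<integral>x. f x $ j * partial j (\<lambda>x. sin (wave_vec k \<bullet> x)) x \<partial>torus) = wave_vec k $ j * cos_coeff k (\<lambda>x. f x $ j)" for j
    by (simp add: partial_sin cos_coeff_def integral_mult_left_commute)
  then show "(\<Sum>j\<in>UNIV. wave_vec k $ j * cos_coeff k (\<lambda>x. f x $ j)) = 0"
    using weakly_div_free_test[OF assms trigp.sin[of k]] by simp
qed

text \<open>At each frequency a gradient is parallel to \<open>k\<close> and a solenoidal field is perpendicular to it. This removes
  the pressure.\<close>

lemma gradient_orthogonal_solenoidal:
  assumes "has_weak_gradient p q" "weakly_div_free w" "w \<in> L2_torus"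
  shows "fourier_coeff q k \<bullet> fourier_coeff w k = 0"
proof -
  have q: "q \<in> L2_torus" "\<And>j. has_weak_partial p j (\<lambda>x. q x $ j)"
    using assms(1) by (auto simp: has_weak_gradient_def)
  have "fourier_coeff q k \<bullet> fourier_coeff w k =
     sin_coeff k p * (\<Sum>j\<in>UNIV. wave_vec k $ j * cos_coeff k (\<lambda>x. w x $ j)) - cos_coeff k p * (\<Sum>j\<in>UNIV. wave_vec k $ j * sin_coeff k (\<lambda>x. w x $ j))"
    unfolding fourier_coeff_inner[OF integrable_component[OF q(1)] integrable_component[OF assms(3)]]
      has_weak_partial_coeff[OF q(2)] sum_distrib_left sum_subtractf[symmetric]
    by (intro sum.cong) (auto simp: algebra_simps)
  then show ?thesis by (simp add: weakly_div_free_coeff[OF assms(2,3)])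
qed

lemma gradient_mean_zero:
  assumes "has_weak_gradient p q"
  shows "fourier_coeff q 0 = 0"
proof -
  have q: "q \<in> L2_torus" "\<And>j. has_weak_partial p j (\<lambda>x. q x $ j)"
    using assms(1) by (auto simp: has_weak_gradient_def)
  then show ?thesis
    by (simp add: vec_eq_iff fourier_coeff_component integrable_component has_weak_partial_coeff[OF q(2)] complex_eq_iff)
qed

text \<open>The waves of frequency \<open>k\<close> are eigenfunctions of the Laplacian.\<close>

lemma weak_laplacian_coeff:
  assumes "has_weak_laplacian f g"
  shows "fourier_coeff g k = - (norm (wave_vec k))\<^sup>2 *\<^sub>R fourier_coeff f k"
proof -
  have fg: "f \<in> L2_torus" "g \<in> L2_torus" using assms by (auto simp: has_weak_laplacian_def)
  have eigen: "(\<integral>x. g x $ i * \<phi> x \<partial>torus) = - (norm (wave_vec k))\<^sup>2 * (\<integral>x. f x $ i * \<phi> x \<partial>torus)"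
    if "trigp \<phi>" and \<phi>: "\<And>j x. partial j (partial j \<phi>) x = - (wave_vec k $ j * wave_vec k $ j) * \<phi> x" for \<phi> i
  proof -
    have "(\<integral>x. g x $ i * \<phi> x \<partial>torus) = (\<integral>x. f x $ i * (\<Sum>j\<in>UNIV. partial j (partial j \<phi>) x) \<partial>torus)"
      using assms trigp_test_function[OF that(1)] by (simp add: has_weak_laplacian_def)
    also have "\<dots> = (\<integral>x. - (norm (wave_vec k))\<^sup>2 * (f x $ i * \<phi> x) \<partial>torus)"
      unfolding \<phi> sum_distrib_right[symmetric] sum_negf power2_norm_eq_inner inner_vec_def inner_real_def
      by (intro Bochner_Integration.integral_cong) auto
    finally show ?thesis by simp
  qed
  have pc: "partial j (\<lambda>x. cos (wave_vec k \<bullet> x)) = (\<lambda>x. (\<lambda>x. - (wave_vec k $ j)) x * sin (wave_vec k \<bullet> x))"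
    and ps: "partial j (\<lambda>x. sin (wave_vec k \<bullet> x)) = (\<lambda>x. (\<lambda>x. wave_vec k $ j) x * cos (wave_vec k \<bullet> x))" for j
    by (simp_all add: fun_eq_iff partial_cos partial_sin)
  have dc: "partial j (partial j (\<lambda>x. cos (wave_vec k \<bullet> x))) x = - (wave_vec k $ j * wave_vec k $ j) * cos (wave_vec k \<bullet> x)"
    and ds: "partial j (partial j (\<lambda>x. sin (wave_vec k \<bullet> x))) x = - (wave_vec k $ j * wave_vec k $ j) * sin (wave_vec k \<bullet> x)" for j x
    unfolding pc ps
    by (subst partial_mult; simp add: trigp_differentiable trigp.intros partial_const partial_cos partial_sin)+
  show ?thesis
    using eigen[OF trigp.cos dc] eigen[OF trigp.sin ds]
    by (simp add: vec_eq_iff fourier_coeff_component integrable_component fg complex_eq_iff cos_coeff_def sin_coeff_def)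
qed

section \<open>Transport by a divergence-free field\<close>

lemma tendsto_integral_partial_fourier:
  assumes "integrable torus g" "wiener f"
  shows "((\<lambda>K. \<integral>x. g x * partial_fourier K f x \<partial>torus) \<longlongrightarrow> (\<integral>x. g x * f x \<partial>torus)) (finite_subsets_at_top UNIV)"
  using parseval_wiener[OF assms] by (simp add: has_sum_def integral_mult_partial_fourier[OF assms(1)])

text \<open>Partial sums of \<open>f\<close> are test functions for \<open>\<nabla> \<cdot> a = 0\<close>, and their gradients are the
  partial sums of the gradient, which converge uniformly.\<close>

lemma transport_mean_zero:
  assumes a: "weakly_div_free a" "a \<in> L2_torus"
    and f: "\<And>j. has_weak_partial f j (G j)" and w: "\<And>j. wiener (G j)"
  shows "(\<Sum>j\<in>UNIV. \<integral>x. a x $ j * G j x \<partial>torus) = 0"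
proof -
  note ia = integrable_component[OF a(2)]
  have z: "(\<Sum>j\<in>UNIV. \<integral>x. a x $ j * partial_fourier K (G j) x \<partial>torus) = 0" for K
    using weakly_div_free_test[OF a trigp_partial_fourier[of K f]] by (simp add: partial_partial_fourier[OF f])
  have "((\<lambda>K. \<Sum>j\<in>UNIV. \<integral>x. a x $ j * partial_fourier K (G j) x \<partial>torus) \<longlongrightarrow> (\<Sum>j\<in>UNIV. \<integral>x. a x $ j * G j x \<partial>torus)) (finite_subsets_at_top UNIV)"
    by (intro tendsto_sum tendsto_integral_partial_fourier ia w)
  then show ?thesis unfolding z by (simp add: tendsto_const_iff)
qed

text \<open>Twice the sum is the integral of \<open>a \<cdot> \<nabla>(f\<^sup>2)\<close>. The test functions are the products \<open>S\<^sub>K f S\<^sub>L f\<close> of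
  two independent partial sums: sending \<open>K\<close> and then \<open>L\<close> to infinity only ever requires the limit of one linear
  factor.\<close>

lemma transport_antisymmetric:
  assumes a: "weakly_div_free a" "a \<in> L2_torus"
    and f: "\<And>j. has_weak_partial f j (G j)" and w: "\<And>j. wiener (G j)" and wf: "wiener f"
  shows "(\<Sum>j\<in>UNIV. \<integral>x. a x $ j * G j x * f x \<partial>torus) = 0"
proof -
  note ia = integrable_component[OF a(2)]
  let ?S = "partial_fourier" and ?F = "finite_subsets_at_top (UNIV :: (int^3) set)"
  note iS = integrable_mult_trigp[OF _ trigp_partial_fourier]
  \<comment> \<open>product rule for \<open>S\<^sub>K f S\<^sub>L f\<close>, with \<open>K'\<close> in the role of \<open>L\<close>\<close>
  have z: "(\<Sum>j\<in>UNIV. (\<integral>x. a x $ j * ?S K' f x * ?S K (G j) x \<partial>torus) + (\<integral>x. a x $ j * ?S K' (G j) x * ?S K f x \<partial>torus)) = 0" for K K'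
  proof -
    have t: "trigp (\<lambda>x. ?S K f x * ?S K' f x)" by (intro trigp.mult trigp_partial_fourier)
    have "0 = (\<Sum>j\<in>UNIV. \<integral>x. a x $ j * partial j (\<lambda>x. ?S K f x * ?S K' f x) x \<partial>torus)"
      using weakly_div_free_test[OF a t] by simp
    also have "\<dots> = (\<Sum>j\<in>UNIV. \<integral>x. a x $ j * ?S K' f x * ?S K (G j) x + a x $ j * ?S K' (G j) x * ?S K f x \<partial>torus)"
      by (intro sum.cong Bochner_Integration.integral_cong refl, subst partial_mult)
         (auto intro: trigp_differentiable trigp_partial_fourier simp: partial_partial_fourier[OF f] algebra_simps)
    also have "\<dots> = (\<Sum>j\<in>UNIV. (\<integral>x. a x $ j * ?S K' f x * ?S K (G j) x \<partial>torus) + (\<integral>x. a x $ j * ?S K' (G j) x * ?S K f x \<partial>torus))"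
      by (intro sum.cong refl Bochner_Integration.integral_add iS ia)
    finally show ?thesis by simp
  qed
  have z': "(\<Sum>j\<in>UNIV. (\<integral>x. a x $ j * G j x * ?S K' f x \<partial>torus) + (\<integral>x. a x $ j * f x * ?S K' (G j) x \<partial>torus)) = 0" for K'
  proof -
    have "((\<lambda>K. \<Sum>j\<in>UNIV. (\<integral>x. a x $ j * ?S K' f x * ?S K (G j) x \<partial>torus) + (\<integral>x. a x $ j * ?S K' (G j) x * ?S K f x \<partial>torus))
      \<longlongrightarrow> (\<Sum>j\<in>UNIV. (\<integral>x. a x $ j * ?S K' f x * G j x \<partial>torus) + (\<integral>x. a x $ j * ?S K' (G j) x * f x \<partial>torus))) ?F"
      by (intro tendsto_sum tendsto_add tendsto_integral_partial_fourier iS ia w wf)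
    then have "(\<Sum>j\<in>UNIV. (\<integral>x. a x $ j * ?S K' f x * G j x \<partial>torus) + (\<integral>x. a x $ j * ?S K' (G j) x * f x \<partial>torus)) = 0"
      unfolding z by (simp add: tendsto_const_iff)
    then show ?thesis by (simp add: mult_ac)
  qed
  have "((\<lambda>K'. \<Sum>j\<in>UNIV. (\<integral>x. a x $ j * G j x * ?S K' f x \<partial>torus) + (\<integral>x. a x $ j * f x * ?S K' (G j) x \<partial>torus))
      \<longlongrightarrow> (\<Sum>j\<in>UNIV. (\<integral>x. a x $ j * G j x * f x \<partial>torus) + (\<integral>x. a x $ j * f x * G j x \<partial>torus))) ?F"
    by (intro tendsto_sum tendsto_add tendsto_integral_partial_fourier integrable_mult_wiener ia w wf)
  then have "(\<Sum>j\<in>UNIV. (\<integral>x. a x $ j * G j x * f x \<partial>torus) + (\<integral>x. a x $ j * f x * G j x \<partial>torus)) = 0"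
    unfolding z' by (simp add: tendsto_const_iff)
  then have "(\<Sum>j\<in>UNIV. 2 * (\<integral>x. a x $ j * G j x * f x \<partial>torus)) = 0"
    by (simp add: mult_ac)
  then show ?thesis by (simp add: sum_distrib_left[symmetric])
qed

section \<open>Absolutely convergent series of third-order Sobolev fields\<close>

text \<open>The constant of the embedding of \<open>H\<^sup>3\<close> into functions whose gradient is bounded.\<close>

definition sobolev_const :: real where
  "sobolev_const = sqrt (\<Sum>\<^sub>\<infinity>k::int^3. (1 + (norm (wave_vec k))\<^sup>2) powr (-2))"

lemma sobolev_const_nonneg: "0 \<le> sobolev_const"
  unfolding sobolev_const_def by (intro real_sqrt_ge_zero infsum_nonneg) auto

text \<open>Cauchy-Schwarz for the splitting \<open>1/2 = -1 + 3/2\<close> of the weight exponent: the factor with exponent \<open>-1\<close> is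
  square summable by the lattice sum, the one with exponent \<open>3/2\<close> by membership in \<open>H\<^sup>3\<close>.\<close>

lemma sobolev_embedding_sum:
  assumes "f \<in> sobolev 3"
  shows "(\<lambda>k. bessel_weight (1/2) k * norm (fourier_coeff f k)) summable_on UNIV"
    and "(\<Sum>\<^sub>\<infinity>k. bessel_weight (1/2) k * norm (fourier_coeff f k)) \<le> sobolev_const * sobolev_norm 3 f"
proof -
  interpret one: weights "\<lambda>k::int^3. 1" by unfold_locales simp
  let ?a = "\<lambda>k. bessel_weight (-1) k" and ?b = "\<lambda>k. bessel_weight (3/2) k *\<^sub>R fourier_coeff f k"
  have a2: "1 * (norm (?a k))\<^sup>2 = (1 + (norm (wave_vec k))\<^sup>2) powr (-2)" for k
    by (simp only: bessel_weight_def power2_eq_square real_norm_def abs_mult[symmetric] powr_add[symmetric] mult_1_left) simp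
  have b2: "1 * (norm (?b k))\<^sup>2 = bessel_weight 3 k * (norm (fourier_coeff f k))\<^sup>2" for k
    by (simp add: bessel_weight_def power2_eq_square powr_add[symmetric] mult_ac)
  have ab: "1 * (norm (?a k) * norm (?b k)) = bessel_weight (1/2) k * norm (fourier_coeff f k)" for k
  proof -
    have "bessel_weight (-1) k * bessel_weight (3/2) k = bessel_weight (1/2) k"
      unfolding bessel_weight_def powr_add[symmetric] by simp
    then show ?thesis by (simp add: bessel_weight_nonneg flip: mult.assoc)
  qed
  have sa: "wsq_summable (\<lambda>k. 1) ?a" unfolding wsq_summable_def a2 by (rule lattice_summable)
  have sb: "wsq_summable (\<lambda>k. 1) ?b" using assms unfolding wsq_summable_def b2 by (simp add: sobolev_iff wsq_summable_def)
  note cs = one.cauchy_schwarz_abs[OF sa, of "\<lambda>k. norm (?b k)"]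
  have nn: "norm (norm (?b k)) = norm (?b k)" for k by simp
  have sb': "wsq_summable (\<lambda>k. 1) (\<lambda>k. norm (?b k))" using sb by (simp add: wsq_summable_def)
  show "(\<lambda>k. bessel_weight (1/2) k * norm (fourier_coeff f k)) summable_on UNIV"
    using cs(1)[OF sb'] by (simp only: nn ab)
  have "sqrt (wsq (\<lambda>k. 1) ?a) = sobolev_const"
    unfolding wsq_def a2 sobolev_const_def ..
  moreover have "sqrt (wsq (\<lambda>k. 1) (\<lambda>k. norm (?b k))) = sobolev_norm 3 f"
    unfolding sobolev_norm_wsq wsq_def using b2 by (simp only: nn)
  ultimately show "(\<Sum>\<^sub>\<infinity>k. bessel_weight (1/2) k * norm (fourier_coeff f k)) \<le> sobolev_const * sobolev_norm 3 f"
    using cs(2)[OF sb'] by (simp only: nn ab)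
qed

lemma abs_fourier_le_coeff:
  assumes "f \<in> L2_torus"
  shows "\<bar>cos_coeff k (\<lambda>x. f x $ i)\<bar> \<le> norm (fourier_coeff f k)" "\<bar>sin_coeff k (\<lambda>x. f x $ i)\<bar> \<le> norm (fourier_coeff f k)"
proof -
  have "norm (fourier_coeff f k $ i) \<le> norm (fourier_coeff f k)" by (rule Finite_Cartesian_Product.norm_nth_le)
  then show "\<bar>cos_coeff k (\<lambda>x. f x $ i)\<bar> \<le> norm (fourier_coeff f k)" "\<bar>sin_coeff k (\<lambda>x. f x $ i)\<bar> \<le> norm (fourier_coeff f k)"
    using abs_Re_le_cmod[of "fourier_coeff f k $ i"] abs_Im_le_cmod[of "fourier_coeff f k $ i"]
    by (auto simp: fourier_coeff_component integrable_component[OF assms])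
qed

lemma bessel_half: "1 \<le> bessel_weight (1/2) k" "norm (wave_vec k) \<le> bessel_weight (1/2) k"
proof -
  have "bessel_weight (1/2) k = sqrt (1 + (norm (wave_vec k))\<^sup>2)"
    by (simp add: bessel_weight_def powr_half_sqrt)
  then show "1 \<le> bessel_weight (1/2) k" "norm (wave_vec k) \<le> bessel_weight (1/2) k"
    by (auto intro: real_le_rsqrt)
qed

lemma wienerI:
  assumes g: "integrable torus g"
    and le: "\<And>k. abs_fourier g k \<le> 2 * (bessel_weight (1/2) k * norm (fourier_coeff f k))" and f: "f \<in> sobolev 3"
  shows "wiener g" "infsum (abs_fourier g) UNIV \<le> 2 * (sobolev_const * sobolev_norm 3 f)"
proof -
  note s = summable_on_cmult_right[OF sobolev_embedding_sum(1)[OF f], of 2]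
  have "abs_fourier g summable_on UNIV"
    by (rule summable_on_nonneg_le[OF s]) (auto simp: abs_fourier_nonneg le)
  then show "wiener g" using g by (simp add: wiener_def)
  have "infsum (abs_fourier g) UNIV \<le> (\<Sum>\<^sub>\<infinity>k. 2 * (bessel_weight (1/2) k * norm (fourier_coeff f k)))"
    by (intro infsum_mono s \<open>abs_fourier g summable_on UNIV\<close> le)
  also have "\<dots> \<le> 2 * (sobolev_const * sobolev_norm 3 f)"
    using sobolev_embedding_sum(2)[OF f] by (simp add: infsum_cmult_right')
  finally show "infsum (abs_fourier g) UNIV \<le> 2 * (sobolev_const * sobolev_norm 3 f)" .
qed

lemma sobolev3_wiener:
  assumes f: "f \<in> sobolev 3"
  shows "wiener (\<lambda>x. f x $ i)"
proof (rule wienerI(1)[OF integrable_component[OF sobolev_L2[OF f]] _ f])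
  fix k
  have "abs_fourier (\<lambda>x. f x $ i) k \<le> 2 * (1 * norm (fourier_coeff f k))"
    using abs_fourier_le_coeff[OF sobolev_L2[OF f], of k i] by (simp add: abs_fourier_def)
  also have "\<dots> \<le> 2 * (bessel_weight (1/2) k * norm (fourier_coeff f k))"
    using bessel_half(1)[of k] by (intro mult_left_mono mult_right_mono) auto
  finally show "abs_fourier (\<lambda>x. f x $ i) k \<le> 2 * (bessel_weight (1/2) k * norm (fourier_coeff f k))" .
qed

lemma has_weak_jacobianD:
  assumes "has_weak_jacobian f G"
  shows "f \<in> L2_torus" "G \<in> L2_torus" "has_weak_partial (\<lambda>x. f x $ i) j (\<lambda>x. G x $ i $ j)"
  using assms by (auto simp: has_weak_jacobian_def)

text \<open>A derivative costs a factor \<open>|k|\<close>, which the weight \<open>(1 + |k|\<^sup>2)\<^bsup>1/2\<^esup>\<close> in the embedding absorbs.\<close>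

lemma sobolev3_jacobian_wiener:
  assumes f: "f \<in> sobolev 3" and G: "has_weak_jacobian f G"
  shows "wiener (\<lambda>x. G x $ i $ j)" "AE x in torus. \<bar>G x $ i $ j\<bar> \<le> 2 * (sobolev_const * sobolev_norm 3 f)"
proof -
  have le: "abs_fourier (\<lambda>x. G x $ i $ j) k \<le> 2 * (bessel_weight (1/2) k * norm (fourier_coeff f k))" for k
  proof -
    have "\<bar>wave_vec k $ j\<bar> \<le> bessel_weight (1/2) k"
      using component_le_norm_cart[of "wave_vec k" j] bessel_half(2)[of k] by simp
    then have "\<bar>wave_vec k $ j\<bar> * \<bar>c\<bar> \<le> bessel_weight (1/2) k * norm (fourier_coeff f k)"
      if "\<bar>c\<bar> \<le> norm (fourier_coeff f k)" for c
      using that by (intro mult_mono) auto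
    from this[OF abs_fourier_le_coeff(1)[OF sobolev_L2[OF f], of k i]] this[OF abs_fourier_le_coeff(2)[OF sobolev_L2[OF f], of k i]]
    show ?thesis
      by (simp add: abs_fourier_def has_weak_partial_coeff[OF has_weak_jacobianD(3)[OF G]] abs_mult)
  qed
  note w = wienerI[OF integrable_entry[OF has_weak_jacobianD(2)[OF G]] le f]
  show "wiener (\<lambda>x. G x $ i $ j)" by (rule w(1))
  show "AE x in torus. \<bar>G x $ i $ j\<bar> \<le> 2 * (sobolev_const * sobolev_norm 3 f)"
    using wiener_AE_bounded[OF w(1)] by eventually_elim (use w(2) in simp)
qed

section \<open>Parseval for the energy\<close>

lemma has_sum_finite_sum:
  fixes f :: "'i \<Rightarrow> 'k \<Rightarrow> real"
  assumes "\<And>i. i \<in> I \<Longrightarrow> (f i has_sum s i) A"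
  shows "((\<lambda>k. \<Sum>i\<in>I. f i k) has_sum (\<Sum>i\<in>I. s i)) A"
  using assms by (induction I rule: infinite_finite_induct) (auto intro!: has_sum_add)

lemma sobolev3_inner_has_sum:
  assumes f: "f \<in> sobolev 3" and g: "\<And>i. integrable torus (\<lambda>x. g x $ i)"
  shows "((\<lambda>k. fourier_coeff g k \<bullet> fourier_coeff f k) has_sum (\<Sum>i\<in>UNIV. \<integral>x. g x $ i * f x $ i \<partial>torus)) UNIV"
proof -
  have "((\<lambda>k. \<Sum>i\<in>UNIV. cos_coeff k (\<lambda>x. f x $ i) * cos_coeff k (\<lambda>x. g x $ i) + sin_coeff k (\<lambda>x. f x $ i) * sin_coeff k (\<lambda>x. g x $ i))
     has_sum (\<Sum>i\<in>UNIV. \<integral>x. g x $ i * f x $ i \<partial>torus)) UNIV"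
    by (intro has_sum_finite_sum parseval_wiener g sobolev3_wiener f)
  then show ?thesis
    by (simp add: fourier_coeff_inner[OF g integrable_component[OF sobolev_L2[OF f]]] mult.commute)
qed

lemma norm_vec_power2: "(norm (x :: 'a::real_inner ^ 'n))\<^sup>2 = (\<Sum>i\<in>UNIV. (norm (x $ i))\<^sup>2)"
  by (simp add: power2_norm_eq_inner inner_vec_def)

lemma L2_torus_norm_power2:
  fixes f :: field3
  assumes "f \<in> L2_torus"
  shows "(L2_torus_norm f)\<^sup>2 = (\<Sum>i\<in>UNIV. \<integral>x. f x $ i * f x $ i \<partial>torus)"
proof -
  have "(L2_torus_norm f)\<^sup>2 = (\<integral>x. (norm (f x))\<^sup>2 \<partial>torus)"
    unfolding L2_torus_norm_def by (intro real_sqrt_pow2 integral_nonneg_AE) auto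
  also have "\<dots> = (\<integral>x. (\<Sum>i\<in>UNIV. f x $ i * f x $ i) \<partial>torus)"
    by (simp add: power2_norm_eq_inner inner_vec_def)
  also have "\<dots> = (\<Sum>i\<in>UNIV. \<integral>x. f x $ i * f x $ i \<partial>torus)"
    by (intro Bochner_Integration.integral_sum L2_torus_mult_integrable L2_torus_component assms)
  finally show ?thesis .
qed

lemma sobolev3_L2_norm:
  assumes f: "f \<in> sobolev 3"
  shows "((\<lambda>k. (norm (fourier_coeff f k))\<^sup>2) has_sum (L2_torus_norm f)\<^sup>2) UNIV"
  using sobolev3_inner_has_sum[OF f integrable_component[OF sobolev_L2[OF f]]]
  by (simp add: power2_norm_eq_inner[symmetric] L2_torus_norm_power2[OF sobolev_L2[OF f]])

lemma L2_torus_norm_matrix_power2: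
  fixes G :: "real^3 \<Rightarrow> real^3^3"
  assumes G: "G \<in> L2_torus"
  shows "(L2_torus_norm G)\<^sup>2 = (\<Sum>i\<in>UNIV. \<Sum>j\<in>UNIV. \<integral>x. G x $ i $ j * G x $ i $ j \<partial>torus)"
proof -
  have "(L2_torus_norm G)\<^sup>2 = (\<integral>x. (norm (G x))\<^sup>2 \<partial>torus)"
    unfolding L2_torus_norm_def by (intro real_sqrt_pow2 integral_nonneg_AE) auto
  also have "\<dots> = (\<integral>x. (\<Sum>i\<in>UNIV. \<Sum>j\<in>UNIV. G x $ i $ j * G x $ i $ j) \<partial>torus)"
    by (simp add: power2_norm_eq_inner inner_vec_def)
  also have "\<dots> = (\<Sum>i\<in>UNIV. \<Sum>j\<in>UNIV. \<integral>x. G x $ i $ j * G x $ i $ j \<partial>torus)"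
    using L2_torus_mult_integrable[OF L2_torus_entry[OF G] L2_torus_entry[OF G]] by simp
  finally show ?thesis .
qed

text \<open>An arbitrary Jacobian \<open>G0\<close> is required only so that the choice operator in \<open>grad_norm\<close> returns one.\<close>

lemma sobolev3_grad_norm:
  assumes f: "f \<in> sobolev 3" and ex: "has_weak_jacobian f G0"
  shows "((\<lambda>k. (norm (wave_vec k))\<^sup>2 * (norm (fourier_coeff f k))\<^sup>2) has_sum (grad_norm f)\<^sup>2) UNIV"
proof -
  define G where "G = (SOME G. has_weak_jacobian f G)"
  have G: "has_weak_jacobian f G" unfolding G_def using ex by (rule someI[of "\<lambda>G. has_weak_jacobian f G"])
  note iG = integrable_entry[OF has_weak_jacobianD(2)[OF G]]
  have "(grad_norm f)\<^sup>2 = (\<Sum>i\<in>UNIV. \<Sum>j\<in>UNIV. \<integral>x. G x $ i $ j * G x $ i $ j \<partial>torus)"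
    unfolding grad_norm_def G_def[symmetric] by (rule L2_torus_norm_matrix_power2[OF has_weak_jacobianD(2)[OF G]])
  moreover have "((\<lambda>k. \<Sum>i\<in>UNIV. \<Sum>j\<in>UNIV. cos_coeff k (\<lambda>x. G x $ i $ j) * cos_coeff k (\<lambda>x. G x $ i $ j) + sin_coeff k (\<lambda>x. G x $ i $ j) * sin_coeff k (\<lambda>x. G x $ i $ j))
     has_sum (\<Sum>i\<in>UNIV. \<Sum>j\<in>UNIV. \<integral>x. G x $ i $ j * G x $ i $ j \<partial>torus)) UNIV"
    by (intro has_sum_finite_sum parseval_wiener iG sobolev3_jacobian_wiener[OF f G])
  moreover have "(\<Sum>i\<in>UNIV. \<Sum>j\<in>UNIV. cos_coeff k (\<lambda>x. G x $ i $ j) * cos_coeff k (\<lambda>x. G x $ i $ j) + sin_coeff k (\<lambda>x. G x $ i $ j) * sin_coeff k (\<lambda>x. G x $ i $ j))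
     = (norm (wave_vec k))\<^sup>2 * (norm (fourier_coeff f k))\<^sup>2" for k
    unfolding fourier_coeff_norm[OF integrable_component[OF sobolev_L2[OF f]]] norm_vec_power2[of "wave_vec k"]
      has_weak_partial_coeff[OF has_weak_jacobianD(3)[OF G]] sum_product
    by (subst sum.swap) (intro sum.cong refl, simp add: power2_eq_square algebra_simps)
  ultimately show ?thesis by simp
qed

definition voigt_weight :: "real \<Rightarrow> int^3 \<Rightarrow> real" where
  "voigt_weight \<alpha> k = 1 + \<alpha>\<^sup>2 * (norm (wave_vec k))\<^sup>2"

text \<open>The identity that moves the energy of \<open>H\<^sup>3\<close> fields to the sequence space. In that space it makes sense
  for \<open>H\<^sup>1\<close> fields, which is what its time derivative needs.\<close>

lemma voigt_energy_wsq:
  assumes f: "f \<in> sobolev 3" and ex: "has_weak_jacobian f G"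
  shows "voigt_energy \<alpha> f = wsq (voigt_weight \<alpha>) (fourier_coeff f)"
proof -
  have "((\<lambda>k. (norm (fourier_coeff f k))\<^sup>2 + \<alpha>\<^sup>2 * ((norm (wave_vec k))\<^sup>2 * (norm (fourier_coeff f k))\<^sup>2)) has_sum voigt_energy \<alpha> f) UNIV"
    unfolding voigt_energy_def
    by (intro has_sum_add has_sum_cmult_right sobolev3_L2_norm f sobolev3_grad_norm[OF f ex])
  then show ?thesis
    unfolding wsq_def by (intro infsumI[symmetric]) (simp add: voigt_weight_def algebra_simps)
qed

interpretation voigt: weights "voigt_weight \<alpha>" for \<alpha>
  by unfold_locales (simp add: voigt_weight_def)

lemma bessel_weight_one: "bessel_weight 1 k = 1 + (norm (wave_vec k))\<^sup>2"
  by (simp add: bessel_weight_def)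

lemma voigt_weight_le: "voigt_weight \<alpha> k \<le> (1 + \<alpha>\<^sup>2) * bessel_weight 1 k"
  by (simp add: voigt_weight_def bessel_weight_one algebra_simps)

lemma wsq_voigt_le:
  assumes "f \<in> sobolev 1"
  shows "wsq_summable (voigt_weight \<alpha>) (fourier_coeff f)"
    "wsq (voigt_weight \<alpha>) (fourier_coeff f) \<le> (1 + \<alpha>\<^sup>2) * (sobolev_norm 1 f)\<^sup>2"
proof -
  have s: "wsq_summable (\<lambda>k. (1 + \<alpha>\<^sup>2) * bessel_weight 1 k) (fourier_coeff f)"
    using assms unfolding sobolev_iff wsq_summable_def
    by (simp add: mult.assoc summable_on_cmult_right)
  note w = wsq_mono[OF voigt.h voigt_weight_le s]
  show "wsq_summable (voigt_weight \<alpha>) (fourier_coeff f)" by (rule w(1))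
  have "wsq (\<lambda>k. (1 + \<alpha>\<^sup>2) * bessel_weight 1 k) (fourier_coeff f) = (1 + \<alpha>\<^sup>2) * (sobolev_norm 1 f)\<^sup>2"
    using bessel.wsq_nonneg[of 1 "fourier_coeff f"] unfolding sobolev_norm_wsq
    by (simp add: wsq_def mult.assoc infsum_cmult_right')
  with w(2) show "wsq (voigt_weight \<alpha>) (fourier_coeff f) \<le> (1 + \<alpha>\<^sup>2) * (sobolev_norm 1 f)\<^sup>2" by simp
qed

section \<open>Weak derivatives of differences\<close>

text \<open>Continuity makes the integrals in the weak formulations finite, so that these are linear in the field.\<close>

lemma test_function_continuous:
  assumes "\<phi> \<in> test_functions"
  shows "continuous_on UNIV \<phi>" "continuous_on UNIV (partial j \<phi>)"
proof -
  have s: "smooth \<phi>" using assms by (simp add: test_functions_def)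
  then have "smooth (partial j \<phi>)" by (auto elim: smooth.cases)
  moreover have "continuous_on UNIV \<psi>" if "smooth \<psi>" for \<psi>
    using that by (auto elim!: smooth.cases intro!: differentiable_imp_continuous_on simp: differentiable_on_def)
  ultimately show "continuous_on UNIV \<phi>" "continuous_on UNIV (partial j \<phi>)" using s by auto
qed

lemma integrable_mult_continuous:
  fixes f \<phi> :: "real^3 \<Rightarrow> real"
  assumes "integrable torus f" "continuous_on UNIV \<phi>"
  shows "integrable torus (\<lambda>x. f x * \<phi> x)"
proof -
  have "bounded (\<phi> ` cbox 0 1)"
    by (intro compact_imp_bounded compact_continuous_image continuous_on_subset[OF assms(2)]) auto
  then obtain B where "\<And>x. x \<in> cbox 0 1 \<Longrightarrow> \<bar>\<phi> x\<bar> \<le> B" by (auto simp: bounded_iff)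
  then show ?thesis
    using AE_torus_in_cube assms by (intro integrable_mult_bounded[where c=B] measurable_torus_continuous) auto
qed

lemmas integrable_mult_test = integrable_mult_continuous[OF _ test_function_continuous(1)]
  integrable_mult_continuous[OF _ test_function_continuous(2)]

lemma has_weak_partial_diff:
  assumes "integrable torus f" "integrable torus f'" "integrable torus g" "integrable torus g'"
    and "has_weak_partial f j g" "has_weak_partial f' j g'"
  shows "has_weak_partial (\<lambda>x. f x - f' x) j (\<lambda>x. g x - g' x)"
  using assms by (simp add: has_weak_partial_def left_diff_distrib integrable_mult_test)

lemma has_weak_jacobian_diff:
  assumes f: "has_weak_jacobian f F" and g: "has_weak_jacobian g G"
  shows "has_weak_jacobian (\<lambda>x. f x - g x) (\<lambda>x. F x - G x)"
  using has_weak_jacobianD[OF f] has_weak_jacobianD[OF g]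
  by (auto simp: has_weak_jacobian_def L2_torus_diff integrable_component integrable_entry intro!: has_weak_partial_diff)

lemma has_weak_gradient_diff:
  assumes f: "has_weak_gradient p q" and g: "has_weak_gradient p' q'"
  shows "has_weak_gradient (\<lambda>x. p x - p' x) (\<lambda>x. q x - q' x)"
  using f g
  by (auto simp: has_weak_gradient_def L2_torus_diff integrable_component L2_torus_integrable intro!: has_weak_partial_diff)

lemma weakly_div_free_diff:
  assumes "weakly_div_free f" "weakly_div_free g" "f \<in> L2_torus" "g \<in> L2_torus"
  shows "weakly_div_free (\<lambda>x. f x - g x)"
  using assms by (simp add: weakly_div_free_def left_diff_distrib integrable_mult_test integrable_component sum_subtractf)

lemma has_weak_jacobian_cong_AE:
  assumes "has_weak_jacobian f G" "AE x in torus. f x = g x" "g \<in> L2_torus"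
  shows "has_weak_jacobian g G"
proof -
  have "(\<integral>x. f x $ i * partial j \<phi> x \<partial>torus) = (\<integral>x. g x $ i * partial j \<phi> x \<partial>torus)" if "\<phi> \<in> test_functions" for i j \<phi>
  proof (rule integral_cong_AE)
    show "AE x in torus. f x $ i * partial j \<phi> x = g x $ i * partial j \<phi> x" using assms(2) by auto
  qed (use integrable_mult_test(2)[OF integrable_component that] has_weak_jacobianD(1)[OF assms(1)] assms(3) in auto)
  then show ?thesis using assms(1,3) by (simp add: has_weak_jacobian_def has_weak_partial_def)
qed

section \<open>The energy estimate at a fixed time\<close>

lemma integral_inner_eq_0:
  assumes w: "w \<in> sobolev 3" and h: "\<And>i. integrable torus (\<lambda>x. h x $ i)"
    and z: "\<And>k. fourier_coeff h k \<bullet> fourier_coeff w k = 0"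
  shows "(\<Sum>i\<in>UNIV. \<integral>x. h x $ i * w x $ i \<partial>torus) = 0"
  by (rule has_sum_unique[OF sobolev3_inner_has_sum[OF w h]]) (simp add: z)

text \<open>Bounds \<open>- \<langle>(w \<cdot> \<nabla>)u, w\<rangle>\<close> for \<open>G = \<nabla>u\<close>: use \<open>|w\<^sub>i w\<^sub>j| \<le> (w\<^sub>i\<^sup>2 + w\<^sub>j\<^sup>2) / 2\<close> and sum over the nine
  entries.\<close>

lemma stretching_bound:
  fixes w :: field3
  assumes w: "w \<in> L2_torus" and G: "\<And>i j. (\<lambda>x. G x $ i $ j) \<in> borel_measurable torus"
    and M: "\<And>i j. AE x in torus. \<bar>G x $ i $ j\<bar> \<le> M"
  shows "- (\<Sum>i\<in>UNIV. \<Sum>j\<in>UNIV. \<integral>x. w x $ j * w x $ i * G x $ i $ j \<partial>torus) \<le> 3 * M * (L2_torus_norm w)\<^sup>2"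
proof -
  let ?s = "\<lambda>i. \<integral>x. w x $ i * w x $ i \<partial>torus"
  have iw: "integrable torus (\<lambda>x. w x $ j * w x $ i)" for i j
    by (intro L2_torus_mult_integrable L2_torus_component w)
  have entry: "- (\<integral>x. w x $ j * w x $ i * G x $ i $ j \<partial>torus) \<le> M / 2 * (?s i + ?s j)" for i j
  proof -
    have "- (\<integral>x. w x $ j * w x $ i * G x $ i $ j \<partial>torus) = (\<integral>x. - (w x $ j * w x $ i * G x $ i $ j) \<partial>torus)" by simp
    also have "\<dots> \<le> (\<integral>x. M / 2 * (w x $ i * w x $ i + w x $ j * w x $ j) \<partial>torus)"
    proof (rule integral_mono_AE)
      show "integrable torus (\<lambda>x. - (w x $ j * w x $ i * G x $ i $ j))"
        by (intro Bochner_Integration.integrable_minus integrable_mult_bounded[OF iw G M])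
      show "integrable torus (\<lambda>x. M / 2 * (w x $ i * w x $ i + w x $ j * w x $ j))" using iw by simp
      show "AE x in torus. - (w x $ j * w x $ i * G x $ i $ j) \<le> M / 2 * (w x $ i * w x $ i + w x $ j * w x $ j)"
        using M[of i j]
      proof eventually_elim
        case (elim x)
        have "- (w x $ j * w x $ i * G x $ i $ j) \<le> \<bar>w x $ j * w x $ i\<bar> * \<bar>G x $ i $ j\<bar>"
          by (metis abs_ge_minus_self abs_mult)
        also have "\<dots> \<le> ((w x $ i * w x $ i + w x $ j * w x $ j) / 2) * M"
        proof (rule mult_mono)
          show "\<bar>w x $ j * w x $ i\<bar> \<le> (w x $ i * w x $ i + w x $ j * w x $ j) / 2"
            using sum_squares_bound[of "\<bar>w x $ i\<bar>" "\<bar>w x $ j\<bar>"]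
            by (simp add: abs_mult power2_eq_square mult_ac)
        qed (use elim in auto)
        finally show ?case by (simp add: mult.commute)
      qed
    qed
    also have "\<dots> = M / 2 * (?s i + ?s j)" using iw by simp
    finally show ?thesis .
  qed
  have "- (\<Sum>i\<in>UNIV. \<Sum>j\<in>UNIV. \<integral>x. w x $ j * w x $ i * G x $ i $ j \<partial>torus)
      \<le> (\<Sum>i\<in>(UNIV::3 set). \<Sum>j\<in>(UNIV::3 set). M / 2 * (?s i + ?s j))"
    unfolding sum_negf[symmetric] by (intro sum_mono entry)
  also have "\<dots> = 3 * M * (\<Sum>i\<in>UNIV. ?s i)" by (simp add: sum_3 algebra_simps)
  finally show ?thesis unfolding L2_torus_norm_power2[OF w] .
qed

text \<open>The difference of the nonlinearities is \<open>(w \<cdot> \<nabla>)u + (a \<cdot> \<nabla>)w\<close> with \<open>w = u - a\<close>. The second part is antisymmetric, so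
  only the gradient of \<open>u\<close> enters the bound.\<close>

theorem nonlinear_estimate:
  assumes u: "u \<in> sobolev 3" "has_weak_jacobian u G"
    and a: "a \<in> sobolev 3" "has_weak_jacobian a A" "weakly_div_free a"
    and M: "\<And>i j. AE x in torus. \<bar>G x $ i $ j\<bar> \<le> M"
  shows "- (\<Sum>i\<in>UNIV. \<integral>x. (G x *v u x - A x *v a x) $ i * (u x - a x) $ i \<partial>torus)
      \<le> 3 * M * (L2_torus_norm (\<lambda>x. u x - a x))\<^sup>2"
    and "\<And>i. integrable torus (\<lambda>x. (G x *v u x - A x *v a x) $ i)"
proof -
  define w where "w x = u x - a x" for x
  define D where "D x = G x - A x" for x
  have w3: "w \<in> sobolev 3" unfolding w_def using u a by (intro sobolev_diff)
  have J: "has_weak_jacobian w D" unfolding w_def[abs_def] D_def[abs_def] using u a by (intro has_weak_jacobian_diff)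
  have a2: "a \<in> L2_torus" using a by (simp add: sobolev_L2)
  have w2: "w \<in> L2_torus" using w3 by (simp add: sobolev_L2)
  note wG = sobolev3_jacobian_wiener(1)[OF u] and wD = sobolev3_jacobian_wiener(1)[OF w3 J]
  have N: "(G x *v u x - A x *v a x) $ i = (\<Sum>j\<in>UNIV. a x $ j * D x $ i $ j) + (\<Sum>j\<in>UNIV. w x $ j * G x $ i $ j)" for x i
    by (simp add: matrix_vector_mult_def w_def D_def sum.distrib[symmetric] sum_subtractf[symmetric] algebra_simps)
  have i1: "integrable torus (\<lambda>x. a x $ j * D x $ i $ j)" for i j
    by (intro integrable_mult_wiener integrable_component a2 wD)
  have i2: "integrable torus (\<lambda>x. w x $ j * G x $ i $ j)" for i j
    by (intro integrable_mult_wiener integrable_component w2 wG)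
  show "integrable torus (\<lambda>x. (G x *v u x - A x *v a x) $ i)" for i
    unfolding N using i1 i2 by simp
  note j1 = integrable_mult_wiener[OF i1 sobolev3_wiener[OF w3]] and j2 = integrable_mult_wiener[OF i2 sobolev3_wiener[OF w3]]
  have "(\<integral>x. (G x *v u x - A x *v a x) $ i * w x $ i \<partial>torus) = (\<Sum>j\<in>UNIV. \<integral>x. w x $ j * w x $ i * G x $ i $ j \<partial>torus)" for i
  proof -
    have "(\<integral>x. (G x *v u x - A x *v a x) $ i * w x $ i \<partial>torus)
       = (\<integral>x. (\<Sum>j\<in>UNIV. a x $ j * D x $ i $ j * w x $ i) + (\<Sum>j\<in>UNIV. w x $ j * G x $ i $ j * w x $ i) \<partial>torus)"
      unfolding N by (simp add: distrib_right sum_distrib_right)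
    also have "\<dots> = (\<Sum>j\<in>UNIV. \<integral>x. a x $ j * D x $ i $ j * w x $ i \<partial>torus) + (\<Sum>j\<in>UNIV. \<integral>x. w x $ j * G x $ i $ j * w x $ i \<partial>torus)"
      using j1 j2 by simp
    also have "(\<Sum>j\<in>UNIV. \<integral>x. a x $ j * D x $ i $ j * w x $ i \<partial>torus) = 0"
      by (rule transport_antisymmetric[OF a(3) a2 has_weak_jacobianD(3)[OF J] wD sobolev3_wiener[OF w3]])
    finally show ?thesis by (simp add: mult.assoc mult.commute[of "G _ $ _ $ _"])
  qed
  then show "- (\<Sum>i\<in>UNIV. \<integral>x. (G x *v u x - A x *v a x) $ i * (u x - a x) $ i \<partial>torus)
      \<le> 3 * M * (L2_torus_norm (\<lambda>x. u x - a x))\<^sup>2"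
    using stretching_bound[OF w2 _ M] integrable_entry[OF has_weak_jacobianD(2)[OF u(2)]]
    unfolding w_def by simp
qed

text \<open>The bound on \<open>E'\<close> at one instant; \<open>v\<close> and \<open>v'\<close> are the time derivatives of \<open>u\<close> and \<open>a\<close>. At frequency \<open>k\<close>, the
  relation between \<open>m\<close> and \<open>v'\<close> turns the summand \<open>(1 + \<alpha>\<^sup>2|k|\<^sup>2) w \<cdot> (v - v')\<close> into \<open>h \<cdot> w + \<alpha>\<^sup>2|k|\<^sup>2 v \<cdot> w\<close> with
  \<open>h = v - v' + \<alpha>\<^sup>2 m\<close>, and the equations express \<open>h\<close> through the nonlinearities and the pressures.\<close>

theorem energy_rate_estimate:
  assumes u: "u \<in> sobolev 3" "weakly_div_free u" "has_weak_jacobian u G" "has_weak_gradient p q"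
    and v: "v \<in> sobolev 1"
    and eq: "AE x in torus. v x + G x *v u x + q x = 0"
    and a: "a \<in> sobolev 3" "weakly_div_free a" "has_weak_jacobian a A" "has_weak_gradient p' q'"
    and v': "v' \<in> sobolev 1" and m: "m \<in> L2_torus" "\<And>k. fourier_coeff m k = - (norm (wave_vec k))\<^sup>2 *\<^sub>R fourier_coeff v' k"
    and eq': "AE x in torus. - \<alpha>\<^sup>2 *\<^sub>R m x + v' x + A x *v a x + q' x = 0"
    and M: "\<And>i j. AE x in torus. \<bar>G x $ i $ j\<bar> \<le> M" "0 \<le> M"
  shows "2 * wip (voigt_weight \<alpha>) (fourier_coeff (\<lambda>x. u x - a x)) (fourier_coeff (\<lambda>x. v x - v' x))
     \<le> (6 * M + 1) * wsq (voigt_weight \<alpha>) (fourier_coeff (\<lambda>x. u x - a x)) + \<alpha>\<^sup>2 * (sobolev_norm 1 v)\<^sup>2"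
proof -
  define w where "w x = u x - a x" for x
  define d where "d x = v x - v' x" for x
  define N where "N x = G x *v u x - A x *v a x" for x
  define Q where "Q x = q x - q' x" for x
  define h where "h x = d x + \<alpha>\<^sup>2 *\<^sub>R m x" for x
  have w3: "w \<in> sobolev 3" unfolding w_def using u a by (intro sobolev_diff)
  have J: "has_weak_jacobian w (\<lambda>x. G x - A x)" unfolding w_def[abs_def] using u a by (intro has_weak_jacobian_diff)
  have w1: "w \<in> sobolev 1" using sobolev_mono(1)[OF _ w3, of 1] by simp
  have w2: "w \<in> L2_torus" by (rule sobolev_L2[OF w3])
  have d1: "d \<in> sobolev 1" unfolding d_def using v v' by (intro sobolev_diff)
  have h2: "h \<in> L2_torus" unfolding h_def[abs_def] by (intro L2_torus_add L2_torus_scaleR m sobolev_L2[OF d1])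
  have Q: "has_weak_gradient (\<lambda>x. p x - p' x) Q" unfolding Q_def[abs_def] by (intro has_weak_gradient_diff u a)
  then have Q2: "Q \<in> L2_torus" by (simp add: has_weak_gradient_def)
  have dw: "weakly_div_free w" unfolding w_def[abs_def] using u a by (intro weakly_div_free_diff sobolev_L2)
  note ih = integrable_component[OF h2] and iQ = integrable_component[OF Q2]
  note nl = nonlinear_estimate[OF u(1,3) a(1,3,2) M(1), folded w_def N_def]
  have hN: "AE x in torus. h x = - (N x + Q x)"
    using eq eq'
  proof eventually_elim
    case (elim x)
    have "h x + N x + Q x = (v x + G x *v u x + q x) - (- \<alpha>\<^sup>2 *\<^sub>R m x + v' x + A x *v a x + q' x)"
      by (simp add: h_def d_def N_def Q_def algebra_simps)
    then have "h x + N x + Q x = 0" unfolding elim by simp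
    then show ?case by (metis add.assoc eq_neg_iff_add_eq_0)
  qed
  have I: "(\<Sum>i\<in>UNIV. \<integral>x. h x $ i * w x $ i \<partial>torus) \<le> 3 * M * (L2_torus_norm w)\<^sup>2"
  proof -
    have "(\<integral>x. h x $ i * w x $ i \<partial>torus) = - (\<integral>x. N x $ i * w x $ i \<partial>torus) - (\<integral>x. Q x $ i * w x $ i \<partial>torus)" for i
    proof -
      note iw = integrable_mult_wiener[OF _ sobolev3_wiener[OF w3]]
      have "(\<integral>x. h x $ i * w x $ i \<partial>torus) = (\<integral>x. - (N x $ i * w x $ i) - Q x $ i * w x $ i \<partial>torus)"
      proof (rule integral_cong_AE)
        show "AE x in torus. h x $ i * w x $ i = - (N x $ i * w x $ i) - Q x $ i * w x $ i"
          using hN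
        proof eventually_elim
          case (elim x)
          show ?case unfolding elim by (simp add: algebra_simps)
        qed
      qed (use iw[OF ih] iw[OF nl(2)] iw[OF iQ] in auto)
      then show ?thesis using iw[OF nl(2)] iw[OF iQ] by simp
    qed
    moreover have "(\<Sum>i\<in>UNIV. \<integral>x. Q x $ i * w x $ i \<partial>torus) = 0"
      by (rule integral_inner_eq_0[OF w3 iQ gradient_orthogonal_solenoidal[OF Q dw w2]])
    ultimately show ?thesis using nl(1) by (simp add: sum_subtractf sum_negf)
  qed
  have sv: "wsq_summable (bessel_weight 1) (fourier_coeff v)" using v by (simp add: sobolev_iff)
  note sw = wsq_voigt_le(1)[OF w1, of \<alpha>] and sd = wsq_voigt_le(1)[OF d1, of \<alpha>]
  have "2 * wip (voigt_weight \<alpha>) (fourier_coeff w) (fourier_coeff d) \<le>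
     2 * (\<Sum>i\<in>UNIV. \<integral>x. h x $ i * w x $ i \<partial>torus) + \<alpha>\<^sup>2 * wsq (bessel_weight 1) (fourier_coeff v) + wsq (voigt_weight \<alpha>) (fourier_coeff w)"
  proof (rule has_sum_mono)
    show "((\<lambda>k. 2 * (voigt_weight \<alpha> k * (fourier_coeff w k \<bullet> fourier_coeff d k))) has_sum
       2 * wip (voigt_weight \<alpha>) (fourier_coeff w) (fourier_coeff d)) UNIV"
      by (intro has_sum_cmult_right voigt.wip_has_sum sw sd)
    show "((\<lambda>k. 2 * (fourier_coeff h k \<bullet> fourier_coeff w k) + \<alpha>\<^sup>2 * (bessel_weight 1 k * (norm (fourier_coeff v k))\<^sup>2)
        + voigt_weight \<alpha> k * (norm (fourier_coeff w k))\<^sup>2) has_sum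
      2 * (\<Sum>i\<in>UNIV. \<integral>x. h x $ i * w x $ i \<partial>torus) + \<alpha>\<^sup>2 * wsq (bessel_weight 1) (fourier_coeff v) + wsq (voigt_weight \<alpha>) (fourier_coeff w)) UNIV"
      by (intro has_sum_add has_sum_cmult_right sobolev3_inner_has_sum w3 ih bessel.wsq_has_sum voigt.wsq_has_sum sv sw)
    fix k
    let ?n = "(norm (wave_vec k))\<^sup>2" and ?v = "fourier_coeff v k" and ?w = "fourier_coeff w k"
    have fd: "fourier_coeff d k = ?v - fourier_coeff v' k"
      unfolding d_def using v v' by (intro fourier_coeff_diff sobolev_L2)
    have fh: "fourier_coeff h k = fourier_coeff d k - (\<alpha>\<^sup>2 * ?n) *\<^sub>R fourier_coeff v' k"
      using fourier_coeff_lincomb[of d m 1 "\<alpha>\<^sup>2" k] integrable_component[OF m(1)] integrable_component[OF sobolev_L2[OF d1]]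
      by (simp add: h_def[abs_def] m(2))
    have "2 * (voigt_weight \<alpha> k * (?w \<bullet> fourier_coeff d k)) = 2 * (fourier_coeff h k \<bullet> ?w) + \<alpha>\<^sup>2 * ?n * (2 * (?v \<bullet> ?w))"
      unfolding fh fd voigt_weight_def by (simp add: inner_simps inner_commute[of ?w] algebra_simps)
    also have "2 * (?v \<bullet> ?w) \<le> (norm ?v)\<^sup>2 + (norm ?w)\<^sup>2"
      using zero_le_power2[of "norm (?v - ?w)"] by (simp add: power2_norm_eq_inner inner_simps inner_commute)
    also have "2 * (fourier_coeff h k \<bullet> ?w) + \<alpha>\<^sup>2 * ?n * ((norm ?v)\<^sup>2 + (norm ?w)\<^sup>2)
       = 2 * (fourier_coeff h k \<bullet> ?w) + \<alpha>\<^sup>2 * (?n * (norm ?v)\<^sup>2) + \<alpha>\<^sup>2 * ?n * (norm ?w)\<^sup>2" by (simp add: algebra_simps)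
    also have "\<dots> \<le> 2 * (fourier_coeff h k \<bullet> ?w) + \<alpha>\<^sup>2 * (bessel_weight 1 k * (norm ?v)\<^sup>2) + voigt_weight \<alpha> k * (norm ?w)\<^sup>2"
      by (intro add_mono mult_left_mono mult_right_mono order_refl) (auto simp: bessel_weight_one voigt_weight_def)
    finally show "2 * (voigt_weight \<alpha> k * (?w \<bullet> fourier_coeff d k)) \<le> 2 * (fourier_coeff h k \<bullet> ?w)
       + \<alpha>\<^sup>2 * (bessel_weight 1 k * (norm ?v)\<^sup>2) + voigt_weight \<alpha> k * (norm ?w)\<^sup>2"
      by (simp add: mult_left_mono)
  qed
  moreover have "(L2_torus_norm w)\<^sup>2 \<le> wsq (voigt_weight \<alpha>) (fourier_coeff w)"
    unfolding voigt_energy_wsq[OF w3 J, of \<alpha>, symmetric] by (simp add: voigt_energy_def)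
  then have "3 * M * (L2_torus_norm w)\<^sup>2 \<le> 3 * M * wsq (voigt_weight \<alpha>) (fourier_coeff w)"
    using M(2) by (intro mult_left_mono) auto
  moreover have "wsq (bessel_weight 1) (fourier_coeff v) = (sobolev_norm 1 v)\<^sup>2"
    using bessel.wsq_nonneg[of 1 "fourier_coeff v"] by (simp add: sobolev_norm_wsq)
  ultimately have "2 * wip (voigt_weight \<alpha>) (fourier_coeff w) (fourier_coeff d)
     \<le> (6 * M + 1) * wsq (voigt_weight \<alpha>) (fourier_coeff w) + \<alpha>\<^sup>2 * (sobolev_norm 1 v)\<^sup>2"
    using I by (simp add: algebra_simps)
  then show ?thesis by (simp add: w_def[abs_def] d_def[abs_def])
qed

section \<open>Curves in Sobolev spaces\<close>

lemma sobolev_diff_coeff: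
  assumes "f \<in> sobolev r" "g \<in> sobolev r"
  shows "fourier_coeff (\<lambda>x. f x - g x) = (\<lambda>k. fourier_coeff f k - fourier_coeff g k)"
  using assms by (simp add: fun_eq_iff fourier_coeff_diff sobolev_L2)

lemma sobolev_quotient:
  assumes "f \<in> sobolev r" "g \<in> sobolev r" "d \<in> sobolev r"
  shows "(\<lambda>x. (f x - g x) /\<^sub>R c - d x) \<in> sobolev r"
    "fourier_coeff (\<lambda>x. (f x - g x) /\<^sub>R c - d x) = (\<lambda>k. (fourier_coeff f k - fourier_coeff g k) /\<^sub>R c - fourier_coeff d k)"
proof -
  note fg = sobolev_diff[OF assms(1,2)]
  note sc = sobolev_scaleR[OF fg, of "inverse c"]
  show "(\<lambda>x. (f x - g x) /\<^sub>R c - d x) \<in> sobolev r" by (intro sobolev_diff sc assms)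
  show "fourier_coeff (\<lambda>x. (f x - g x) /\<^sub>R c - d x) = (\<lambda>k. (fourier_coeff f k - fourier_coeff g k) /\<^sub>R c - fourier_coeff d k)"
    unfolding sobolev_diff_coeff[OF sc assms(3)]
    using assms by (simp add: fun_eq_iff fourier_coeff_scaleR[OF sobolev_L2[OF fg]] fourier_coeff_diff sobolev_L2)
qed

lemma sobolev_norm_diff_le:
  assumes "f \<in> sobolev r" "g \<in> sobolev r"
  shows "sobolev_norm r (\<lambda>x. f x - g x) \<le> sobolev_norm r f + sobolev_norm r g"
proof -
  have g: "wsq_summable (bessel_weight r) (\<lambda>k. - fourier_coeff g k)"
    using assms(2) by (simp add: sobolev_iff wsq_summable_def)
  show ?thesis
    using bessel.wsq_triangle[OF _ g, of "fourier_coeff f"] assms(1)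
    by (simp add: sobolev_norm_wsq sobolev_diff_coeff[OF assms] sobolev_iff wsq_def)
qed

lemma sobolev_norm_nonneg: "0 \<le> sobolev_norm r f"
  by (simp add: sobolev_norm_wsq bessel.wsq_nonneg)

lemma C0_sobolevD:
  assumes "C0_sobolev T r u" "t \<in> {0..T}"
  shows "u t \<in> sobolev r"
  using assms by (simp add: C0_sobolev_def)

text \<open>The norm is continuous along the curve and the time interval is compact.\<close>

lemma C0_sobolev_bounded:
  assumes u: "C0_sobolev T r u"
  shows "\<exists>B\<ge>0. \<forall>t\<in>{0..T}. sobolev_norm r (u t) \<le> B"
proof -
  have "continuous_on {0..T} (\<lambda>t. sqrt (wsq (bessel_weight r) (fourier_coeff (u t))))"
  proof (rule bessel.wsq_sqrt_continuous)
    show "wsq_summable (bessel_weight r) (fourier_coeff (u t))" if "t \<in> {0..T}" for t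
      using C0_sobolevD[OF u that] by (simp add: sobolev_iff)
    fix t assume t: "t \<in> {0..T}"
    have "((\<lambda>\<tau>. sobolev_norm r (\<lambda>x. u \<tau> x - u t x)) \<longlongrightarrow> 0) (at t within {0..T})"
      using u t by (simp add: C0_sobolev_def)
    moreover have "\<forall>\<^sub>F \<tau> in at t within {0..T}. sobolev_norm r (\<lambda>x. u \<tau> x - u t x)
        = sqrt (wsq (bessel_weight r) (\<lambda>k. fourier_coeff (u \<tau>) k - fourier_coeff (u t) k))"
      unfolding eventually_at_filter
      by (intro always_eventually allI impI)
         (simp only: sobolev_norm_wsq sobolev_diff_coeff[OF C0_sobolevD[OF u] C0_sobolevD[OF u t]])
    ultimately show "((\<lambda>\<tau>. sqrt (wsq (bessel_weight r) (\<lambda>k. fourier_coeff (u \<tau>) k - fourier_coeff (u t) k))) \<longlongrightarrow> 0) (at t within {0..T})"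
      by (rule Lim_transform_eventually)
  qed
  then have "bounded ((\<lambda>t. sobolev_norm r (u t)) ` {0..T})"
    unfolding sobolev_norm_wsq by (intro compact_imp_bounded compact_continuous_image) auto
  then obtain B where B: "\<forall>t\<in>{0..T}. \<bar>sobolev_norm r (u t)\<bar> \<le> B" by (auto simp: bounded_iff)
  then show ?thesis by (intro exI[of _ "\<bar>B\<bar>"]) fastforce
qed

lemma C1_sobolevD:
  assumes "C1_sobolev T r u v" "t \<in> {0..T}"
  shows "u t \<in> sobolev r" "v t \<in> sobolev r"
    "((\<lambda>\<tau>. sobolev_norm r (\<lambda>x. (u \<tau> x - u t x) /\<^sub>R (\<tau> - t) - v t x)) \<longlongrightarrow> 0) (at t within {0..T})"
  using assms by (auto simp: C1_sobolev_def C0_sobolev_def)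

text \<open>A single coefficient is bounded by any Sobolev norm of nonnegative order.\<close>

lemma C1_sobolev_coeff_derivative:
  assumes u: "C1_sobolev T r u v" and r: "0 \<le> r" and t: "t \<in> {0..T}"
  shows "((\<lambda>\<tau>. (fourier_coeff (u \<tau>) k - fourier_coeff (u t) k) /\<^sub>R (\<tau> - t)) \<longlongrightarrow> fourier_coeff (v t) k) (at t within {0..T})"
proof (rule LIM_zero_cancel, rule Lim_null_comparison[OF _ C1_sobolevD(3)[OF u t]])
  show "\<forall>\<^sub>F \<tau> in at t within {0..T}. norm ((fourier_coeff (u \<tau>) k - fourier_coeff (u t) k) /\<^sub>R (\<tau> - t) - fourier_coeff (v t) k)
     \<le> sobolev_norm r (\<lambda>x. (u \<tau> x - u t x) /\<^sub>R (\<tau> - t) - v t x)"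
    unfolding eventually_at_filter
  proof (intro always_eventually allI impI)
    fix \<tau> assume \<tau>: "\<tau> \<in> {0..T}"
    note q = sobolev_quotient[OF C1_sobolevD(1)[OF u \<tau>] C1_sobolevD(1,2)[OF u t], of "\<tau> - t"]
    show "norm ((fourier_coeff (u \<tau>) k - fourier_coeff (u t) k) /\<^sub>R (\<tau> - t) - fourier_coeff (v t) k)
     \<le> sobolev_norm r (\<lambda>x. (u \<tau> x - u t x) /\<^sub>R (\<tau> - t) - v t x)"
      using fourier_coeff_le_sobolev_norm[OF q(1) r, of k] unfolding q(2) .
  qed
qed

lemma voigt_energy_derivative:
  assumes u: "C1_sobolev T r u v" and a: "C1_sobolev T r a b" and r: "1 \<le> r" and t: "t \<in> {0..T}"
  shows "((\<lambda>\<tau>. wsq (voigt_weight \<alpha>) (fourier_coeff (\<lambda>x. u \<tau> x - a \<tau> x))) has_real_derivative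
      2 * wip (voigt_weight \<alpha>) (fourier_coeff (\<lambda>x. u t x - a t x)) (fourier_coeff (\<lambda>x. v t x - b t x))) (at t within {0..T})"
proof -
  define w where "w \<tau> x = u \<tau> x - a \<tau> x" for \<tau> x
  define d where "d x = v t x - b t x" for x
  note uD = C1_sobolevD[OF u] and aD = C1_sobolevD[OF a]
  have w: "w \<tau> \<in> sobolev r" if "\<tau> \<in> {0..T}" for \<tau>
    unfolding w_def using uD aD that by (intro sobolev_diff)
  have d: "d \<in> sobolev r" unfolding d_def using uD aD t by (intro sobolev_diff)
  let ?q = "\<lambda>\<tau> x. (w \<tau> x - w t x) /\<^sub>R (\<tau> - t) - d x"
  let ?n = "\<lambda>u v \<tau>. sobolev_norm r (\<lambda>x. (u \<tau> x - u t x) /\<^sub>R (\<tau> - t) - v t x)"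
  let ?r = "\<lambda>\<tau> k. (fourier_coeff (w \<tau>) k - fourier_coeff (w t) k) /\<^sub>R (\<tau> - t) - fourier_coeff d k"
    and ?e = "\<lambda>\<tau>. (1 + \<alpha>\<^sup>2) * (?n u v \<tau> + ?n a b \<tau>)\<^sup>2"
  have "((\<lambda>\<tau>. wsq (voigt_weight \<alpha>) (fourier_coeff (w \<tau>))) has_real_derivative
      2 * wip (voigt_weight \<alpha>) (fourier_coeff (w t)) (fourier_coeff d)) (at t within {0..T})"
  proof (rule voigt.wsq_has_derivative)
    show "wsq_summable (voigt_weight \<alpha>) (fourier_coeff (w \<tau>))" if "\<tau> \<in> {0..T}" for \<tau>
      by (rule wsq_voigt_le(1)[OF sobolev_mono(1)[OF r w[OF that]]])
    show "wsq_summable (voigt_weight \<alpha>) (fourier_coeff d)"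
      by (rule wsq_voigt_le(1)[OF sobolev_mono(1)[OF r d]])
    show "((\<lambda>\<tau>. wsq (voigt_weight \<alpha>) (?r \<tau>)) \<longlongrightarrow> 0) (at t within {0..T})"
    proof (rule Lim_null_comparison)
      show "(?e \<longlongrightarrow> 0) (at t within {0..T})"
        using uD(3)[OF t] aD(3)[OF t] by (auto intro!: tendsto_eq_intros)
      show "\<forall>\<^sub>F \<tau> in at t within {0..T}. norm (wsq (voigt_weight \<alpha>) (?r \<tau>))
         \<le> ?e \<tau>"
        unfolding eventually_at_filter
      proof (intro always_eventually allI impI)
        fix \<tau> assume \<tau>: "\<tau> \<in> {0..T}"
        note q = sobolev_quotient[OF w[OF \<tau>] w[OF t] d, of "\<tau> - t"]
        have "?q \<tau> = (\<lambda>x. ((u \<tau> x - u t x) /\<^sub>R (\<tau> - t) - v t x) - ((a \<tau> x - a t x) /\<^sub>R (\<tau> - t) - b t x))"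
          by (simp add: fun_eq_iff w_def d_def scaleR_diff_right)
        then have "sobolev_norm r (?q \<tau>) \<le> ?n u v \<tau> + ?n a b \<tau>"
          using sobolev_norm_diff_le[OF sobolev_quotient(1)[OF uD(1)[OF \<tau>] uD(1,2)[OF t]] sobolev_quotient(1)[OF aD(1)[OF \<tau>] aD(1,2)[OF t]]]
          by simp
        then have "sobolev_norm 1 (?q \<tau>) \<le> ?n u v \<tau> + ?n a b \<tau>"
          using sobolev_mono(2)[OF r q(1)] by simp
        then have "(1 + \<alpha>\<^sup>2) * (sobolev_norm 1 (?q \<tau>))\<^sup>2 \<le> ?e \<tau>"
          by (intro mult_left_mono power_mono sobolev_norm_nonneg) auto
        with wsq_voigt_le(2)[OF sobolev_mono(1)[OF r q(1)], of \<alpha>]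
        show "norm (wsq (voigt_weight \<alpha>) (?r \<tau>))
         \<le> ?e \<tau>"
          unfolding q(2) real_norm_def abs_of_nonneg[OF voigt.wsq_nonneg] by (rule order_trans)
      qed
    qed
  qed (rule t)
  then show ?thesis by (simp add: w_def[abs_def] d_def[abs_def])
qed

lemma at_within_Icc_neq_bot:
  fixes t T :: real
  assumes "0 < T" "t \<in> {0..T}"
  shows "at t within {0..T} \<noteq> bot"
  using islimpt_Icc[OF assms(1), of t] assms(2) trivial_limit_within[of t "{0..T}"] by simp

text \<open>Time derivative and Laplacian commute because they do so on each coefficient, where limits are unique.\<close>

lemma laplacian_time_derivative:
  assumes T: "0 < T" and u: "C1_sobolev T r u v" and r: "0 \<le> r" and L: "C1_sobolev T r' L m" and r': "0 \<le> r'"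
    and lap: "\<And>t. t \<in> {0..T} \<Longrightarrow> has_weak_laplacian (u t) (L t)" and t: "t \<in> {0..T}"
  shows "fourier_coeff (m t) k = - (norm (wave_vec k))\<^sup>2 *\<^sub>R fourier_coeff (v t) k"
proof (rule tendsto_unique[OF at_within_Icc_neq_bot[OF T t]])
  show "((\<lambda>\<tau>. (fourier_coeff (L \<tau>) k - fourier_coeff (L t) k) /\<^sub>R (\<tau> - t)) \<longlongrightarrow> fourier_coeff (m t) k) (at t within {0..T})"
    by (rule C1_sobolev_coeff_derivative[OF L r' t])
  have "((\<lambda>\<tau>. - (norm (wave_vec k))\<^sup>2 *\<^sub>R ((fourier_coeff (u \<tau>) k - fourier_coeff (u t) k) /\<^sub>R (\<tau> - t)))
      \<longlongrightarrow> - (norm (wave_vec k))\<^sup>2 *\<^sub>R fourier_coeff (v t) k) (at t within {0..T})"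
    by (intro tendsto_scaleR tendsto_const C1_sobolev_coeff_derivative[OF u r t])
  moreover have "\<forall>\<^sub>F \<tau> in at t within {0..T}.
      - (norm (wave_vec k))\<^sup>2 *\<^sub>R ((fourier_coeff (u \<tau>) k - fourier_coeff (u t) k) /\<^sub>R (\<tau> - t))
      = (fourier_coeff (L \<tau>) k - fourier_coeff (L t) k) /\<^sub>R (\<tau> - t)"
    unfolding eventually_at_filter
    by (intro always_eventually allI impI)
       (simp add: weak_laplacian_coeff[OF lap] weak_laplacian_coeff[OF lap[OF t]] algebra_simps)
  ultimately show "((\<lambda>\<tau>. (fourier_coeff (L \<tau>) k - fourier_coeff (L t) k) /\<^sub>R (\<tau> - t))
      \<longlongrightarrow> - (norm (wave_vec k))\<^sup>2 *\<^sub>R fourier_coeff (v t) k) (at t within {0..T})"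
    by (rule Lim_transform_eventually)
qed

text \<open>The function \<open>exp (- C t) (y t + D / C)\<close> is nonincreasing.\<close>

lemma gronwall:
  fixes y y' :: "real \<Rightarrow> real"
  assumes y: "\<And>t. t \<in> {0..T} \<Longrightarrow> (y has_real_derivative y' t) (at t within {0..T})"
    and le: "\<And>t. t \<in> {0..T} \<Longrightarrow> y' t \<le> C * y t + D" and C: "C \<noteq> 0" and t: "t \<in> {0..T}"
  shows "y t \<le> y 0 * exp (C * t) + D / C * (exp (C * t) - 1)"
proof -
  define z where "z s = exp (- C * s) * (y s + D / C)" for s
  have z: "(z has_real_derivative exp (- C * s) * (y' s - (C * y s + D))) (at s within {0..T})" if "s \<in> {0..T}" for s
    unfolding z_def using C by (auto intro!: derivative_eq_intros y that simp: field_simps)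
  have "z t \<le> z 0"
  proof (rule DERIV_nonpos_imp_decreasing_open[of 0 t z])
    show "0 \<le> t" using t by simp
    show "\<exists>y. (z has_real_derivative y) (at s) \<and> y \<le> 0" if "0 < s" "s < t" for s
    proof (intro exI conjI)
      show "(z has_real_derivative exp (- C * s) * (y' s - (C * y s + D))) (at s)"
        using z[of s] that t at_within_Icc_at[of 0 s T] by auto
      show "exp (- C * s) * (y' s - (C * y s + D)) \<le> 0"
        using le[of s] that t by (intro mult_nonneg_nonpos) auto
    qed
    have "continuous_on {0..T} z"
      unfolding continuous_on_eq_continuous_within
      using DERIV_continuous[OF z] by blast
    then show "continuous_on {0..t} z" by (rule continuous_on_subset) (use t in auto)
  qed
  then have "exp (C * t) * z t \<le> exp (C * t) * z 0" by (intro mult_left_mono) auto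
  moreover have "exp (C * t) * z t = y t + D / C"
    unfolding z_def mult.assoc[symmetric] exp_add[symmetric] by simp
  moreover have "exp (C * t) * z 0 = y 0 * exp (C * t) + D / C * exp (C * t)"
    by (simp add: z_def algebra_simps)
  ultimately have "y t + D / C \<le> y 0 * exp (C * t) + D / C * exp (C * t)" by simp
  then show ?thesis by (simp add: right_diff_distrib)
qed

section \<open>The energy inequality\<close>

lemma voigt_energy_cong_AE:
  assumes f: "f \<in> sobolev 3" "has_weak_jacobian f G" and g: "g \<in> sobolev 3" and eq: "AE x in torus. f x = g x"
  shows "voigt_energy \<alpha> g = voigt_energy \<alpha> f"
proof -
  have "has_weak_jacobian g G" by (rule has_weak_jacobian_cong_AE[OF f(2) eq sobolev_L2[OF g]])
  then have "voigt_energy \<alpha> g = wsq (voigt_weight \<alpha>) (fourier_coeff g)" by (rule voigt_energy_wsq[OF g])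
  also have "fourier_coeff g = fourier_coeff f"
    using fourier_coeff_cong_AE[OF eq sobolev_L2[OF f(1)] sobolev_L2[OF g]] by (simp add: fun_eq_iff)
  finally show ?thesis using voigt_energy_wsq[OF f] by simp
qed

text \<open>The constants are suprema over \<open>[0,T]\<close> of norms of \<open>u\<close> and of its time derivative, fixed before \<open>\<alpha>\<close> and the Voigt
  solution are introduced.\<close>

theorem energy_inequality:
  assumes s: "3 \<le> s" and T: "0 < T" and uin: "uin \<in> sobolev s" and sol: "euler_solution s T uin u"
  shows "\<exists>C>0. \<forall>\<alpha> uain ua. uain \<in> sobolev s \<longrightarrow> euler_voigt_solution \<alpha> s T uain ua \<longrightarrow>
     (\<forall>t\<in>{0..T}. voigt_energy \<alpha> (\<lambda>x. u t x - ua t x)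
        \<le> voigt_energy \<alpha> (\<lambda>x. uin x - uain x) * exp (C * t) + C * \<alpha>\<^sup>2 * (exp (C * t) - 1))"
proof -
  obtain v where u0: "C0_sobolev T s u" and u1: "C1_sobolev T (s - 1) u v"
    and ueq: "\<And>t. t \<in> {0..T} \<Longrightarrow> weakly_div_free (u t) \<and>
         (\<exists>G p q. has_weak_jacobian (u t) G \<and> has_weak_gradient p q \<and> (AE x in torus. v t x + G x *v u t x + q x = 0))"
    and uini: "AE x in torus. u 0 x = uin x"
    using sol unfolding euler_solution_def by blast
  obtain B where B: "B \<ge> 0" "\<And>t. t \<in> {0..T} \<Longrightarrow> sobolev_norm s (u t) \<le> B"
    using C0_sobolev_bounded[OF u0] by blast
  have "C0_sobolev T (s - 1) v" using u1 by (simp add: C1_sobolev_def)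
  from C0_sobolev_bounded[OF this] obtain K where K: "K \<ge> 0" "\<And>t. t \<in> {0..T} \<Longrightarrow> sobolev_norm (s - 1) (v t) \<le> K"
    by blast
  define M where "M = 2 * (sobolev_const * B)"
  have M0: "0 \<le> M" using B(1) sobolev_const_nonneg by (simp add: M_def)
  \<comment> \<open>the summands \<open>1\<close> and \<open>K\<^sup>2\<close> give \<open>K\<^sup>2 \<le> C\<^sup>2\<close>, so that \<open>K\<^sup>2 / C\<close> from Gronwall is at most \<open>C\<close>\<close>
  define C where "C = 6 * M + 1 + K\<^sup>2"
  have C1: "1 \<le> C" using M0 by (simp add: C_def)
  have r1: "1 \<le> s - 1" using s by simp
  show ?thesis
  proof (intro exI[of _ C] conjI allI impI ballI)
    show "C > 0" using C1 by simp
    fix \<alpha> uain ua t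
    assume uain: "uain \<in> sobolev s" and asol: "euler_voigt_solution \<alpha> s T uain ua" and t: "t \<in> {0..T}"
    obtain va L m where a0: "C0_sobolev T s ua" and a1: "C1_sobolev T (s - 1) ua va"
      and lap: "\<And>t. t \<in> {0..T} \<Longrightarrow> has_weak_laplacian (ua t) (L t)" and L: "C1_sobolev T (s - 3) L m"
      and aeq: "\<And>t. t \<in> {0..T} \<Longrightarrow> weakly_div_free (ua t) \<and>
         (\<exists>G p q. has_weak_jacobian (ua t) G \<and> has_weak_gradient p q \<and>
            (AE x in torus. - \<alpha>\<^sup>2 *\<^sub>R m t x + va t x + G x *v ua t x + q x = 0))"
      and aini: "AE x in torus. ua 0 x = uain x"
      using asol unfolding euler_voigt_solution_def by blast
    define E where "E t = wsq (voigt_weight \<alpha>) (fourier_coeff (\<lambda>x. u t x - ua t x))" for t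
    have S3: "u \<tau> \<in> sobolev 3" "ua \<tau> \<in> sobolev 3" if "\<tau> \<in> {0..T}" for \<tau>
      using sobolev_mono(1)[OF s] C0_sobolevD[OF u0 that] C0_sobolevD[OF a0 that] by auto
    have J: "\<exists>G. has_weak_jacobian (\<lambda>x. u \<tau> x - ua \<tau> x) G" if "\<tau> \<in> {0..T}" for \<tau>
      using ueq[OF that] aeq[OF that] has_weak_jacobian_diff by blast
    have E: "voigt_energy \<alpha> (\<lambda>x. u \<tau> x - ua \<tau> x) = E \<tau>" if "\<tau> \<in> {0..T}" for \<tau>
      using J[OF that] voigt_energy_wsq[OF sobolev_diff[OF S3[OF that]]] by (auto simp: E_def)
    have rate: "2 * wip (voigt_weight \<alpha>) (fourier_coeff (\<lambda>x. u \<tau> x - ua \<tau> x)) (fourier_coeff (\<lambda>x. v \<tau> x - va \<tau> x))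
        \<le> C * E \<tau> + \<alpha>\<^sup>2 * K\<^sup>2" if \<tau>: "\<tau> \<in> {0..T}" for \<tau>
    proof -
      obtain G p q where G: "has_weak_jacobian (u \<tau>) G" "has_weak_gradient p q" "AE x in torus. v \<tau> x + G x *v u \<tau> x + q x = 0"
        using ueq[OF \<tau>] by blast
      obtain A p' q' where A: "has_weak_jacobian (ua \<tau>) A" "has_weak_gradient p' q'"
          "AE x in torus. - \<alpha>\<^sup>2 *\<^sub>R m \<tau> x + va \<tau> x + A x *v ua \<tau> x + q' x = 0"
        using aeq[OF \<tau>] by blast
      have "sobolev_norm 3 (u \<tau>) \<le> B"
        using sobolev_mono(2)[OF s C0_sobolevD[OF u0 \<tau>]] B(2)[OF \<tau>] by simp
      then have "2 * (sobolev_const * sobolev_norm 3 (u \<tau>)) \<le> M"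
        unfolding M_def by (intro mult_left_mono sobolev_const_nonneg) auto
      then have M: "AE x in torus. \<bar>G x $ i $ j\<bar> \<le> M" for i j
        using sobolev3_jacobian_wiener(2)[OF S3(1)[OF \<tau>] G(1), of i j] by auto
      have v1: "v \<tau> \<in> sobolev 1" "va \<tau> \<in> sobolev 1"
        using sobolev_mono(1)[OF r1] C1_sobolevD(2)[OF u1 \<tau>] C1_sobolevD(2)[OF a1 \<tau>] by auto
      have m2: "m \<tau> \<in> L2_torus" using C1_sobolevD(2)[OF L \<tau>] by (rule sobolev_L2)
      have mk: "fourier_coeff (m \<tau>) k = - (norm (wave_vec k))\<^sup>2 *\<^sub>R fourier_coeff (va \<tau>) k" for k
        by (rule laplacian_time_derivative[OF T a1 _ L _ lap \<tau>]) (use s in auto)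
      have "sobolev_norm 1 (v \<tau>) \<le> K"
        using sobolev_mono(2)[OF r1 C1_sobolevD(2)[OF u1 \<tau>]] K(2)[OF \<tau>] by simp
      then have "\<alpha>\<^sup>2 * (sobolev_norm 1 (v \<tau>))\<^sup>2 \<le> \<alpha>\<^sup>2 * K\<^sup>2"
        by (intro mult_left_mono power_mono sobolev_norm_nonneg) auto
      moreover have "(6 * M + 1) * E \<tau> \<le> C * E \<tau>"
        unfolding E_def by (intro mult_right_mono voigt.wsq_nonneg) (simp add: C_def)
      moreover have "2 * wip (voigt_weight \<alpha>) (fourier_coeff (\<lambda>x. u \<tau> x - ua \<tau> x)) (fourier_coeff (\<lambda>x. v \<tau> x - va \<tau> x))
          \<le> (6 * M + 1) * E \<tau> + \<alpha>\<^sup>2 * (sobolev_norm 1 (v \<tau>))\<^sup>2"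
        unfolding E_def
        by (rule energy_rate_estimate[OF S3(1)[OF \<tau>] _ G(1,2) v1(1) G(3) S3(2)[OF \<tau>] _ A(1,2) v1(2) m2 mk A(3) M M0])
           (use ueq[OF \<tau>] aeq[OF \<tau>] in auto)
      ultimately show ?thesis by linarith
    qed
    have "E t \<le> E 0 * exp (C * t) + \<alpha>\<^sup>2 * K\<^sup>2 / C * (exp (C * t) - 1)"
      by (rule gronwall[OF _ rate _ t])
         (use C1 voigt_energy_derivative[OF u1 a1 r1] in \<open>auto simp: E_def[abs_def]\<close>)
    also have "\<alpha>\<^sup>2 * K\<^sup>2 / C * (exp (C * t) - 1) \<le> C * \<alpha>\<^sup>2 * (exp (C * t) - 1)"
    proof (rule mult_right_mono)
      have "C * 1 \<le> C * C" using C1 by (intro mult_left_mono) auto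
      then have "K\<^sup>2 \<le> C * C" using M0 by (simp add: C_def)
      then have "K\<^sup>2 / C \<le> C" using C1 by (simp add: divide_le_eq)
      then have "\<alpha>\<^sup>2 * (K\<^sup>2 / C) \<le> \<alpha>\<^sup>2 * C" by (intro mult_left_mono) auto
      then show "\<alpha>\<^sup>2 * K\<^sup>2 / C \<le> C * \<alpha>\<^sup>2" by (simp add: mult.commute)
      have "0 \<le> C * t" using C1 t by simp
      then show "0 \<le> exp (C * t) - 1" by simp
    qed
    also have "E 0 = voigt_energy \<alpha> (\<lambda>x. uin x - uain x)"
    proof -
      have 0: "0 \<in> {0..T}" using T by simp
      obtain G where G: "has_weak_jacobian (\<lambda>x. u 0 x - ua 0 x) G" using J[OF 0] by blast
      have "voigt_energy \<alpha> (\<lambda>x. uin x - uain x) = voigt_energy \<alpha> (\<lambda>x. u 0 x - ua 0 x)"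
      proof (rule voigt_energy_cong_AE[OF sobolev_diff[OF S3[OF 0]] G])
        show "(\<lambda>x. uin x - uain x) \<in> sobolev 3" using sobolev_mono(1)[OF s sobolev_diff[OF uin uain]] .
        show "AE x in torus. u 0 x - ua 0 x = uin x - uain x" using uini aini by eventually_elim simp
      qed
      then show ?thesis using E[OF 0] by simp
    qed
    finally show "voigt_energy \<alpha> (\<lambda>x. u t x - ua t x)
        \<le> voigt_energy \<alpha> (\<lambda>x. uin x - uain x) * exp (C * t) + C * \<alpha>\<^sup>2 * (exp (C * t) - 1)"
      unfolding E[OF t] by simp
  qed
qed

section \<open>Conservation of the mean\<close>

text \<open>Both the transport term and the pressure gradient have integral zero. Taking a general field \<open>z\<close> covers the
  Euler equations with \<open>z = \<partial>\<^sub>tu\<close> and the Euler-Voigt equations with \<open>z = \<partial>\<^sub>tu - \<alpha>\<^sup>2 \<partial>\<^sub>t\<Delta>u\<close>.\<close>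

lemma momentum_balance:
  assumes u: "u \<in> sobolev 3" "weakly_div_free u" "has_weak_jacobian u G" "has_weak_gradient p q"
    and z: "z \<in> L2_torus" and eq: "AE x in torus. z x + G x *v u x + q x = 0"
  shows "fourier_coeff z 0 = 0"
proof -
  have u2: "u \<in> L2_torus" using u by (simp add: sobolev_L2)
  have q2: "q \<in> L2_torus" using u by (simp add: has_weak_gradient_def)
  note w = sobolev3_jacobian_wiener(1)[OF u(1,3)]
  have int: "integrable torus (\<lambda>x. u x $ j * G x $ i $ j)" for i j
    by (intro integrable_mult_wiener integrable_component u2 w)
  have "(\<integral>x. z x $ i \<partial>torus) = 0" for i
  proof -
    have "(\<integral>x. z x $ i \<partial>torus) = (\<integral>x. - (\<Sum>j\<in>UNIV. u x $ j * G x $ i $ j) - q x $ i \<partial>torus)"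
    proof (rule integral_cong_AE)
      show "AE x in torus. z x $ i = - (\<Sum>j\<in>UNIV. u x $ j * G x $ i $ j) - q x $ i"
        using eq
      proof eventually_elim
        case (elim x)
        have "(z x + G x *v u x + q x) $ i = 0" unfolding elim by simp
        then show ?case by (simp add: matrix_vector_mult_def mult.commute)
      qed
    qed (use integrable_component[OF z, of i] integrable_component[OF q2, of i] int[of _ i] in auto)
    also have "\<dots> = - (\<Sum>j\<in>UNIV. \<integral>x. u x $ j * G x $ i $ j \<partial>torus) - (\<integral>x. q x $ i \<partial>torus)"
      using int integrable_component[OF q2] by simp
    also have "(\<Sum>j\<in>UNIV. \<integral>x. u x $ j * G x $ i $ j \<partial>torus) = 0"
      by (rule transport_mean_zero[OF u(2) u2 has_weak_jacobianD(3)[OF u(3)] w])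
    also have "(\<integral>x. q x $ i \<partial>torus) = 0"
    proof -
      have "fourier_coeff q 0 $ i = 0" using gradient_mean_zero[OF u(4)] by simp
      then show ?thesis by (simp add: fourier_coeff_component integrable_component q2 complex_eq_iff cos_coeff_def)
    qed
    finally show ?thesis by simp
  qed
  then show ?thesis
    by (simp add: vec_eq_iff fourier_coeff_component integrable_component z complex_eq_iff cos_coeff_def sin_coeff_def)
qed

lemma mean_conserved:
  assumes u: "C1_sobolev T r u v" and r: "0 \<le> r" and z: "\<And>t. t \<in> {0..T} \<Longrightarrow> fourier_coeff (v t) 0 = 0"
    and t: "t \<in> {0..T}"
  shows "fourier_coeff (u t) 0 = fourier_coeff (u 0) 0"
proof -
  have "fourier_coeff (u t) 0 \<bullet> b = fourier_coeff (u 0) 0 \<bullet> b" for b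
  proof -
  have "((\<lambda>\<tau>. fourier_coeff (u \<tau>) 0 \<bullet> b) has_real_derivative 0) (at s within {0..T})" if s: "s \<in> {0..T}" for s
    using tendsto_inner[OF C1_sobolev_coeff_derivative[OF u r s, of 0] tendsto_const[of b]]
    by (simp add: has_field_derivative_iff z[OF s] inner_diff_left divide_inverse mult.commute)
  then have "\<exists>c. \<forall>s\<in>{0..T}. fourier_coeff (u s) 0 \<bullet> b = c"
    by (intro has_field_derivative_zero_constant) auto
  then show ?thesis using t by fastforce
  qed
  then show ?thesis by (metis vector_eq_rdot)
qed

definition fourier_sum_field :: "(int^3) set \<Rightarrow> field3 \<Rightarrow> field3" where
  "fourier_sum_field K f x = (\<chi> i. partial_fourier K (\<lambda>y. f y $ i) x)"

lemma fourier_sum_field_component: "fourier_sum_field K f x $ i = partial_fourier K (\<lambda>y. f y $ i) x"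
  by (simp add: fourier_sum_field_def)

lemma L2_torus_trig_field:
  fixes \<phi> :: field3
  assumes "\<And>i. trigp (\<lambda>x. \<phi> x $ i)"
  shows "\<phi> \<in> L2_torus"
proof -
  have e: "\<phi> x = (\<Sum>i\<in>UNIV. \<phi> x $ i *\<^sub>R axis i 1)" for x
    by (simp add: vec_eq_iff axis_def if_distrib[of "\<lambda>y. _ * y"] sum.delta cong: if_cong)
  have "(\<lambda>x. \<Sum>i\<in>UNIV. \<phi> x $ i *\<^sub>R axis i (1::real)) \<in> borel_measurable torus"
    using trigp_measurable[OF assms] by measurable
  then have "\<phi> \<in> borel_measurable torus" by (simp only: e[symmetric])
  moreover have "integrable torus (\<lambda>x. (norm (\<phi> x))\<^sup>2)"
    unfolding norm_vec_power2 using integrable_mult_trigp[OF integrable_trigp[OF assms] assms]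
    by (simp add: power2_eq_square)
  ultimately show ?thesis by (simp add: L2_torus_def)
qed

text \<open>Divergence and mean are read off from the coefficients, so both properties pass to partial sums.\<close>

lemma fourier_sum_field_solenoidal:
  assumes f: "f \<in> L2_torus" "weakly_div_free f" "fourier_coeff f 0 = 0" and K: "finite K"
  shows "fourier_sum_field K f \<in> solenoidal_trig"
proof -
  let ?c = "\<lambda>k. \<chi> i. cos_coeff k (\<lambda>y. f y $ i)" and ?d = "\<lambda>k. \<chi> i. sin_coeff k (\<lambda>y. f y $ i)"
  have "fourier_sum_field K f = (\<lambda>x. \<Sum>k\<in>K. cos (wave_vec k \<bullet> x) *\<^sub>R ?c k + sin (wave_vec k \<bullet> x) *\<^sub>R ?d k)"
    by (simp add: fun_eq_iff vec_eq_iff fourier_sum_field_component partial_fourier_def mult.commute)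
  then have tp: "trig_polynomial (fourier_sum_field K f)"
    unfolding trig_polynomial_def using K by (intro exI[of _ K] exI[of _ ?c] exI[of _ ?d]) simp
  have comp: "(\<lambda>y. fourier_sum_field K f y $ j) = partial_fourier K (\<lambda>y. f y $ j)" for j
    by (simp add: fun_eq_iff fourier_sum_field_component)
  have div: "(\<Sum>j\<in>UNIV. partial j (\<lambda>y. fourier_sum_field K f y $ j) x) = 0" for x
  proof -
    have "(\<Sum>j\<in>UNIV. partial j (\<lambda>y. fourier_sum_field K f y $ j) x) =
      (\<Sum>k\<in>K. \<Sum>j\<in>UNIV. wave_vec k $ j * sin_coeff k (\<lambda>y. f y $ j) * cos (wave_vec k \<bullet> x)
        - wave_vec k $ j * cos_coeff k (\<lambda>y. f y $ j) * sin (wave_vec k \<bullet> x))"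
      unfolding comp partial_partial_fourier_eq by (rule sum.swap)
    also have "\<dots> = 0"
      by (simp add: sum_subtractf sum_distrib_right[symmetric] weakly_div_free_coeff[OF f(2,1)])
    finally show ?thesis .
  qed
  have t: "trigp (\<lambda>y. fourier_sum_field K f y $ j)" for j
    unfolding comp by (rule trigp_partial_fourier)
  have int: "integrable torus (fourier_sum_field K f)"
    by (rule L2_torus_integrable[OF L2_torus_trig_field[OF t]])
  have "(\<integral>x. fourier_sum_field K f x \<partial>torus) $ i = 0" for i
  proof -
    have "(\<integral>x. fourier_sum_field K f x \<partial>torus) $ i = (\<integral>x. fourier_sum_field K f x $ i \<partial>torus)"
      using integral_inner_left[OF int, of "axis i 1"] by (simp add: inner_axis)
    also have "\<dots> = cos_coeff 0 (partial_fourier K (\<lambda>y. f y $ i))"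
      by (simp add: fourier_sum_field_component cos_coeff_def)
    also have "\<dots> = 0"
    proof -
      have "fourier_coeff f 0 $ i = 0" using f(3) by simp
      then have "cos_coeff 0 (\<lambda>y. f y $ i) = 0"
        by (simp add: fourier_coeff_component integrable_component f(1) complex_eq_iff)
      then have "cos_coeff k (\<lambda>y. f y $ i) * ((of_bool (0 = k) + of_bool (0 = - k)) / 2) = 0" for k
        by (cases "k = 0") auto
      then show ?thesis unfolding coeff_partial_fourier_eq_sum by (intro sum.neutral ballI)
    qed
    finally show ?thesis .
  qed
  then have "(\<integral>x. fourier_sum_field K f x \<partial>torus) = 0" by (simp add: vec_eq_iff)
  then show ?thesis using tp div by (simp add: solenoidal_trig_def)
qed

text \<open>The partial sums are admissible approximants and converge uniformly.\<close>

lemma sobolev3_H_space: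
  assumes f: "f \<in> sobolev 3" "weakly_div_free f" "fourier_coeff f 0 = 0"
  shows "f \<in> H_space"
proof -
  let ?d = "\<lambda>K x. f x - fourier_sum_field K f x"
  have f2: "f \<in> L2_torus" using f by (simp add: sobolev_L2)
  let ?t = "\<lambda>K. \<Sum>i\<in>UNIV. (fourier_tail (\<lambda>x. f x $ i) K)\<^sup>2"
  have bound: "(L2_torus_norm (?d K))\<^sup>2 \<le> ?t K" if K: "finite K" for K
  proof -
    have S2: "fourier_sum_field K f \<in> L2_torus"
      by (rule L2_torus_trig_field) (simp add: fourier_sum_field_component trigp_partial_fourier)
    note D = L2_torus_diff[OF f2 S2]
    have "(\<integral>x. ?d K x $ i * ?d K x $ i \<partial>torus)
        \<le> (fourier_tail (\<lambda>x. f x $ i) K)\<^sup>2" for i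
    proof -
      have "(\<integral>x. ?d K x $ i * ?d K x $ i \<partial>torus)
        \<le> (\<integral>x. (fourier_tail (\<lambda>x. f x $ i) K)\<^sup>2 \<partial>torus)"
      proof (rule integral_mono_AE)
        show "integrable torus (\<lambda>x. ?d K x $ i * ?d K x $ i)"
          by (intro L2_torus_mult_integrable L2_torus_component D)
        show "AE x in torus. ?d K x $ i * ?d K x $ i \<le> (fourier_tail (\<lambda>x. f x $ i) K)\<^sup>2"
          using wiener_uniform_approx[OF sobolev3_wiener[OF f(1), of i]]
        proof eventually_elim
          case (elim x)
          then have "\<bar>?d K x $ i\<bar> \<le> fourier_tail (\<lambda>x. f x $ i) K"
            using K by (simp add: fourier_sum_field_component)
          from power_mono[OF this abs_ge_zero, of 2] show ?case by (simp add: power2_eq_square)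
        qed
      qed simp
      then show ?thesis by (simp add: measure_torus)
    qed
    then show ?thesis unfolding L2_torus_norm_power2[OF D] by (intro sum_mono)
  qed
  have lim: "(?t \<longlongrightarrow> 0) (finite_subsets_at_top UNIV)"
    using fourier_tail_tendsto_0[OF sobolev3_wiener[OF f(1)]] by (auto intro!: tendsto_eq_intros)
  have "\<exists>\<phi>\<in>solenoidal_trig. L2_torus_norm (\<lambda>x. f x - \<phi> x) < \<epsilon>" if \<epsilon>: "0 < \<epsilon>" for \<epsilon>
  proof -
    have "\<forall>\<^sub>F K in finite_subsets_at_top UNIV. ?t K < \<epsilon>\<^sup>2"
      using order_tendstoD(2)[OF lim, of "\<epsilon>\<^sup>2"] \<epsilon> by simp
    then obtain K where K: "finite K" "?t K < \<epsilon>\<^sup>2" unfolding eventually_finite_subsets_at_top by blast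
    then have "(L2_torus_norm (?d K))\<^sup>2 < \<epsilon>\<^sup>2" using bound[of K] by simp
    then have "L2_torus_norm (?d K) < \<epsilon>"
      using \<epsilon> by (intro power2_less_imp_less[of _ \<epsilon>]) auto
    then show ?thesis using fourier_sum_field_solenoidal[OF f2 f(2,3) K(1)] by blast
  qed
  then show ?thesis using f2 by (simp add: H_space_def)
qed

lemma trig_polynomial_trigp:
  assumes "trig_polynomial \<phi>"
  shows "trigp (\<lambda>x. \<phi> x $ i)"
proof -
  obtain K c d where "finite K" and \<phi>: "\<phi> = (\<lambda>x. \<Sum>k\<in>K. cos (wave_vec k \<bullet> x) *\<^sub>R c k + sin (wave_vec k \<bullet> x) *\<^sub>R d k)"
    using assms unfolding trig_polynomial_def by blast
  have "(\<lambda>x. \<phi> x $ i) = (\<lambda>x. \<Sum>k\<in>K. (c k $ i) * cos (wave_vec k \<bullet> x) + (d k $ i) * sin (wave_vec k \<bullet> x))"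
    by (simp add: \<phi> fun_eq_iff mult.commute)
  then show ?thesis by (simp add: trigp_sum trigp.add trigp_cmult trigp.cos trigp.sin)
qed

lemma trig_polynomial_sobolev:
  assumes \<phi>: "trig_polynomial \<phi>"
  shows "\<phi> \<in> sobolev r"
proof -
  obtain K c d where K: "finite K" and \<phi>: "\<phi> = (\<lambda>x. \<Sum>k\<in>K. cos (wave_vec k \<bullet> x) *\<^sub>R c k + sin (wave_vec k \<bullet> x) *\<^sub>R d k)"
    using assms unfolding trig_polynomial_def by blast
  have comp: "(\<lambda>x. \<phi> x $ i) = (\<lambda>x. \<Sum>k\<in>K. (c k $ i) * cos (wave_vec k \<bullet> x) + (d k $ i) * sin (wave_vec k \<bullet> x))" for i
    by (simp add: \<phi> fun_eq_iff mult.commute)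
  note int = integrable_trigp[OF trigp.cos] integrable_trigp[OF trigp.sin]
  \<comment> \<open>the frequencies \<open>k\<close> and \<open>-k\<close> share their real waves, hence the reflected copy of \<open>K\<close>\<close>
  have zero: "fourier_coeff \<phi> l = 0" if l: "l \<notin> K \<union> uminus ` K" for l
  proof -
    have "k \<in> K \<Longrightarrow> l \<noteq> k \<and> l \<noteq> - k" for k using l by auto
    then have "cos_coeff l (\<lambda>x. \<phi> x $ i) = 0" "sin_coeff l (\<lambda>x. \<phi> x $ i) = 0" for i
      unfolding comp by (simp_all add: coeff_sum coeff_lincomb int coeff_wave)
    then show ?thesis
      by (simp add: vec_eq_iff fourier_coeff_component integrable_trigp trig_polynomial_trigp[OF assms] complex_eq_iff)
  qed
  have "(\<lambda>k. bessel_weight r k * (norm (fourier_coeff \<phi> k))\<^sup>2) summable_on (K \<union> uminus ` K)"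
    using K by (intro summable_on_finite) auto
  then have "(\<lambda>k. bessel_weight r k * (norm (fourier_coeff \<phi> k))\<^sup>2) summable_on UNIV"
    by (subst (asm) summable_on_cong_neutral[where T = UNIV]) (auto simp: zero)
  then show ?thesis
    using L2_torus_trig_field[OF trig_polynomial_trigp[OF assms]] by (simp add: sobolev_iff wsq_summable_def)
qed

text \<open>The mean is one of the coefficients, hence continuous in \<open>H\<^sup>1\<close>, and it vanishes on the approximating
  trigonometric polynomials.\<close>

lemma V_space_mean_zero:
  assumes f: "f \<in> V_space"
  shows "fourier_coeff f 0 = 0"
proof -
  have f1: "f \<in> sobolev 1" using f by (simp add: V_space_def)
  have "norm (fourier_coeff f 0) \<le> 0 + \<epsilon>" if \<epsilon>: "0 < \<epsilon>" for \<epsilon>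
  proof -
    obtain \<phi> where \<phi>: "\<phi> \<in> solenoidal_trig" "sobolev_norm 1 (\<lambda>x. f x - \<phi> x) < \<epsilon>"
      using f \<epsilon> by (auto simp: V_space_def)
    have tp: "trig_polynomial \<phi>" and mean: "(\<integral>x. \<phi> x \<partial>torus) = 0" using \<phi>(1) by (auto simp: solenoidal_trig_def)
    note p1 = trig_polynomial_sobolev[OF tp, of 1]
    have p2: "\<phi> \<in> L2_torus" using p1 by (rule sobolev_L2)
    have "(\<integral>x. \<phi> x $ i \<partial>torus) = 0" for i
      using integral_inner_left[OF L2_torus_integrable[OF p2], of "axis i 1"] mean by (simp add: inner_axis)
    then have "fourier_coeff \<phi> 0 = 0"
      by (simp add: vec_eq_iff fourier_coeff_component integrable_component p2 complex_eq_iff cos_coeff_def sin_coeff_def)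
    then have "norm (fourier_coeff f 0) = norm (fourier_coeff (\<lambda>x. f x - \<phi> x) 0)"
      by (simp add: fourier_coeff_diff sobolev_L2[OF f1] p2)
    also have "\<dots> \<le> sobolev_norm 1 (\<lambda>x. f x - \<phi> x)"
      by (intro fourier_coeff_le_sobolev_norm sobolev_diff f1 p1) simp
    finally show ?thesis using \<phi>(2) by simp
  qed
  then have "norm (fourier_coeff f 0) \<le> 0" by (rule field_le_epsilon)
  then show ?thesis by simp
qed

lemma C0_H_I:
  assumes s: "3 \<le> s" and u: "C0_sobolev T s u" and H: "\<And>t. t \<in> {0..T} \<Longrightarrow> u t \<in> H_space"
  shows "C0_H T u"
  unfolding C0_H_def
proof (intro ballI conjI H)
  fix t assume t: "t \<in> {0..T}"
  have lim: "((\<lambda>\<tau>. sobolev_norm s (\<lambda>x. u \<tau> x - u t x)) \<longlongrightarrow> 0) (at t within {0..T})"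
    using u t by (simp add: C0_sobolev_def)
  show "((\<lambda>\<tau>. L2_torus_norm (\<lambda>x. u \<tau> x - u t x)) \<longlongrightarrow> 0) (at t within {0..T})"
  proof (rule Lim_null_comparison[OF _ lim])
    show "\<forall>\<^sub>F \<tau> in at t within {0..T}. norm (L2_torus_norm (\<lambda>x. u \<tau> x - u t x)) \<le> sobolev_norm s (\<lambda>x. u \<tau> x - u t x)"
      unfolding eventually_at_filter
    proof (intro always_eventually allI impI)
      fix \<tau> assume "\<tau> \<in> {0..T}"
      then have d: "(\<lambda>x. u \<tau> x - u t x) \<in> sobolev s" using C0_sobolevD[OF u] t by (intro sobolev_diff)
      let ?d = "\<lambda>x. u \<tau> x - u t x"
      have "((\<lambda>k. (norm (fourier_coeff ?d k))\<^sup>2) has_sum (L2_torus_norm ?d)\<^sup>2) UNIV"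
        by (rule sobolev3_L2_norm[OF sobolev_mono(1)[OF s d]])
      moreover have "((\<lambda>k. bessel_weight s k * (norm (fourier_coeff ?d k))\<^sup>2) has_sum wsq (bessel_weight s) (fourier_coeff ?d)) UNIV"
        using d by (intro bessel.wsq_has_sum) (simp add: sobolev_iff)
      moreover have "(norm (fourier_coeff ?d k))\<^sup>2 \<le> bessel_weight s k * (norm (fourier_coeff ?d k))\<^sup>2" for k
      proof -
        have "1 \<le> bessel_weight s k" unfolding bessel_weight_def using s by (intro ge_one_powr_ge_zero) auto
        then have "1 * (norm (fourier_coeff ?d k))\<^sup>2 \<le> bessel_weight s k * (norm (fourier_coeff ?d k))\<^sup>2"
          by (intro mult_right_mono) auto
        then show ?thesis by simp
      qed
      ultimately have "(L2_torus_norm ?d)\<^sup>2 \<le> wsq (bessel_weight s) (fourier_coeff ?d)" by (rule has_sum_mono)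
      then have "sqrt ((L2_torus_norm ?d)\<^sup>2) \<le> sobolev_norm s ?d"
        unfolding sobolev_norm_wsq by (rule real_sqrt_le_mono)
      then show "norm (L2_torus_norm ?d) \<le> sobolev_norm s ?d" by simp
    qed
  qed
qed

lemma mean_zero_curve_C0_H:
  assumes s: "3 \<le> s" and T: "0 < T" and uin: "uin \<in> sobolev s \<inter> V_space" and ini: "AE x in torus. u 0 x = uin x"
    and u: "C0_sobolev T s u" "C1_sobolev T (s - 1) u v"
    and div: "\<And>t. t \<in> {0..T} \<Longrightarrow> weakly_div_free (u t)"
    and v0: "\<And>t. t \<in> {0..T} \<Longrightarrow> fourier_coeff (v t) 0 = 0"
  shows "C0_H T u"
proof -
  have u3: "u t \<in> sobolev 3" if "t \<in> {0..T}" for t using sobolev_mono(1)[OF s C0_sobolevD[OF u(1) that]] .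
  have 0: "0 \<in> {0..T}" using T by simp
  have "fourier_coeff (u 0) 0 = fourier_coeff uin 0"
    using uin by (intro fourier_coeff_cong_AE[OF ini] sobolev_L2[OF u3[OF 0]] sobolev_L2) auto
  then have "fourier_coeff (u 0) 0 = 0" using V_space_mean_zero uin by simp
  then have "fourier_coeff (u t) 0 = 0" if "t \<in> {0..T}" for t
    using mean_conserved[OF u(2) _ v0 that] s by simp
  then show ?thesis using div u3 by (intro C0_H_I[OF s u(1)] sobolev3_H_space) auto
qed

lemma euler_solution_C0_H:
  assumes s: "3 \<le> s" and T: "0 < T" and uin: "uin \<in> sobolev s \<inter> V_space" and sol: "euler_solution s T uin u"
  shows "C0_H T u"
proof -
  obtain v where u0: "C0_sobolev T s u" and u1: "C1_sobolev T (s - 1) u v"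
    and ueq: "\<And>t. t \<in> {0..T} \<Longrightarrow> weakly_div_free (u t) \<and>
         (\<exists>G p q. has_weak_jacobian (u t) G \<and> has_weak_gradient p q \<and> (AE x in torus. v t x + G x *v u t x + q x = 0))"
    and ini: "AE x in torus. u 0 x = uin x"
    using sol unfolding euler_solution_def by blast
  have "fourier_coeff (v t) 0 = 0" if t: "t \<in> {0..T}" for t
    using ueq[OF t] momentum_balance[OF sobolev_mono(1)[OF s C0_sobolevD[OF u0 t]] _ _ _ sobolev_L2[OF C1_sobolevD(2)[OF u1 t]]]
    by blast
  with ueq show ?thesis by (intro mean_zero_curve_C0_H[OF s T uin ini u0 u1]) auto
qed

lemma euler_voigt_solution_C0_H:
  assumes s: "3 \<le> s" and T: "0 < T" and uin: "uin \<in> sobolev s \<inter> V_space" and sol: "euler_voigt_solution \<alpha> s T uin u"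
  shows "C0_H T u"
proof -
  obtain v L m where u0: "C0_sobolev T s u" and u1: "C1_sobolev T (s - 1) u v"
    and lap: "\<And>t. t \<in> {0..T} \<Longrightarrow> has_weak_laplacian (u t) (L t)" and L: "C1_sobolev T (s - 3) L m"
    and ueq: "\<And>t. t \<in> {0..T} \<Longrightarrow> weakly_div_free (u t) \<and>
         (\<exists>G p q. has_weak_jacobian (u t) G \<and> has_weak_gradient p q \<and>
            (AE x in torus. - \<alpha>\<^sup>2 *\<^sub>R m t x + v t x + G x *v u t x + q x = 0))"
    and ini: "AE x in torus. u 0 x = uin x"
    using sol unfolding euler_voigt_solution_def by blast
  have "fourier_coeff (v t) 0 = 0" if t: "t \<in> {0..T}" for t
  proof -
    have m2: "m t \<in> L2_torus" and v2: "v t \<in> L2_torus"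
      using C1_sobolevD(2)[OF L t] C1_sobolevD(2)[OF u1 t] by (auto intro: sobolev_L2)
    have z2: "(\<lambda>x. - \<alpha>\<^sup>2 *\<^sub>R m t x + v t x) \<in> L2_torus" by (intro L2_torus_add L2_torus_scaleR m2 v2)
    have "fourier_coeff (\<lambda>x. - \<alpha>\<^sup>2 *\<^sub>R m t x + v t x) 0 = 0"
      using ueq[OF t] momentum_balance[OF sobolev_mono(1)[OF s C0_sobolevD[OF u0 t]] _ _ _ z2] by blast
    moreover have "fourier_coeff (m t) 0 = 0"
      using laplacian_time_derivative[OF T u1 _ L _ lap t, of 0] s by simp
    moreover have "fourier_coeff (\<lambda>x. - \<alpha>\<^sup>2 *\<^sub>R m t x + v t x) 0 = - \<alpha>\<^sup>2 *\<^sub>R fourier_coeff (m t) 0 + fourier_coeff (v t) 0"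
      using fourier_coeff_lincomb[of "m t" "v t" "- \<alpha>\<^sup>2" 1 0] m2 v2 by (simp add: integrable_component)
    ultimately show ?thesis by simp
  qed
  with ueq show ?thesis by (intro mean_zero_curve_C0_H[OF s T uin ini u0 u1]) auto
qed

section \<open>Convergence\<close>

lemma voigt_energy_AE_zero:
  assumes f: "f \<in> sobolev 3" and eq: "AE x in torus. f x = 0"
  shows "voigt_energy \<alpha> f = 0"
proof -
  have f2: "f \<in> L2_torus" by (rule sobolev_L2[OF f])
  have z2: "(\<lambda>x. 0 :: real^3) \<in> L2_torus" by (simp add: L2_torus_def)
  have "has_weak_jacobian (\<lambda>x. 0) (\<lambda>x. 0)"
    using z2 by (simp add: has_weak_jacobian_def has_weak_partial_def L2_torus_def)
  then have J: "has_weak_jacobian f (\<lambda>x. 0)"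
    by (rule has_weak_jacobian_cong_AE) (use eq f2 in auto)
  have "fourier_coeff f k = 0" for k
    using fourier_coeff_cong_AE[OF eq f2 z2, of k] by (simp add: fourier_coeff_def vec_eq_iff)
  then show ?thesis by (simp add: voigt_energy_wsq[OF f J] wsq_def)
qed

lemma energy_bound_imp_convergence:
  assumes s: "3 \<le> s" and T: "0 < T" and uin: "uin \<in> sobolev s \<inter> V_space" and sol: "euler_solution s T uin u"
    and C: "0 < C"
    and est: "\<And>\<alpha> t. 0 < \<alpha> \<Longrightarrow> t \<in> {0..T} \<Longrightarrow> voigt_energy \<alpha> (\<lambda>x. u t x - ua \<alpha> t x)
        \<le> voigt_energy \<alpha> (\<lambda>x. uin x - uain \<alpha> x) * exp (C * t) + C * \<alpha>\<^sup>2 * (exp (C * t) - 1)"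
    and asol: "\<And>\<alpha>. 0 < \<alpha> \<Longrightarrow> uain \<alpha> \<in> sobolev s \<inter> V_space \<and> euler_voigt_solution \<alpha> s T (uain \<alpha>) (ua \<alpha>)"
    and lim: "((\<lambda>\<alpha>. voigt_energy \<alpha> (\<lambda>x. uin x - uain \<alpha> x)) \<longlongrightarrow> 0) (at_right 0)"
  shows "converges_in_C0_H T ua u"
proof -
  let ?n = "\<lambda>\<alpha> t. L2_torus_norm (\<lambda>x. ua \<alpha> t x - u t x)" and ?E = "\<lambda>\<alpha>. voigt_energy \<alpha> (\<lambda>x. uin x - uain \<alpha> x)"
  define e where "e \<alpha> = sqrt (?E \<alpha> * exp (C * T) + C * \<alpha>\<^sup>2 * (exp (C * T) - 1))" for \<alpha>
  have e_lim: "(e \<longlongrightarrow> 0) (at_right 0)"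
    unfolding e_def by (rule tendsto_eq_intros lim refl)+ simp
  have en0: "0 \<le> voigt_energy \<alpha> f" for \<alpha> f by (simp add: voigt_energy_def)
  have L2: "?n \<alpha> t \<le> e \<alpha>" if \<alpha>: "0 < \<alpha>" and t: "t \<in> {0..T}" for \<alpha> t
  proof -
    have "(?n \<alpha> t)\<^sup>2 = (L2_torus_norm (\<lambda>x. u t x - ua \<alpha> t x))\<^sup>2"
      by (simp add: L2_torus_norm_def norm_minus_commute)
    also have "\<dots> \<le> voigt_energy \<alpha> (\<lambda>x. u t x - ua \<alpha> t x)" by (simp add: voigt_energy_def)
    also have "\<dots> \<le> ?E \<alpha> * exp (C * t) + C * \<alpha>\<^sup>2 * (exp (C * t) - 1)"
      by (rule est[OF \<alpha> t])
    also have "\<dots> \<le> ?E \<alpha> * exp (C * T) + C * \<alpha>\<^sup>2 * (exp (C * T) - 1)"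
      using t C en0 by (intro add_mono mult_left_mono) auto
    finally have "sqrt ((?n \<alpha> t)\<^sup>2) \<le> e \<alpha>"
      unfolding e_def by (rule real_sqrt_le_mono)
    then show ?thesis by simp
  qed
  have n0: "0 \<le> L2_torus_norm f" for f :: field3 by (simp add: L2_torus_norm_def)
  have "((\<lambda>\<alpha>. SUP t\<in>{0..T}. ?n \<alpha> t) \<longlongrightarrow> 0) (at_right 0)"
  proof (rule Lim_null_comparison[OF _ e_lim])
    have "norm (SUP t\<in>{0..T}. ?n \<alpha> t) \<le> e \<alpha>" if \<alpha>: "0 < \<alpha>" for \<alpha>
    proof -
      have "(SUP t\<in>{0..T}. ?n \<alpha> t) \<le> e \<alpha>"
        using T L2[OF \<alpha>] by (intro cSUP_least) auto
      moreover have "0 \<le> (SUP t\<in>{0..T}. ?n \<alpha> t)"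
        using T L2[OF \<alpha>] by (intro cSUP_upper2[of _ _ 0] bdd_aboveI2[where M="e \<alpha>"] n0) auto
      ultimately show ?thesis by simp
    qed
    then show "\<forall>\<^sub>F \<alpha> in at_right 0. norm (SUP t\<in>{0..T}. ?n \<alpha> t) \<le> e \<alpha>"
      by (auto simp: eventually_at_filter)
  qed
  then show ?thesis
    using euler_solution_C0_H[OF s T uin sol] euler_voigt_solution_C0_H[OF s T] asol
    by (auto simp: converges_in_C0_H_def)
qed

theorem theorem5p1:
  fixes s T :: real
    and uin :: field3
    and u :: "real \<Rightarrow> field3"
  assumes "s \<ge> 3"
    and "uin \<in> sobolev s \<inter> V_space"
    and "0 < T"
    and "ereal T < euler_Tmax s uin"
    and "euler_solution s T uin u"
  shows "(\<exists>C>0. \<forall>\<alpha>>0. \<forall>uain ua.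
            uain \<in> sobolev s \<inter> V_space \<longrightarrow> euler_voigt_solution \<alpha> s T uain ua \<longrightarrow>
            (\<forall>t\<in>{0..T}.
               voigt_energy \<alpha> (\<lambda>x. u t x - ua t x)
               \<le> voigt_energy \<alpha> (\<lambda>x. uin x - uain x) * exp (C * t)
                 + C * \<alpha>\<^sup>2 * (exp (C * t) - 1)))
       \<and> (\<forall>(uain :: real \<Rightarrow> field3) (ua :: real \<Rightarrow> real \<Rightarrow> field3).
            (\<forall>\<alpha>>0. uain \<alpha> \<in> sobolev s \<inter> V_space \<and> euler_voigt_solution \<alpha> s T (uain \<alpha>) (ua \<alpha>)) \<longrightarrow>
            (((\<lambda>\<alpha>. voigt_energy \<alpha> (\<lambda>x. uin x - uain \<alpha> x)) \<longlongrightarrow> 0) (at_right 0)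
               \<longrightarrow> converges_in_C0_H T ua u)
            \<and> ((\<forall>\<alpha>>0. AE x in torus. uain \<alpha> x = uin x) \<longrightarrow> converges_in_C0_H T ua u))"
proof -
  have uin: "uin \<in> sobolev s" using assms(2) by simp
  obtain C where C: "C > 0" and est: "\<And>\<alpha> uain ua t. uain \<in> sobolev s \<Longrightarrow> euler_voigt_solution \<alpha> s T uain ua \<Longrightarrow> t \<in> {0..T} \<Longrightarrow>
      voigt_energy \<alpha> (\<lambda>x. u t x - ua t x)
        \<le> voigt_energy \<alpha> (\<lambda>x. uin x - uain x) * exp (C * t) + C * \<alpha>\<^sup>2 * (exp (C * t) - 1)"
    using energy_inequality[OF assms(1,3) uin assms(5)] by blast
  show ?thesis
  proof (intro conjI exI[of _ C] allI impI ballI)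
    fix uain :: "real \<Rightarrow> field3" and ua :: "real \<Rightarrow> real \<Rightarrow> field3"
    let ?E = "\<lambda>\<alpha>. voigt_energy \<alpha> (\<lambda>x. uin x - uain \<alpha> x)"
    assume sol: "\<forall>\<alpha>>0. uain \<alpha> \<in> sobolev s \<inter> V_space \<and> euler_voigt_solution \<alpha> s T (uain \<alpha>) (ua \<alpha>)"
    show conv: "converges_in_C0_H T ua u" if "(?E \<longlongrightarrow> 0) (at_right 0)"
      using sol that by (intro energy_bound_imp_convergence[OF assms(1,3,2,5) C est]) auto
    show "converges_in_C0_H T ua u" if eq: "\<forall>\<alpha>>0. AE x in torus. uain \<alpha> x = uin x"
    proof (rule conv, rule tendsto_eventually)
      have "?E \<alpha> = 0" if "\<alpha> > 0" for \<alpha>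
        using sobolev_mono(1)[OF assms(1) sobolev_diff[OF uin]] sol eq that
        by (intro voigt_energy_AE_zero) auto
      then show "\<forall>\<^sub>F \<alpha> in at_right 0. ?E \<alpha> = 0" by (auto simp: eventually_at_filter)
    qed
  qed (use C est in auto)
qed

end
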